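(* Let $P_{XY}$ be a distribution on $\mathcal{X}\times\mathcal{Y}$ with support $\mathcal{S}=\mathsf{supp}(P_{XY})$ and $\mathsf{supp}(P_X)=\mathcal{X}$, and let $f:\mathcal{X}\times\mathcal{Y}\to\mathcal{V}=\{0,\dots,m-1\}$. Let $\mathcal{G}=(\mathcal{X},\mathcal{E})$ be the hypergraph with $\mathcal{E}=\mathcal{E}(\mathcal{S},f)$, the set of all maximal solvable hyperedges for $(\mathcal{S},f)$. Then for the i.i.d. source $(\mathbf{X},\mathbf{Y})$ with $P_{X^nY^n}=P_{XY}^n$ and $\mathbf{f}^{\mathsf t}=\{f_n^{\mathsf t}\}$, $$R(\mathbf{X}|\mathbf{Y}|\mathbf{f}^{\mathsf t})=H_{\mathcal{G}}(X|Y).$$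
   Context: Finite alphabets $\mathcal{X}=\{0,\dots,|\mathcal{X}|-1\}$, $\mathcal{Y}=\{0,\dots,|\mathcal{Y}|-1\}$. The type of $\mathbf{s}\in\mathcal{S}^n$ is $P_{\mathbf{s}}(s)=|\{i:s_i=s\}|/n$. $f_n^{\mathsf t}(\mathbf{x},\mathbf{y})$ is the type of $(f(x_1,y_1),\dots,f(x_n,y_n))$. For a sequence $\mathbf{f}=\{f_n\}$, a code is an encoder $\varphi_n:\mathcal{X}^n\to\mathcal{M}_n$ and decoder $\psi_n:\mathcal{M}_n\times\mathcal{Y}^n\to\mathcal{Z}_n$; a rate $R$ is achievable if codes exist with $\Pr(\psi_n(\varphi_n(X^n),Y^n)\ne f_n(X^n,Y^n))\to0$ and $\limsup\frac1n\log|\mathcal{M}_n|\le R$; $R(\mathbf{X}|\mathbf{Y}|\mathbf{f})$ is the infimum of achievable rates (logs base 2). Simple loop / solvability: for $\mathcal{A}\times\mathcal{B}\subseteq\mathcal{X}\times\mathcal{Y}$, a simple loop is a set $\{(a_0,b_0),(a_0,b_1),(a_1,b_1),(a_1,b_2),\dots,(a_{k-2},b_{k-1}),(a_{k-1},b_{k-1}),(a_{k-1},b_0)\}\subseteq(\mathcal{A}\times\mathcal{B})\cap\mathcal{S}$ with the $a_i$ pairwise distinct and the $b_i$ pairwise distinct. For $v\in\mathcal{V}$ let $\mathcal{I}_+(v)=\{0\le i\le k-1: f(a_i,b_i)=v\}$ and $\mathcal{I}_-(v)=\{0\le i\le k-1: f(a_i,b_{i+1\bmod k})=v\}$. $\mathcal{A}\times\mathcal{B}$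 is solvable for $(\mathcal{S},f)$ if every simple loop in it satisfies $|\mathcal{I}_+(v)|=|\mathcal{I}_-(v)|$ for all $v\in\mathcal{V}$ (vacuous if no simple loop). A set $e\subseteq\mathcal{X}$ is a solvable hyperedge if $e\times\mathcal{Y}$ is solvable for $(\mathcal{S},f)$; $\mathcal{E}(\mathcal{S},f)$ is the set of inclusion-maximal solvable hyperedges. Conditional hypergraph entropy: for a hypergraph $\mathcal{G}=(\mathcal{X},\mathcal{E})$, $\mathcal{E}\subseteq 2^{\mathcal{X}}$, $H_{\mathcal{G}}(X|Y)=\min I(W\wedge X|Y)$, where the minimum is over random variables $W$ taking values in $\mathcal{E}$ such that $W - X - Y$ is a Markov chain and $\Pr(X\in W)=1$ (i.e., over channels $P_{W|X}$ with $\sum_{w\ni x}P_{W|X}(w|x)=1$ for all $x$). *)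

theory Defs
  imports Complex_Main "HOL-Library.Extended_Real" "HOL-Library.Liminf_Limsup"
begin

text \<open>Alphabets: X = {0..<nx}, Y = {0..<ny}, V = {0..<m}. A joint distribution
  is P :: nat => nat => real on {0..<nx} x {0..<ny}.\<close>

definition is_joint_dist :: "nat \<Rightarrow> nat \<Rightarrow> (nat \<Rightarrow> nat \<Rightarrow> real) \<Rightarrow> bool" where
  "is_joint_dist nx ny P \<longleftrightarrow>
     (\<forall>x<nx. \<forall>y<ny. P x y \<ge> 0) \<and> (\<Sum>x<nx. \<Sum>y<ny. P x y) = 1"

definition support :: "nat \<Rightarrow> nat \<Rightarrow> (nat \<Rightarrow> nat \<Rightarrow> real) \<Rightarrow> (nat \<times> nat) set" where
  "support nx ny P = {(x, y). x < nx \<and> y < ny \<and> P x y > 0}"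

definition seqs :: "nat \<Rightarrow> nat \<Rightarrow> nat list set" where
  "seqs k n = {xs. set xs \<subseteq> {0..<k} \<and> length xs = n}"

definition prod_dist :: "(nat \<Rightarrow> nat \<Rightarrow> real) \<Rightarrow> nat list \<Rightarrow> nat list \<Rightarrow> real" where
  "prod_dist P xs ys = (\<Prod>i<length xs. P (xs ! i) (ys ! i))"

definition seq_type :: "nat list \<Rightarrow> nat \<Rightarrow> real" where
  "seq_type s v = real (card {i. i < length s \<and> s ! i = v}) / real (length s)"

definition type_fun :: "(nat \<Rightarrow> nat \<Rightarrow> nat) \<Rightarrow> nat list \<Rightarrow> nat list \<Rightarrow> (nat \<Rightarrow> real)" where
  "type_fun f xs ys = seq_type (map2 f xs ys)"

definition err_prob ::
  "nat \<Rightarrow> nat \<Rightarrow> (nat \<Rightarrow> nat \<Rightarrow> real) \<Rightarrow> nat \<Rightarrow> (nat list \<Rightarrow> nat list \<Rightarrow> 'z)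
     \<Rightarrow> (nat list \<Rightarrow> nat) \<Rightarrow> (nat \<Rightarrow> nat list \<Rightarrow> 'z) \<Rightarrow> real" where
  "err_prob nx ny P n g enc dec =
     (\<Sum>xs\<in>seqs nx n. \<Sum>ys\<in>seqs ny n.
        if dec (enc xs) ys \<noteq> g xs ys then prod_dist P xs ys else 0)"

text \<open>Achievable rate for a sequence of functions g = {g_n}. The message set
  M_n is taken to be {0..<M n} (w.l.o.g., any finite set).\<close>
definition achievable ::
  "nat \<Rightarrow> nat \<Rightarrow> (nat \<Rightarrow> nat \<Rightarrow> real) \<Rightarrow> (nat \<Rightarrow> nat list \<Rightarrow> nat list \<Rightarrow> 'z) \<Rightarrow> real \<Rightarrow> bool" where
  "achievable nx ny P g R \<longleftrightarrow>
     (\<exists>(M :: nat \<Rightarrow> nat) (enc :: nat \<Rightarrow> nat list \<Rightarrow> nat) (dec :: nat \<Rightarrow> nat \<Rightarrow> nat list \<Rightarrow> 'z).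
        (\<forall>n. \<forall>xs\<in>seqs nx n. enc n xs < M n) \<and>
        (\<lambda>n. err_prob nx ny P n (g n) (enc n) (dec n)) \<longlonglongrightarrow> 0 \<and>
        limsup (\<lambda>n. ereal (log 2 (real (M n)) / real n)) \<le> ereal R)"

definition opt_rate ::
  "nat \<Rightarrow> nat \<Rightarrow> (nat \<Rightarrow> nat \<Rightarrow> real) \<Rightarrow> (nat \<Rightarrow> nat list \<Rightarrow> nat list \<Rightarrow> 'z) \<Rightarrow> real" where
  "opt_rate nx ny P g = Inf {R. achievable nx ny P g R}"

definition simple_loop ::
  "(nat \<times> nat) set \<Rightarrow> nat set \<Rightarrow> nat set \<Rightarrow> nat list \<Rightarrow> nat list \<Rightarrow> bool" where
  "simple_loop S A B as bs \<longleftrightarrow>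
     length as = length bs \<and> length as \<ge> 1 \<and> distinct as \<and> distinct bs \<and>
     set as \<subseteq> A \<and> set bs \<subseteq> B \<and>
     (\<forall>i<length as. (as ! i, bs ! i) \<in> S \<and>
                    (as ! i, bs ! ((i + 1) mod length as)) \<in> S)"

definition solvable ::
  "(nat \<times> nat) set \<Rightarrow> (nat \<Rightarrow> nat \<Rightarrow> nat) \<Rightarrow> nat set \<Rightarrow> nat set \<Rightarrow> bool" where
  "solvable S f A B \<longleftrightarrow>
     (\<forall>as bs. simple_loop S A B as bs \<longrightarrow>
        (\<forall>v. card {i. i < length as \<and> f (as ! i) (bs ! i) = v} =
             card {i. i < length as \<and> f (as ! i) (bs ! ((i + 1) mod length as)) = v}))"

definition solvable_hyperedge ::
  "nat \<Rightarrow> nat \<Rightarrow> (nat \<times> nat) set \<Rightarrow> (nat \<Rightarrow> nat \<Rightarrow> nat) \<Rightarrow> nat set \<Rightarrow> bool" where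
  "solvable_hyperedge nx ny S f e \<longleftrightarrow> e \<subseteq> {0..<nx} \<and> solvable S f e {0..<ny}"

definition max_solvable_hyperedges ::
  "nat \<Rightarrow> nat \<Rightarrow> (nat \<times> nat) set \<Rightarrow> (nat \<Rightarrow> nat \<Rightarrow> nat) \<Rightarrow> nat set set" where
  "max_solvable_hyperedges nx ny S f =
     {e. solvable_hyperedge nx ny S f e \<and>
         (\<forall>e'. e \<subset> e' \<longrightarrow> \<not> solvable_hyperedge nx ny S f e')}"

text \<open>Conditional mutual information I(W;X|Y) (base 2) for the joint law
  P(w,x,y) = P_XY(x,y) Q(w|x), with W ranging over the finite set E.\<close>
definition cond_mi ::
  "nat \<Rightarrow> nat \<Rightarrow> (nat \<Rightarrow> nat \<Rightarrow> real) \<Rightarrow> nat set set \<Rightarrow> (nat set \<Rightarrow> nat \<Rightarrow> real) \<Rightarrow> real" where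
  "cond_mi nx ny P E Q =
     (\<Sum>w\<in>E. \<Sum>x<nx. \<Sum>y<ny.
        (let pwxy = P x y * Q w x;
             py = (\<Sum>x'<nx. P x' y);
             pwy = (\<Sum>x'<nx. P x' y * Q w x')
         in if pwxy > 0 then pwxy * log 2 (pwxy * py / (pwy * P x y)) else 0))"

text \<open>Admissible channels P_{W|X}: values in E, Pr(X \<in> W) = 1.\<close>
definition hyper_channel :: "nat \<Rightarrow> nat set set \<Rightarrow> (nat set \<Rightarrow> nat \<Rightarrow> real) \<Rightarrow> bool" where
  "hyper_channel nx E Q \<longleftrightarrow>
     (\<forall>w\<in>E. \<forall>x<nx. Q w x \<ge> 0) \<and>
     (\<forall>w\<in>E. \<forall>x<nx. x \<notin> w \<longrightarrow> Q w x = 0) \<and>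
     (\<forall>x<nx. (\<Sum>w\<in>E. Q w x) = 1)"

definition cond_hypergraph_entropy ::
  "nat \<Rightarrow> nat \<Rightarrow> (nat \<Rightarrow> nat \<Rightarrow> real) \<Rightarrow> nat set set \<Rightarrow> real" where
  "cond_hypergraph_entropy nx ny P E =
     Inf {cond_mi nx ny P E Q | Q. hyper_channel nx E Q}"

end

theory Submission
  imports Defs "HOL-Library.FuncSet" "HOL-Real_Asymp.Real_Asymp"
begin

text \<open>Converse: the decoder may re-run itself with its \<open>i\<close>-th symbol replaced by any letter \<open>b\<close>. Up
  to an additive constant, the answers must equal the indicator of \<open>f x b\<close>, where \<open>x\<close> is the true
  \<open>i\<close>-th source letter, for every \<open>b\<close> that is possible together with \<open>x\<close>. So the answers are a
  potential on the second alphabet, and the letters \<open>x\<close> that agree with a given potential form a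
  solvable hyperedge, because a potential telescopes along loops. This hyperedge is a function of
  the message and of the side information outside \<open>i\<close>, so it forms a Markov chain with the \<open>i\<close>-th
  letters, and it misses \<open>x\<close> with probability at most a constant times the error probability.
  Jensen's inequality gives a single-letter bound, and compactness of the set of channels turns
  the vanishing miss probability into an admissible channel.

  Achievability: a Wyner-Ziv type random code conveys a word of hyperedges containing the source
  word, and the joint type of the two words costs no rate. The joint type of \<open>(x, y)\<close> on the
  positions carrying a given hyperedge is then known up to a circulation, a circulation decomposes
  into simple loops, and solvability says that loops do not change the type of \<open>f\<close>.\<close>

subsection \<open>Words over a finite alphabet\<close>

text \<open>The rate is a difference of two exponents: I(W;X), the cost of covering the source word
  by a word of hyperedges, minus I(W;Y), what the side information gives back. No typical sets
  occur: typicality is a threshold on a likelihood ratio, controlled by Chebyshev's inequality. The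
  joint counts of hyperedges and source letters take at most \<open>(n + 1) ^ (card E * nx)\<close>
  values, a polynomial number, hence they cost no rate. The obstacle in the converse is that a small
  error probability constrains letters only with high probability, so the channel obtained at one
  coordinate may still give a little mass to hyperedges that miss the letter. It need not be
  admissible at any finite block length; only the limit is. Moreover, the hyperedge must ignore the
  side letter at its own position, for otherwise it could depend on y beyond x. This is why the
  decoder is asked about all replacements of that letter and not only about the actual one.\<close>

definition words :: "'a set \<Rightarrow> nat \<Rightarrow> 'a list set" where
  "words S n = {xs. set xs \<subseteq> S \<and> length xs = n}"

lemma seqs_eq_words: "seqs k n = words {..<k} n"
  by (simp add: seqs_def words_def lessThan_atLeast0)

lemma finite_words [simp]: "finite S \<Longrightarrow> finite (words S n)"
  unfolding words_def by (rule finite_lists_length_eq)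

lemma words_length: "xs \<in> words S n \<Longrightarrow> length xs = n"
  by (simp add: words_def)

lemma words_nth: "xs \<in> words S n \<Longrightarrow> i < n \<Longrightarrow> xs ! i \<in> S"
  by (auto simp: words_def)

lemma words_update: "xs \<in> words S n \<Longrightarrow> a \<in> S \<Longrightarrow> xs[i := a] \<in> words S n"
  using set_update_subset_insert[of xs i a] by (auto simp: words_def)

lemma words_0 [simp]: "words S 0 = {[]}"
  by (auto simp: words_def)

lemma words_Suc: "words S (Suc n) = (\<lambda>(a, xs). a # xs) ` (S \<times> words S n)"
  by (auto simp: words_def length_Suc_conv image_iff)

lemma sum_words_Suc:
  "(\<Sum>xs\<in>words S (Suc n). F xs) = (\<Sum>a\<in>S. \<Sum>xs\<in>words S n. F (a # xs))"
proof -
  have "inj_on (\<lambda>(a, xs). a # xs) (S \<times> words S n)" by (auto simp: inj_on_def)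
  then show ?thesis
    by (simp add: words_Suc sum.reindex sum.cartesian_product case_prod_unfold)
qed

text \<open>The factor may depend on the position, so that the lemma also serves for conditional
  product laws given a fixed word, with \<open>g i\<close> determined by its \<open>i\<close>-th
  letter.\<close>

lemma sum_prod_words:
  fixes g :: "nat \<Rightarrow> 'a \<Rightarrow> real"
  shows "(\<Sum>xs\<in>words S n. \<Prod>i<n. g i (xs ! i)) = (\<Prod>i<n. \<Sum>a\<in>S. g i a)"
proof (induction n arbitrary: g)
  case (Suc n)
  have "(\<Sum>xs\<in>words S (Suc n). \<Prod>i<Suc n. g i (xs ! i))
      = (\<Sum>a\<in>S. \<Sum>xs\<in>words S n. g 0 a * (\<Prod>i<n. g (Suc i) (xs ! i)))"
    unfolding sum_words_Suc by (simp add: prod.lessThan_Suc_shift del: prod.lessThan_Suc)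
  also have "\<dots> = (\<Sum>a\<in>S. g 0 a) * (\<Prod>i<n. \<Sum>a\<in>S. g (Suc i) a)"
    by (simp add: Suc.IH[of "\<lambda>i. g (Suc i)"] sum_distrib_left [symmetric] sum_distrib_right)
  finally show ?case by (simp add: prod.lessThan_Suc_shift del: prod.lessThan_Suc)
qed simp

lemma sum_words_prod_set:
  "(\<Sum>zs\<in>words (A \<times> B) n. F (map fst zs) (map snd zs))
     = (\<Sum>xs\<in>words A n. \<Sum>ys\<in>words B n. F xs ys)"
proof -
  have "(\<Sum>zs\<in>words (A \<times> B) n. F (map fst zs) (map snd zs))
      = (\<Sum>(xs, ys)\<in>words A n \<times> words B n. F xs ys)"
    by (rule sum.reindex_bij_witness[where
          i = "\<lambda>(xs, ys). zip xs ys" and j = "\<lambda>zs. (map fst zs, map snd zs)"])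
      (auto simp: words_def zip_map_fst_snd dest: set_zip_leftD set_zip_rightD)
  then show ?thesis by (simp add: sum.cartesian_product)
qed

text \<open>When the square is expanded in the induction, the cross term carries the mean of
  \<open>g\<close>, which is zero, so the variances add up.\<close>

lemma second_moment_words:
  fixes \<mu> g :: "'a \<Rightarrow> real"
  assumes "(\<Sum>a\<in>S. \<mu> a) = 1" and "(\<Sum>a\<in>S. \<mu> a * g a) = 0"
  shows "(\<Sum>xs\<in>words S n. (\<Prod>i<n. \<mu> (xs ! i)) * (\<Sum>i<n. g (xs ! i))\<^sup>2)
    = real n * (\<Sum>a\<in>S. \<mu> a * (g a)\<^sup>2)"
proof (induction n)
  case (Suc n)
  let ?m = "\<lambda>xs. \<Prod>i<n. \<mu> (xs ! i)" and ?s = "\<lambda>xs. \<Sum>i<n. g (xs ! i)"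
  have one: "(\<Sum>xs\<in>words S n. ?m xs) = 1"
    using sum_prod_words[where g = "\<lambda>_. \<mu>" and S = S and n = n] assms(1) by simp
  have "(\<Sum>xs\<in>words S (Suc n). (\<Prod>i<Suc n. \<mu> (xs ! i)) * (\<Sum>i<Suc n. g (xs ! i))\<^sup>2)
     = (\<Sum>a\<in>S. \<Sum>xs\<in>words S n. (\<mu> a * (g a)\<^sup>2) * ?m xs + 2 * (\<mu> a * g a) * (?m xs * ?s xs)
          + \<mu> a * (?m xs * (?s xs)\<^sup>2))"
    unfolding sum_words_Suc
    by (simp add: prod.lessThan_Suc_shift sum.lessThan_Suc_shift power2_eq_square algebra_simps
        del: sum.lessThan_Suc prod.lessThan_Suc)
  also have "\<dots> = (\<Sum>a\<in>S. \<mu> a * (g a)\<^sup>2) * (\<Sum>xs\<in>words S n. ?m xs)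
      + 2 * (\<Sum>a\<in>S. \<mu> a * g a) * (\<Sum>xs\<in>words S n. ?m xs * ?s xs)
      + (\<Sum>a\<in>S. \<mu> a) * (\<Sum>xs\<in>words S n. ?m xs * (?s xs)\<^sup>2)"
    by (simp add: sum.distrib sum_distrib_left [symmetric] sum_distrib_right [symmetric])
  also have "\<dots> = real (Suc n) * (\<Sum>a\<in>S. \<mu> a * (g a)\<^sup>2)"
    by (simp add: one assms Suc.IH algebra_simps)
  finally show ?case .
qed simp

text \<open>Chebyshev's inequality: after centring \<open>g\<close>, the indicator of a deviation is
  at most the squared sum over \<open>(real n * \<delta>)\<^sup>2\<close>, and the second moment is
  linear in \<open>n\<close>.\<close>

lemma weak_law_words:
  fixes \<mu> g :: "'a \<Rightarrow> real"
  assumes fin: "finite S" and nn: "\<And>a. a \<in> S \<Longrightarrow> \<mu> a \<ge> 0"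
    and one: "(\<Sum>a\<in>S. \<mu> a) = 1" and n: "n > 0" and d: "\<delta> > 0"
  shows "(\<Sum>xs\<in>words S n. if \<bar>(\<Sum>i<n. g (xs ! i)) - real n * (\<Sum>a\<in>S. \<mu> a * g a)\<bar> \<ge> real n * \<delta>
            then (\<Prod>i<n. \<mu> (xs ! i)) else 0)
    \<le> (\<Sum>a\<in>S. \<mu> a * (g a - (\<Sum>a\<in>S. \<mu> a * g a))\<^sup>2) / (real n * \<delta>\<^sup>2)"
proof -
  define e where "e = (\<Sum>a\<in>S. \<mu> a * g a)"
  define h where "h a = g a - e" for a
  have zero: "(\<Sum>a\<in>S. \<mu> a * h a) = 0"
    by (simp add: h_def right_diff_distrib sum_subtractf sum_distrib_right [symmetric] one flip: e_def)
  have hs: "(\<Sum>i<n. g (xs ! i)) - real n * e = (\<Sum>i<n. h (xs ! i))" for xs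
    by (simp add: h_def sum_subtractf)
  have pos: "0 < (real n * \<delta>)\<^sup>2" using n d by simp
  have "(\<Sum>xs\<in>words S n. if \<bar>\<Sum>i<n. h (xs ! i)\<bar> \<ge> real n * \<delta> then (\<Prod>i<n. \<mu> (xs ! i)) else 0)
    \<le> (\<Sum>xs\<in>words S n. (\<Prod>i<n. \<mu> (xs ! i)) * (\<Sum>i<n. h (xs ! i))\<^sup>2 / (real n * \<delta>)\<^sup>2)"
  proof (rule sum_mono)
    fix xs assume xs: "xs \<in> words S n"
    have m: "0 \<le> (\<Prod>i<n. \<mu> (xs ! i))"
      by (rule prod_nonneg) (use nn words_nth[OF xs] in auto)
    show "(if \<bar>\<Sum>i<n. h (xs ! i)\<bar> \<ge> real n * \<delta> then (\<Prod>i<n. \<mu> (xs ! i)) else 0)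
      \<le> (\<Prod>i<n. \<mu> (xs ! i)) * (\<Sum>i<n. h (xs ! i))\<^sup>2 / (real n * \<delta>)\<^sup>2"
    proof (cases "\<bar>\<Sum>i<n. h (xs ! i)\<bar> \<ge> real n * \<delta>")
      case True
      then have "(real n * \<delta>)\<^sup>2 \<le> (\<Sum>i<n. h (xs ! i))\<^sup>2"
        using n d by (subst abs_le_square_iff [symmetric]) simp
      then have "(\<Prod>i<n. \<mu> (xs ! i)) * (real n * \<delta>)\<^sup>2 \<le> (\<Prod>i<n. \<mu> (xs ! i)) * (\<Sum>i<n. h (xs ! i))\<^sup>2"
        using m by (rule mult_left_mono)
      then show ?thesis using pos True by (simp add: pos_le_divide_eq)
    qed (use m in simp)
  qed
  also have "\<dots> = real n * (\<Sum>a\<in>S. \<mu> a * (h a)\<^sup>2) / (real n * \<delta>)\<^sup>2"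
    unfolding sum_divide_distrib [symmetric] second_moment_words[OF one zero] ..
  also have "\<dots> = (\<Sum>a\<in>S. \<mu> a * (h a)\<^sup>2) / (real n * \<delta>\<^sup>2)"
    using n d by (simp add: power2_eq_square field_simps)
  finally show ?thesis unfolding hs [symmetric] unfolding h_def e_def .
qed

subsection \<open>Circulations and simple loops\<close>

lemma bij_betw_cyclic_shift:
  assumes "k \<ge> 1"
  shows "bij_betw (\<lambda>i. (i + 1) mod k) {..<k} {..<k :: nat}"
proof -
  have "inj_on (\<lambda>i. (i + 1) mod k) {..<k}"
    by (rule inj_onI)
      (metis Suc_eq_plus1 lessThan_iff less_antisym mod_Suc mod_less nat.inject nat.distinct(1))
  moreover have "(\<lambda>i. (i + 1) mod k) ` {..<k} \<subseteq> {..<k}" using assms by auto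
  ultimately show ?thesis by (simp add: bij_betw_def endo_inj_surj)
qed

text \<open>Finiteness forces the orbit of \<open>b0\<close> to meet itself, which gives a periodic
  point; before its least period the iterates are distinct.\<close>

lemma ex_minimal_cycle:
  assumes "finite B" "g ` B \<subseteq> B" "b0 \<in> B"
  obtains b k where "b \<in> B" "k \<ge> 1" "(g ^^ k) b = b" "inj_on (\<lambda>i. (g ^^ i) b) {..<k}"
proof -
  have in_B: "(g ^^ i) b0 \<in> B" for i using assms by (induction i) auto
  then have "range (\<lambda>i. (g ^^ i) b0) \<subseteq> B" by auto
  then have "\<not> inj (\<lambda>i. (g ^^ i) b0)"
    using assms(1) finite_subset range_inj_infinite by blast
  then obtain i j where "i < j" "(g ^^ i) b0 = (g ^^ j) b0"
    unfolding inj_def by (metis linorder_less_linear)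
  define b where "b = (g ^^ i) b0"
  have per: "(g ^^ (j - i)) b = b"
  proof -
    have "(g ^^ (j - i)) b = (g ^^ (j - i + i)) b0" by (simp only: b_def funpow_add o_apply)
    then show ?thesis using \<open>i < j\<close> \<open>(g ^^ i) b0 = (g ^^ j) b0\<close> b_def by simp
  qed
  define k where "k = (LEAST k. k \<ge> 1 \<and> (g ^^ k) b = b)"
  have k: "k \<ge> 1 \<and> (g ^^ k) b = b"
    unfolding k_def by (rule LeastI[of _ "j - i"]) (use per \<open>i < j\<close> in auto)
  have least: "k \<le> l" if "l \<ge> 1" "(g ^^ l) b = b" for l
    unfolding k_def using that by (intro Least_le) auto
  have "inj_on (\<lambda>i. (g ^^ i) b) {..<k}"
  proof (rule linorder_inj_onI')
    fix p q assume "p \<in> {..<k}" "q \<in> {..<k}" "p < q"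
    show "(g ^^ p) b \<noteq> (g ^^ q) b"
    proof
      assume eq: "(g ^^ p) b = (g ^^ q) b"
      \<comment> \<open>Applying \<open>k - q\<close> further iterates to both sides of
        \<open>eq\<close> returns the right one to \<open>b\<close>, so \<open>k - q + p\<close>
        would be a smaller period.\<close>
      have "(g ^^ (k - q + p)) b = (g ^^ (k - q + q)) b" by (simp only: funpow_add o_apply eq)
      also have "\<dots> = b" using k \<open>q \<in> {..<k}\<close> by simp
      finally have "k \<le> k - q + p" using \<open>q \<in> {..<k}\<close> by (intro least) auto
      then show False using \<open>p < q\<close> \<open>q \<in> {..<k}\<close> by auto
    qed
  qed
  moreover have "b \<in> B" using in_B b_def by simp
  ultimately show thesis using k that by blast
qed

lemma ex_neg_if_sum_zero:
  fixes c :: "'a \<Rightarrow> int"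
  assumes "finite A" "(\<Sum>x\<in>A. c x) = 0" "a \<in> A" "c a > 0"
  shows "\<exists>x\<in>A. c x < 0"
proof (rule ccontr)
  assume "\<not> ?thesis"
  then have "\<And>x. x \<in> A \<Longrightarrow> c x \<ge> 0" by (simp add: not_less)
  then have "(\<Sum>x\<in>A. c x) > 0" using assms by (intro sum_pos2[where i = a]) auto
  with assms show False by simp
qed

text \<open>Vanishing row and column sums make signs alternate: from a positive entry one moves
  along its row to a negative entry, and along that column to a positive one again. On finitely many
  columns this walk closes up.\<close>

lemma circulation_contains_loop:
  fixes c :: "nat \<Rightarrow> nat \<Rightarrow> int"
  assumes finA: "finite A" and finB: "finite B"
    and supp: "\<And>x y. c x y \<noteq> 0 \<Longrightarrow> x \<in> A \<and> y \<in> B \<and> (x, y) \<in> S"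
    and rows: "\<And>x. (\<Sum>y\<in>B. c x y) = 0" and cols: "\<And>y. (\<Sum>x\<in>A. c x y) = 0"
    and nz: "c x0 y0 \<noteq> 0"
  obtains as bs where "simple_loop S A B as bs"
    "\<And>i. i < length as \<Longrightarrow> c (as ! i) (bs ! i) > 0"
    "\<And>i. i < length as \<Longrightarrow> c (as ! i) (bs ! ((i + 1) mod length as)) < 0"
proof -
  define B' where "B' = {y. \<exists>x. c x y > 0}"
  have B': "B' \<subseteq> B"
  proof
    fix y assume "y \<in> B'"
    then obtain x where "c x y > 0" by (auto simp: B'_def)
    then show "y \<in> B" using supp[of x y] by simp
  qed
  have neg: "\<exists>y. c x y < 0" if "c x y' > 0" for x y'
    using ex_neg_if_sum_zero[OF finB rows[of x], of y'] that supp[of x y'] by auto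
  have pos: "\<exists>x. c x y > 0" if "c x' y < 0" for x' y
    using ex_neg_if_sum_zero[of A "\<lambda>x. - c x y" x'] finA cols[of y] that supp[of x' y]
    by (auto simp: sum_negf)
  define \<alpha> where "\<alpha> y = (SOME x. c x y > 0)" for y
  define \<beta> where "\<beta> x = (SOME y. c x y < 0)" for x
  have \<alpha>: "c (\<alpha> y) y > 0" if "y \<in> B'" for y
    using that unfolding \<alpha>_def B'_def by (auto intro: someI)
  have \<beta>: "c x (\<beta> x) < 0" if "c x y' > 0" for x y'
    using someI_ex[OF neg[OF that]] by (simp add: \<beta>_def)
  \<comment> \<open>One step of the walk: \<open>\<alpha>\<close> fixes the row of a positive entry
    in the column, \<open>\<beta>\<close> a column where this row is negative. Fixing the choices as
    functions turns the walk into the iteration of a map on \<open>B'\<close>.\<close>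
  define g where "g = \<beta> \<circ> \<alpha>"
  have gB: "g ` B' \<subseteq> B'"
  proof (rule image_subsetI)
    fix y assume "y \<in> B'"
    from pos[OF \<beta>[OF \<alpha>[OF this]]] show "g y \<in> B'" by (simp add: g_def B'_def)
  qed
  have "\<exists>b0. b0 \<in> B'"
  proof (cases "c x0 y0 > 0")
    case True
    then show ?thesis by (auto simp: B'_def)
  next
    case False
    with nz have "c x0 y0 < 0" by simp
    from pos[OF this] show ?thesis by (auto simp: B'_def)
  qed
  then obtain b0 where "b0 \<in> B'" ..
  then obtain b k where bk: "b \<in> B'" "k \<ge> 1" "(g ^^ k) b = b" "inj_on (\<lambda>i. (g ^^ i) b) {..<k}"
    by (rule ex_minimal_cycle[OF finite_subset[OF B' finB] gB])
  define bs where "bs = map (\<lambda>i. (g ^^ i) b) [0..<k]"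
  define as where "as = map \<alpha> bs"
  have len: "length bs = k" "length as = k" by (auto simp: bs_def as_def)
  have b_in: "(g ^^ i) b \<in> B'" for i using bk(1) gB by (induction i) auto
  have nth_b: "bs ! i = (g ^^ i) b" and nth_a: "as ! i = \<alpha> ((g ^^ i) b)" if "i < k" for i
    using that by (auto simp: bs_def as_def)
  have nxt: "bs ! ((i + 1) mod k) = g (bs ! i)" if "i < k" for i
  proof (cases "i + 1 = k")
    case True
    then have "g (bs ! i) = (g ^^ k) b" using nth_b[OF that] by (metis Suc_eq_plus1 funpow.simps(2) o_apply)
    then show ?thesis using True bk nth_b[of 0] by simp
  next
    case False
    then show ?thesis using that nth_b by simp
  qed
  have P: "c (as ! i) (bs ! i) > 0" if "i < k" for i
    using \<alpha>[OF b_in[of i]] nth_a nth_b that by simp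
  have N: "c (as ! i) (bs ! ((i + 1) mod k)) < 0" if "i < k" for i
  proof -
    have "bs ! ((i + 1) mod k) = \<beta> (as ! i)" using nxt nth_a nth_b that by (simp add: g_def)
    then show ?thesis using \<beta>[OF P[OF that]] by simp
  qed
  have dist_b: "distinct bs"
    unfolding bs_def distinct_map using bk(4) by (simp add: lessThan_atLeast0)
  have mod_inj: "i = j" if "i < k" "j < k" "(i + 1) mod k = (j + 1) mod k" for i j
    by (rule inj_onD[OF bij_betw_imp_inj_on[OF bij_betw_cyclic_shift[OF bk(2)]] that(3)]) (use that in auto)
  \<comment> \<open>The next column is \<open>\<beta>\<close> of the row, so a repeated row would
    repeat the next column, against distinct columns and the injective cyclic shift.\<close>
  have dist_a: "distinct as"
    unfolding distinct_conv_nth len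
  proof (intro allI impI notI)
    fix i j assume ij: "i < k" "j < k" "i \<noteq> j" "as ! i = as ! j"
    then have "bs ! ((i + 1) mod k) = bs ! ((j + 1) mod k)"
      using nxt nth_a nth_b by (simp add: g_def)
    then have "(i + 1) mod k = (j + 1) mod k"
      using dist_b len ij by (simp add: distinct_conv_nth) (metis mod_less_divisor bk(2) less_le_trans zero_less_one)
    with mod_inj ij show False by blast
  qed
  have mem: "as ! i \<in> A \<and> bs ! i \<in> B \<and> (as ! i, bs ! i) \<in> S" if "i < k" for i
    using supp[of "as ! i" "bs ! i"] P[OF that] by simp
  have "set as \<subseteq> A" "set bs \<subseteq> B" using mem len by (auto simp: set_conv_nth)
  moreover have "(as ! i, bs ! i) \<in> S \<and> (as ! i, bs ! ((i + 1) mod k)) \<in> S" if "i < k" for i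
    using mem[OF that] N[OF that] supp[of "as ! i" "bs ! ((i + 1) mod k)"] by simp
  ultimately have "simple_loop S A B as bs"
    unfolding simple_loop_def using len bk(2) dist_a dist_b by simp
  then show thesis using P N by (intro that[of as bs]) (simp_all add: len)
qed

lemma sum_of_bool_card: "(\<Sum>i<(k::nat). of_bool (R i) :: int) = int (card {i. i < k \<and> R i})"
proof -
  have "{..<k} \<inter> {i. R i} = {i. i < k \<and> R i}" by auto
  then show ?thesis by (simp add: sum_of_bool_eq)
qed

lemma sum_of_bool_conj_eq:
  assumes "finite B" "b \<in> B"
  shows "(\<Sum>y\<in>B. of_bool (R \<and> y = b) :: int) = of_bool R" "(\<Sum>y\<in>B. of_bool (y = b \<and> R) :: int) = of_bool R"
proof -
  have "(\<Sum>y\<in>B. of_bool (R \<and> y = b) :: int) = (\<Sum>y\<in>B. if y = b then of_bool R else 0)"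
    by (rule sum.cong) auto
  then show "(\<Sum>y\<in>B. of_bool (R \<and> y = b) :: int) = of_bool R" using assms by simp
  then show "(\<Sum>y\<in>B. of_bool (y = b \<and> R) :: int) = of_bool R" by (simp only: conj_commute)
qed

lemma sum_sum_of_bool_pair:
  fixes h :: "'a \<Rightarrow> 'b \<Rightarrow> int"
  assumes "finite A" "finite B" "a \<in> A" "b \<in> B"
  shows "(\<Sum>x\<in>A. \<Sum>y\<in>B. h x y * of_bool (x = a \<and> y = b)) = h a b"
proof -
  have "(\<Sum>x\<in>A. \<Sum>y\<in>B. h x y * of_bool (x = a \<and> y = b))
    = (\<Sum>x\<in>A. if x = a then (\<Sum>y\<in>B. if y = b then h x y else 0) else 0)"
    by (intro sum.cong refl) (auto intro!: sum.cong)
  then show ?thesis using assms by simp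
qed

text \<open>Induction on the sum of absolute values. A loop along which the signs of
  \<open>c\<close> alternate is subtracted; solvability makes its contribution zero, and what
  remains is a smaller circulation inside the same support.\<close>

lemma solvable_circulation:
  fixes c :: "nat \<Rightarrow> nat \<Rightarrow> int"
  assumes finA: "finite A" and finB: "finite B" and solv: "solvable S f A B"
    and supp: "\<And>x y. c x y \<noteq> 0 \<Longrightarrow> x \<in> A \<and> y \<in> B \<and> (x, y) \<in> S"
    and rows: "\<And>x. (\<Sum>y\<in>B. c x y) = 0" and cols: "\<And>y. (\<Sum>x\<in>A. c x y) = 0"
  shows "(\<Sum>x\<in>A. \<Sum>y\<in>B. of_bool (f x y = v) * c x y) = 0"
  using supp rows cols
proof (induction "nat (\<Sum>x\<in>A. \<Sum>y\<in>B. \<bar>c x y\<bar>)" arbitrary: c rule: less_induct)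
  case (less c)
  show ?case
  proof (cases "\<forall>x y. c x y = 0")
    case False
    then obtain x0 y0 where "c x0 y0 \<noteq> 0" by blast
    then obtain as bs where loop: "simple_loop S A B as bs"
      and P: "\<And>i. i < length as \<Longrightarrow> c (as ! i) (bs ! i) > 0"
      and N: "\<And>i. i < length as \<Longrightarrow> c (as ! i) (bs ! ((i + 1) mod length as)) < 0"
      using circulation_contains_loop[OF finA finB less.prems] by metis
    define k where "k = length as"
    define nx where "nx i = (i + 1) mod k" for i
    have k: "k \<ge> 1" "length bs = k" "distinct as" "distinct bs"
      and inAB: "\<And>i. i < k \<Longrightarrow> as ! i \<in> A \<and> bs ! i \<in> B"
      using loop by (auto simp: simple_loop_def k_def dest: nth_mem)
    have nx: "nx i < k" for i using k(1) by (simp add: nx_def)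
    have nx_bij: "bij_betw nx {..<k} {..<k}"
      using bij_betw_cyclic_shift[OF k(1)] by (simp add: nx_def [abs_def])
    \<comment> \<open>\<open>dp - dn\<close> is the elementary circulation of the loop: 1 where
      \<open>c\<close> is positive and -1 where it is negative.\<close>
    define dp dn :: "nat \<Rightarrow> nat \<Rightarrow> int" where
      "dp x y = (\<Sum>i<k. of_bool (x = as ! i \<and> y = bs ! i))" and
      "dn x y = (\<Sum>i<k. of_bool (x = as ! i \<and> y = bs ! nx i))" for x y
    \<comment> \<open>Since the rows are distinct, at most one index contributes, so
      \<open>dp\<close> and \<open>dn\<close> are zero-one matrices.\<close>
    have one: "(\<Sum>i<k. of_bool (x = as ! i \<and> R i)) = (of_bool (\<exists>i<k. x = as ! i \<and> R i) :: int)" for x R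
    proof (cases "\<exists>i<k. x = as ! i \<and> R i")
      case True
      then obtain j where "j < k" "x = as ! j" "R j" by blast
      then have "(\<Sum>i<k. of_bool (x = as ! i \<and> R i)) = (\<Sum>i<k. (if i = j then 1 else 0) :: int)"
        using k(3) by (intro sum.cong) (auto simp: k_def nth_eq_iff_index_eq)
      then show ?thesis using True \<open>j < k\<close> by simp
    qed auto
    define c' where "c' x y = c x y - (dp x y - dn x y)" for x y
    have dp_pos: "dp x y = 0 \<or> dp x y = 1 \<and> c x y > 0" for x y
      using P one[of x "\<lambda>i. y = bs ! i"] by (auto simp: dp_def k_def)
    have dn_neg: "dn x y = 0 \<or> dn x y = 1 \<and> c x y < 0" for x y
      using N one[of x "\<lambda>i. y = bs ! nx i"] by (auto simp: dn_def nx_def k_def)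
    \<comment> \<open>Entries are integers: a positive one is at least 1 and a negative one at most
      -1, so subtracting the loop never overshoots zero and creates no new support.\<close>
    have le: "\<bar>c' x y\<bar> \<le> \<bar>c x y\<bar>" for x y
      using dp_pos[of x y] dn_neg[of x y] by (auto simp: c'_def)
    have "dp (as ! 0) (bs ! 0) = 1"
      using one[of "as ! 0" "\<lambda>i. bs ! 0 = bs ! i"] k(1) by (force simp: dp_def)
    then have lt: "\<bar>c' (as ! 0) (bs ! 0)\<bar> < \<bar>c (as ! 0) (bs ! 0)\<bar>"
      using dp_pos[of "as ! 0" "bs ! 0"] dn_neg[of "as ! 0" "bs ! 0"] by (auto simp: c'_def)
    have a0: "as ! 0 \<in> A" "bs ! 0 \<in> B" using inAB[of 0] k(1) by auto
    have "(\<Sum>x\<in>A. \<Sum>y\<in>B. \<bar>c' x y\<bar>) < (\<Sum>x\<in>A. \<Sum>y\<in>B. \<bar>c x y\<bar>)"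
    proof (rule sum_strict_mono_ex1[OF finA])
      show "\<forall>x\<in>A. (\<Sum>y\<in>B. \<bar>c' x y\<bar>) \<le> (\<Sum>y\<in>B. \<bar>c x y\<bar>)" using le by (auto intro: sum_mono)
      show "\<exists>x\<in>A. (\<Sum>y\<in>B. \<bar>c' x y\<bar>) < (\<Sum>y\<in>B. \<bar>c x y\<bar>)"
        by (rule bexI[OF _ a0(1)], rule sum_strict_mono_ex1[OF finB]) (use a0 lt le in auto)
    qed
    moreover have "0 \<le> (\<Sum>x\<in>A. \<Sum>y\<in>B. \<bar>c' x y\<bar>)" by (intro sum_nonneg) auto
    ultimately have dec: "nat (\<Sum>x\<in>A. \<Sum>y\<in>B. \<bar>c' x y\<bar>) < nat (\<Sum>x\<in>A. \<Sum>y\<in>B. \<bar>c x y\<bar>)" by linarith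
    have row: "(\<Sum>y\<in>B. dp x y) = (\<Sum>y\<in>B. dn x y)" for x
    proof -
      have "(\<Sum>y\<in>B. \<Sum>i<k. of_bool (x = as ! i \<and> y = bs ! h i)) = (\<Sum>i<k. of_bool (x = as ! i) :: int)"
        if "\<And>i. i < k \<Longrightarrow> h i < k" for h
        by (subst sum.swap) (use that inAB finB in \<open>auto intro!: sum.cong sum_of_bool_conj_eq simp del: sum_of_bool_eq\<close>)
      from this[of "\<lambda>i. i"] this[of nx] show ?thesis using nx by (simp add: dp_def dn_def)
    qed
    have col: "(\<Sum>x\<in>A. dp x y) = (\<Sum>x\<in>A. dn x y)" for y
    proof -
      have "(\<Sum>x\<in>A. \<Sum>i<k. of_bool (x = as ! i \<and> y = bs ! h i)) = (\<Sum>i<k. of_bool (y = bs ! h i) :: int)" for h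
        by (subst sum.swap) (use inAB finA in \<open>auto intro!: sum.cong sum_of_bool_conj_eq simp del: sum_of_bool_eq\<close>)
      from this[of "\<lambda>i. i"] this[of nx] show ?thesis
        using sum.reindex_bij_betw[OF nx_bij, of "\<lambda>i. of_bool (y = bs ! i) :: int"]
        by (simp add: dp_def dn_def)
    qed
    have val: "(\<Sum>x\<in>A. \<Sum>y\<in>B. of_bool (f x y = v) * dp x y) = (\<Sum>x\<in>A. \<Sum>y\<in>B. of_bool (f x y = v) * dn x y)"
    proof -
      have "(\<Sum>x\<in>A. \<Sum>y\<in>B. of_bool (f x y = v) * (\<Sum>i<k. of_bool (x = as ! i \<and> y = bs ! h i)))
        = (\<Sum>i<k. of_bool (f (as ! i) (bs ! h i) = v) :: int)" (is "?l = _")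
        if "\<And>i. i < k \<Longrightarrow> h i < k" for h
      proof -
        have "?l = (\<Sum>i<k. \<Sum>x\<in>A. \<Sum>y\<in>B. of_bool (f x y = v) * of_bool (x = as ! i \<and> y = bs ! h i))"
          by (simp only: sum_distrib_left sum.swap[of _ "{..<k}" B] sum.swap[of _ "{..<k}" A])
        also have "\<dots> = (\<Sum>i<k. of_bool (f (as ! i) (bs ! h i) = v))"
          using that inAB finA finB by (intro sum.cong refl sum_sum_of_bool_pair) auto
        finally show ?thesis .
      qed
      from this[of "\<lambda>i. i"] this[of nx] nx
      have "(\<Sum>x\<in>A. \<Sum>y\<in>B. of_bool (f x y = v) * dp x y) = int (card {i. i < k \<and> f (as ! i) (bs ! i) = v})"
        "(\<Sum>x\<in>A. \<Sum>y\<in>B. of_bool (f x y = v) * dn x y) = int (card {i. i < k \<and> f (as ! i) (bs ! nx i) = v})"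
        by (simp_all only: dp_def dn_def sum_of_bool_card)
      then show ?thesis using solv loop unfolding solvable_def nx_def k_def by simp
    qed
    have "(\<Sum>x\<in>A. \<Sum>y\<in>B. of_bool (f x y = v) * c' x y) = 0"
    proof (rule less.hyps[OF dec])
      show "x \<in> A \<and> y \<in> B \<and> (x, y) \<in> S" if "c' x y \<noteq> 0" for x y
        using that le[of x y] less.prems(1)[of x y] by force
      show "(\<Sum>y\<in>B. c' x y) = 0" for x using less.prems(2) row by (simp add: c'_def sum_subtractf)
      show "(\<Sum>x\<in>A. c' x y) = 0" for y using less.prems(3) col by (simp add: c'_def sum_subtractf)
    qed
    then show ?thesis using val by (simp add: c'_def right_diff_distrib sum_subtractf)
  qed simp
qed

text \<open>On the positions carrying \<open>w\<close>, the joint counts of (x, y) for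
  \<open>xs\<close> and for \<open>xs'\<close> differ by a circulation: row sums agree by
  \<open>counts\<close>, column sums because both words are paired with the same \<open>ws\<close>
  and \<open>ys\<close>.\<close>

lemma type_fun_determined:
  assumes finE: "finite E" and ws: "ws \<in> words E n"
    and xs: "length xs = n" and xs': "length xs' = n" and ys: "ys \<in> words {..<ny} n"
    and E: "\<And>w. w \<in> E \<Longrightarrow> solvable S f w {0..<ny} \<and> w \<subseteq> {0..<nx}"
    and sup: "\<And>i. i < n \<Longrightarrow> xs ! i \<in> ws ! i \<and> (xs ! i, ys ! i) \<in> S"
    and sup': "\<And>i. i < n \<Longrightarrow> xs' ! i \<in> ws ! i \<and> (xs' ! i, ys ! i) \<in> S"
    and counts: "\<And>w x. w \<in> E \<Longrightarrow> x < nx \<Longrightarrow>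
      card {i. i < n \<and> ws ! i = w \<and> xs ! i = x} = card {i. i < n \<and> ws ! i = w \<and> xs' ! i = x}"
  shows "type_fun f xs ys = type_fun f xs' ys"
proof
  fix v
  have lys: "length ys = n" using ys by (rule words_length)
  define N :: "nat list \<Rightarrow> nat set \<Rightarrow> nat \<Rightarrow> nat \<Rightarrow> int"
    where "N us w x y = (\<Sum>i<n. of_bool (ws ! i = w \<and> x = us ! i \<and> y = ys ! i))" for us w x y
  have ysb: "ys ! i < ny" if "i < n" for i using words_nth[OF ys that] by simp
  have main: "(\<Sum>x\<in>w. \<Sum>y\<in>{0..<ny}. of_bool (f x y = v) * (N xs w x y - N xs' w x y)) = 0" if w: "w \<in> E" for w
  proof (rule solvable_circulation[where S = S])
    have wx: "w \<subseteq> {0..<nx}" using E w by blast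
    then show fw: "finite w" using finite_subset by blast
    show "solvable S f w {0..<ny}" using E w by blast
    have Nz: "x \<in> w \<and> y \<in> {0..<ny} \<and> (x, y) \<in> S" if "N us w x y \<noteq> 0"
      "\<And>i. i < n \<Longrightarrow> us ! i \<in> ws ! i \<and> (us ! i, ys ! i) \<in> S" for us x y
    proof -
      obtain i where "i < n" "ws ! i = w \<and> x = us ! i \<and> y = ys ! i"
        using \<open>N us w x y \<noteq> 0\<close> unfolding N_def by (force dest: sum.not_neutral_contains_not_neutral)
      then show ?thesis using that(2)[of i] ysb[of i] by auto
    qed
    show "x \<in> w \<and> y \<in> {0..<ny} \<and> (x, y) \<in> S" if "N xs w x y - N xs' w x y \<noteq> 0" for x y
      using that Nz[of xs x y] Nz[of xs' x y] sup sup' by fastforce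
    have Nrow: "(\<Sum>y\<in>{0..<ny}. N us w x y) = int (card {i. i < n \<and> ws ! i = w \<and> us ! i = x})" for us x
    proof -
      have "(\<Sum>y\<in>{0..<ny}. N us w x y) = (\<Sum>i<n. \<Sum>y\<in>{0..<ny}. of_bool (ws ! i = w \<and> x = us ! i \<and> y = ys ! i))"
        unfolding N_def by (rule sum.swap)
      also have "\<dots> = (\<Sum>i<n. of_bool (ws ! i = w \<and> x = us ! i))"
        using ysb by (intro sum.cong refl) (auto simp: of_bool_def sum.If_cases)
      finally show ?thesis by (simp add: sum_of_bool_card eq_commute[of x])
    qed
    show "(\<Sum>y\<in>{0..<ny}. N xs w x y - N xs' w x y) = 0" for x
    proof (cases "x < nx")
      case True
      then show ?thesis using counts[OF w True] by (simp add: sum_subtractf Nrow)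
    next
      case False
      have "N us w x y = 0" if "\<And>i. i < n \<Longrightarrow> us ! i \<in> ws ! i \<and> (us ! i, ys ! i) \<in> S" for us y
        using Nz[of us x y] that wx False by fastforce
      then show ?thesis using sup sup' by simp
    qed
    have Ncol: "(\<Sum>x\<in>w. N us w x y) = (\<Sum>i<n. of_bool (ws ! i = w \<and> ys ! i = y))"
      if "\<And>i. i < n \<Longrightarrow> us ! i \<in> ws ! i \<and> (us ! i, ys ! i) \<in> S" for us y
    proof -
      have "(\<Sum>x\<in>w. N us w x y) = (\<Sum>i<n. \<Sum>x\<in>w. of_bool (ws ! i = w \<and> x = us ! i \<and> y = ys ! i))"
        unfolding N_def by (rule sum.swap)
      also have "\<dots> = (\<Sum>i<n. of_bool (ws ! i = w \<and> ys ! i = y))"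
        using that fw by (intro sum.cong refl) (auto simp: of_bool_def sum.If_cases)
      finally show ?thesis .
    qed
    show "(\<Sum>x\<in>w. N xs w x y - N xs' w x y) = 0" for y
      using Ncol[of xs y] Ncol[of xs' y] sup sup' by (simp add: sum_subtractf)
  qed simp
  \<comment> \<open>Each position carries exactly one hyperedge, so the number of occurrences of
    \<open>v\<close> splits over the hyperedges.\<close>
  have tot: "int (card {i. i < n \<and> f (us ! i) (ys ! i) = v})
      = (\<Sum>w\<in>E. \<Sum>x\<in>w. \<Sum>y\<in>{0..<ny}. of_bool (f x y = v) * N us w x y)"
    if us: "\<And>i. i < n \<Longrightarrow> us ! i \<in> ws ! i \<and> (us ! i, ys ! i) \<in> S" for us
  proof -
    have fin: "finite w" if "w \<in> E" for w using E[OF that] finite_subset by blast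
    have "(\<Sum>x\<in>w. \<Sum>y\<in>{0..<ny}. of_bool (f x y = v) * N us w x y)
       = (\<Sum>i<n. of_bool (ws ! i = w \<and> f (us ! i) (ys ! i) = v))" if w: "w \<in> E" for w
    proof -
      have "(\<Sum>x\<in>w. \<Sum>y\<in>{0..<ny}. of_bool (f x y = v) * N us w x y)
        = (\<Sum>i<n. \<Sum>x\<in>w. \<Sum>y\<in>{0..<ny}. of_bool (f x y = v) * of_bool (ws ! i = w \<and> x = us ! i \<and> y = ys ! i))"
        by (simp only: N_def sum_distrib_left sum.swap[of _ "{..<n}" w] sum.swap[of _ "{..<n}" "{0..<ny}"])
      also have "\<dots> = (\<Sum>i<n. of_bool (ws ! i = w \<and> f (us ! i) (ys ! i) = v))"
      proof (intro sum.cong refl)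
        fix i assume i: "i \<in> {..<n}"
        show "(\<Sum>x\<in>w. \<Sum>y\<in>{0..<ny}. of_bool (f x y = v) * of_bool (ws ! i = w \<and> x = us ! i \<and> y = ys ! i))
          = (of_bool (ws ! i = w \<and> f (us ! i) (ys ! i) = v) :: int)"
        proof (cases "ws ! i = w")
          case True
          then have "us ! i \<in> w" "ys ! i \<in> {0..<ny}" using us[of i] ysb[of i] i by auto
          from sum_sum_of_bool_pair[OF fin[OF w] finite_atLeastLessThan this, of "\<lambda>x y. of_bool (f x y = v)"]
          show ?thesis using True by simp
        qed simp
      qed
      finally show ?thesis .
    qed
    then have "(\<Sum>w\<in>E. \<Sum>x\<in>w. \<Sum>y\<in>{0..<ny}. of_bool (f x y = v) * N us w x y)
      = (\<Sum>w\<in>E. \<Sum>i<n. of_bool (ws ! i = w \<and> f (us ! i) (ys ! i) = v))"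
      by (rule sum.cong[OF refl])
    also have "\<dots> = (\<Sum>i<n. \<Sum>w\<in>E. of_bool (ws ! i = w \<and> f (us ! i) (ys ! i) = v))"
      by (rule sum.swap)
    also have "\<dots> = (\<Sum>i<n. of_bool (f (us ! i) (ys ! i) = v))"
      using words_nth[OF ws] finE
      by (intro sum.cong refl) (simp add: eq_commute[of "ws ! _"] sum_of_bool_conj_eq del: sum_of_bool_eq)
    finally show ?thesis by (simp add: sum_of_bool_card)
  qed
  have "int (card {i. i < n \<and> f (xs ! i) (ys ! i) = v}) - int (card {i. i < n \<and> f (xs' ! i) (ys ! i) = v})
     = (\<Sum>w\<in>E. \<Sum>x\<in>w. \<Sum>y\<in>{0..<ny}. of_bool (f x y = v) * (N xs w x y - N xs' w x y))"
    using tot[of xs, OF sup] tot[of xs', OF sup'] by (simp add: right_diff_distrib sum_subtractf)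
  also have "\<dots> = 0" using main by (intro sum.neutral) auto
  finally have "card {i. i < n \<and> f (xs ! i) (ys ! i) = v} = card {i. i < n \<and> f (xs' ! i) (ys ! i) = v}"
    by simp
  moreover have "seq_type (map2 f us ys) v = real (card {i. i < n \<and> f (us ! i) (ys ! i) = v}) / real n"
    if "length us = n" for us
    using that lys by (auto simp: seq_type_def intro!: arg_cong[where f = card])
  ultimately show "type_fun f xs ys v = type_fun f xs' ys v"
    using xs xs' by (simp add: type_fun_def)
qed

subsection \<open>A one-shot random code\<close>

lemma sum_words_one_coord:
  fixes r g :: "'a \<Rightarrow> real"
  assumes one: "(\<Sum>a\<in>S. r a) = 1" and j: "j < n"
  shows "(\<Sum>xs\<in>words S n. (\<Prod>i<n. r (xs ! i)) * g (xs ! j)) = (\<Sum>a\<in>S. r a * g a)"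
proof -
  have "(\<Sum>xs\<in>words S n. (\<Prod>i<n. r (xs ! i)) * g (xs ! j))
     = (\<Sum>xs\<in>words S n. \<Prod>i<n. r (xs ! i) * (if i = j then g (xs ! i) else 1))"
    using j by (simp add: prod.distrib)
  also have "\<dots> = (\<Prod>i<n. \<Sum>a\<in>S. r a * (if i = j then g a else 1))"
    by (rule sum_prod_words[where g = "\<lambda>i a. r a * (if i = j then g a else 1)"])
  also have "\<dots> = (\<Prod>i<n. if i = j then (\<Sum>a\<in>S. r a * g a) else 1)"
    by (rule prod.cong) (auto simp: one)
  finally show ?thesis using j by simp
qed

text \<open>Independence of two entries of a random word; it makes the probability of a clash
  between two codewords of a row factorize.\<close>

lemma sum_words_two_coords:
  fixes r g h :: "'a \<Rightarrow> real"
  assumes one: "(\<Sum>a\<in>S. r a) = 1" and j: "j < n" "k < n" "j \<noteq> k"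
  shows "(\<Sum>xs\<in>words S n. (\<Prod>i<n. r (xs ! i)) * (g (xs ! j) * h (xs ! k)))
    = (\<Sum>a\<in>S. r a * g a) * (\<Sum>a\<in>S. r a * h a)"
proof -
  let ?G = "\<lambda>i a. (if i = j then g a else 1) * (if i = k then h a else 1)"
  have "(\<Sum>xs\<in>words S n. (\<Prod>i<n. r (xs ! i)) * (g (xs ! j) * h (xs ! k)))
     = (\<Sum>xs\<in>words S n. \<Prod>i<n. r (xs ! i) * ?G i (xs ! i))"
    using j by (simp add: prod.distrib)
  also have "\<dots> = (\<Prod>i<n. \<Sum>a\<in>S. r a * ?G i a)"
    by (rule sum_prod_words[where g = "\<lambda>i a. r a * ?G i a"])
  also have "\<dots> = (\<Prod>i<n. (if i = j then (\<Sum>a\<in>S. r a * g a) else 1) * (if i = k then (\<Sum>a\<in>S. r a * h a) else 1))"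
    by (rule prod.cong) (use j in \<open>auto simp: one\<close>)
  finally show ?thesis using j by (simp add: prod.distrib)
qed

text \<open>Derandomization: a bound on the mean over all codebooks yields one codebook that meets
  it. With uniform weights it also selects a coordinate in the converse.\<close>

lemma weighted_average_le_ex:
  fixes w v :: "'a \<Rightarrow> real"
  assumes "finite A" "\<And>a. a \<in> A \<Longrightarrow> w a \<ge> 0" "(\<Sum>a\<in>A. w a) = 1" "(\<Sum>a\<in>A. w a * v a) \<le> K"
  shows "\<exists>a\<in>A. v a \<le> K"
proof (rule ccontr)
  assume "\<not> ?thesis"
  then have gt: "\<And>a. a \<in> A \<Longrightarrow> v a > K" by (simp add: not_le)
  obtain a where a: "a \<in> A" "w a > 0"
    using assms(2,3) by (metis less_eq_real_def sum.neutral zero_neq_one)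
  have "0 < (\<Sum>a\<in>A. w a * (v a - K))"
    using assms(1,2) gt a by (intro sum_pos2[of _ a]) (auto intro!: mult_nonneg_nonneg simp: less_imp_le)
  also have "\<dots> = (\<Sum>a\<in>A. w a * v a) - K"
    by (simp add: right_diff_distrib sum_subtractf assms(3) flip: sum_distrib_right)
  finally show False using assms(4) by simp
qed

text \<open>The codebook has \<open>L\<close> rows of \<open>J\<close> independent codewords with law \<open>r\<close>; the encoder sends a row,
  the decoder picks the entry of the row that satisfies \<open>B\<close> with its side information. An entry is
  good for \<open>x\<close> if it lies in \<open>T x\<close> and the other entries of its row rarely satisfy \<open>B\<close>. Since entries
  in \<open>T x\<close> satisfy \<open>B\<close> with probability more than one half, a row has at most one good entry, so the
  probabilities of the \<open>J\<close> positions add up.\<close>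

lemma one_shot_code:
  fixes p :: "'x \<Rightarrow> 'y \<Rightarrow> real" and q :: "'w \<Rightarrow> 'x \<Rightarrow> real" and r :: "'w \<Rightarrow> real"
    and A :: "'x \<Rightarrow> 'w \<Rightarrow> bool" and B :: "'w \<Rightarrow> 'y \<Rightarrow> bool"
  assumes fin: "finite X" "finite Y" "finite W"
    and p: "\<And>x y. x \<in> X \<Longrightarrow> y \<in> Y \<Longrightarrow> p x y \<ge> 0" "(\<Sum>x\<in>X. \<Sum>y\<in>Y. p x y) = 1"
    and q: "\<And>w x. w \<in> W \<Longrightarrow> x \<in> X \<Longrightarrow> q w x \<ge> 0" "\<And>x. x \<in> X \<Longrightarrow> (\<Sum>w\<in>W. q w x) = 1"
    and r: "\<And>w. w \<in> W \<Longrightarrow> r w \<ge> 0" "(\<Sum>w\<in>W. r w) = 1"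
    and \<alpha>: "\<alpha> > 0" "\<And>x w. x \<in> X \<Longrightarrow> w \<in> W \<Longrightarrow> A x w \<Longrightarrow> q w x \<le> \<alpha> * r w"
    and \<beta>: "\<And>y. y \<in> Y \<Longrightarrow> (\<Sum>w\<in>W. r w * of_bool (B w y)) \<le> \<beta>"
    and \<eta>: "(\<Sum>x\<in>X. \<Sum>w\<in>W. \<Sum>y\<in>Y. p x y * q w x * of_bool (\<not> (A x w \<and> B w y))) \<le> \<eta>"
    and \<tau>: "0 < \<tau>" "\<tau> < 1/2" and J: "J \<ge> 1" "real (J - 1) * \<beta> \<le> \<tau> / 2" and L: "L \<ge> 1"
  shows "\<exists>(e :: 'x \<Rightarrow> nat) u D. (\<forall>x. e x < L) \<and>
    (\<Sum>x\<in>X. \<Sum>y\<in>Y. p x y * of_bool (\<not> (D (e x) y = u x \<and> u x \<in> W \<and> q (u x) x > 0)))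
      \<le> 2 * \<tau> + 2 * \<eta> / \<tau> + exp (- (real L * real J / (4 * \<alpha>)))"
proof -
  define pX where "pX x = (\<Sum>y\<in>Y. p x y)" for x
  have pX: "pX x \<ge> 0" if "x \<in> X" for x using p(1) that by (auto simp: pX_def intro: sum_nonneg)
  have pX1: "(\<Sum>x\<in>X. pX x) = 1" using p(2) by (simp add: pX_def)
  \<comment> \<open>Besides the encoder's test \<open>A\<close>, an entry of \<open>T x\<close> must
    pass the decoder's test except with conditional probability \<open>\<tau>\<close> given
    \<open>x\<close>; \<open>clash\<close> is measured on the same scale.\<close>
  define T where "T x = {w \<in> W. A x w \<and> q w x > 0 \<and> (\<Sum>y\<in>Y. p x y * of_bool (\<not> B w y)) \<le> \<tau> * pX x}" for x
  define miss where "miss x = (\<Sum>w\<in>W - T x. q w x)" for x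
  define clash where "clash x row j = (\<Sum>y\<in>Y. p x y * of_bool (\<exists>k<J. k \<noteq> j \<and> B (row ! k) y))" for x row j
  define good where "good x row j \<longleftrightarrow> j < J \<and> row ! j \<in> T x \<and> clash x row j \<le> \<tau> * pX x" for x row j
  define rr where "rr row = (\<Prod>i<J. r (row ! i))" for row
  let ?R = "words W J"
  have rr: "rr row \<ge> 0" if "row \<in> ?R" for row
    unfolding rr_def by (rule prod_nonneg) (use r(1) words_nth[OF that] in auto)
  have rr1: "(\<Sum>row\<in>?R. rr row) = 1"
    using sum_prod_words[where g = "\<lambda>_. r" and S = W and n = J] r(2) by (simp add: rr_def)
  have TW: "T x \<subseteq> W" for x by (auto simp: T_def)
  have finT: "finite (T x)" for x using TW fin(3) finite_subset by blast

  \<comment> \<open>Markov's inequality: if \<open>w\<close> is outside \<open>T x\<close> and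
    \<open>q w x > 0\<close>, then at least the fraction \<open>\<tau>\<close> of the mass
    \<open>pX x\<close> violates one of the two tests.\<close>
  have miss_total: "(\<Sum>x\<in>X. pX x * miss x) \<le> \<eta> / \<tau>"
  proof -
    have "pX x * miss x \<le> (\<Sum>w\<in>W. \<Sum>y\<in>Y. p x y * q w x * of_bool (\<not> (A x w \<and> B w y))) / \<tau>" if x: "x \<in> X" for x
    proof -
      let ?t = "\<lambda>w. \<Sum>y\<in>Y. p x y * q w x * of_bool (\<not> (A x w \<and> B w y))"
      have nn: "?t w \<ge> 0" if "w \<in> W" for w using p(1) q(1) x that by (intro sum_nonneg) auto
      have "\<tau> * (pX x * q w x) \<le> ?t w" if w: "w \<in> W - T x" for w
      proof -
        consider "q w x = 0" | "\<not> A x w" | "\<tau> * pX x < (\<Sum>y\<in>Y. p x y * of_bool (\<not> B w y))"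
          using w q(1)[of w x] x by (force simp: T_def)
        then show ?thesis
        proof cases
          case 2
          then have "?t w = pX x * q w x" by (simp add: pX_def sum_distrib_right)
          moreover have "0 \<le> pX x * q w x" using pX q(1) w x by auto
          ultimately show ?thesis using \<tau> mult_right_mono[of \<tau> 1 "pX x * q w x"] by simp
        next
          case 3
          have "\<tau> * pX x * q w x \<le> (\<Sum>y\<in>Y. p x y * of_bool (\<not> B w y)) * q w x"
            using 3 q(1) w x by (intro mult_right_mono) auto
          also have "\<dots> \<le> ?t w"
            unfolding sum_distrib_right using p(1) q(1) x w by (intro sum_mono) auto
          finally show ?thesis by (simp add: mult.assoc)
        qed simp
      qed
      then have "(\<Sum>w\<in>W - T x. \<tau> * (pX x * q w x)) \<le> (\<Sum>w\<in>W - T x. ?t w)" by (rule sum_mono)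
      also have "\<dots> \<le> (\<Sum>w\<in>W. ?t w)" using fin nn by (intro sum_mono2) auto
      finally have "\<tau> * (pX x * miss x) \<le> (\<Sum>w\<in>W. ?t w)" by (simp add: miss_def sum_distrib_left)
      then show ?thesis using \<tau> by (simp add: pos_le_divide_eq mult.commute)
    qed
    then have "(\<Sum>x\<in>X. pX x * miss x) \<le> (\<Sum>x\<in>X. (\<Sum>w\<in>W. \<Sum>y\<in>Y. p x y * q w x * of_bool (\<not> (A x w \<and> B w y))) / \<tau>)"
      by (rule sum_mono)
    also have "\<dots> \<le> \<eta> / \<tau>"
      unfolding sum_divide_distrib [symmetric] using \<eta> \<tau> by (intro divide_right_mono) auto
    finally show ?thesis .
  qed

  have good_unique: "j = k" if x: "x \<in> X" "pX x > 0" and "good x row j" "good x row k" for x row j k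
  proof (rule ccontr)
    assume "j \<noteq> k"
    have "pX x = (\<Sum>y\<in>Y. p x y * of_bool (\<not> B (row ! k) y)) + (\<Sum>y\<in>Y. p x y * of_bool (B (row ! k) y))"
      unfolding pX_def sum.distrib [symmetric] by (rule sum.cong) auto
    moreover have "(\<Sum>y\<in>Y. p x y * of_bool (\<not> B (row ! k) y)) \<le> \<tau> * pX x"
      using that by (auto simp: good_def T_def)
    moreover have "(\<Sum>y\<in>Y. p x y * of_bool (B (row ! k) y)) \<le> clash x row j"
      unfolding clash_def using \<open>j \<noteq> k\<close> \<open>good x row k\<close> p(1) x
      by (intro sum_mono mult_left_mono) (auto simp: good_def)
    moreover have "clash x row j \<le> \<tau> * pX x" using that by (simp add: good_def)
    moreover have "\<tau> * pX x < 1/2 * pX x" using \<tau> x by (intro mult_strict_right_mono) auto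
    ultimately show False by linarith
  qed

  have row_prob: "(\<Sum>row\<in>?R. rr row * of_bool (\<exists>j. good x row j)) \<ge> real J / (4 * \<alpha>)"
    if x: "x \<in> X" "pX x > 0" and m: "miss x \<le> 1/2" for x
  proof -
    define rT where "rT = (\<Sum>w\<in>W. r w * of_bool (w \<in> T x))"
    have "1/2 \<le> (\<Sum>w\<in>T x. q w x)"
      using m q(2)[OF x(1)] sum.subset_diff[OF TW fin(3), of "\<lambda>w. q w x" x] by (simp add: miss_def)
    also have "\<dots> \<le> (\<Sum>w\<in>T x. \<alpha> * r w)"
      using \<alpha>(2) x by (intro sum_mono) (auto simp: T_def)
    also have "\<dots> = \<alpha> * rT"
      unfolding rT_def using TW[of x] fin(3)
      by (simp add: sum_distrib_left [symmetric] of_bool_def if_distrib sum.If_cases Int_absorb1 cong: if_cong)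
    \<comment> \<open>At least half of the mass of \<open>q\<close> lies in \<open>T x\<close>;
      passing to the codeword law \<open>r\<close> costs the factor \<open>\<alpha>\<close>.\<close>
    finally have rT: "rT \<ge> 1 / (2 * \<alpha>)" using \<alpha>(1) by (simp add: field_simps)
    have rT0: "rT \<ge> 0" using rT \<alpha>(1) by (meson divide_nonneg_nonneg less_imp_le mult_nonneg_nonneg order_trans zero_le_numeral zero_le_one)
    have one_j: "(\<Sum>row\<in>?R. rr row * of_bool (good x row j)) \<ge> 1 / (4 * \<alpha>)" if j: "j < J" for j
    proof -
      let ?K = "{..<J} - {j}"
      \<comment> \<open>The union bound for the clashes of entry \<open>j\<close>, multiplied by the
        indicator of \<open>row ! j \<in> T x\<close>; its mean factorizes because the entries
        \<open>j\<close> and \<open>k\<close> are independent.\<close>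
      define b where "b row = (\<Sum>y\<in>Y. \<Sum>k\<in>?K. p x y * (of_bool (row ! j \<in> T x) * of_bool (B (row ! k) y)))" for row
      \<comment> \<open>An entry of \<open>T x\<close> that is not good has a clash above the
        threshold, and then the subtracted quotient is at least 1.\<close>
      have pt: "of_bool (row ! j \<in> T x) - b row / (\<tau> * pX x) \<le> (of_bool (good x row j) :: real)" for row
      proof -
        have pos: "0 < \<tau> * pX x" using \<tau> x by simp
        have b0: "b row \<ge> 0" unfolding b_def using p(1) x by (intro sum_nonneg) auto
        show ?thesis
        proof (cases "row ! j \<in> T x \<and> \<not> good x row j")
          case True
          then have "\<tau> * pX x < clash x row j" using j by (auto simp: good_def)
          also have "\<dots> \<le> b row"
            unfolding clash_def b_def
          proof (rule sum_mono)
            fix y assume y: "y \<in> Y"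
            have "of_bool (\<exists>k<J. k \<noteq> j \<and> B (row ! k) y) \<le> (\<Sum>k\<in>?K. of_bool (B (row ! k) y) :: real)"
            proof (cases "\<exists>k<J. k \<noteq> j \<and> B (row ! k) y")
              case True
              then obtain k where "k \<in> ?K" "B (row ! k) y" by auto
              then show ?thesis
                using True member_le_sum[of k ?K "\<lambda>k. of_bool (B (row ! k) y) :: real"] by simp
            next
              case False
              then have "of_bool (\<exists>k<J. k \<noteq> j \<and> B (row ! k) y) = (0 :: real)" by simp
              then show ?thesis by (metis (no_types, lifting) of_nat_0_le_iff of_nat_of_bool sum_nonneg)
            qed
            then show "p x y * of_bool (\<exists>k<J. k \<noteq> j \<and> B (row ! k) y)
              \<le> (\<Sum>k\<in>?K. p x y * (of_bool (row ! j \<in> T x) * of_bool (B (row ! k) y)))"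
              using p(1)[OF x(1) y] True
              by (simp add: sum_distrib_left [symmetric] mult_left_mono del: sum_of_bool_eq)
          qed
          finally have "1 \<le> b row / (\<tau> * pX x)" using pos by (simp add: pos_le_divide_eq)
          then show ?thesis using True by simp
        next
          case False
          then have "of_bool (row ! j \<in> T x) \<le> (of_bool (good x row j) :: real)" by auto
          moreover have "0 \<le> b row / (\<tau> * pX x)" using b0 pos by (intro divide_nonneg_pos)
          ultimately show ?thesis by linarith
        qed
      qed
      have s1: "(\<Sum>row\<in>?R. rr row * of_bool (row ! j \<in> T x)) = rT"
        unfolding rr_def rT_def by (rule sum_words_one_coord[OF r(2) j])
      have "(\<Sum>row\<in>?R. rr row * b row)
        = (\<Sum>y\<in>Y. \<Sum>k\<in>?K. p x y * (\<Sum>row\<in>?R. rr row * (of_bool (row ! j \<in> T x) * of_bool (B (row ! k) y))))"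
        unfolding b_def sum_distrib_left
        by (subst sum.swap, intro sum.cong refl, subst sum.swap) (simp add: mult.left_commute)
      also have "\<dots> = (\<Sum>y\<in>Y. \<Sum>k\<in>?K. p x y * (rT * (\<Sum>w\<in>W. r w * of_bool (B w y))))"
        unfolding rr_def rT_def
        by (intro sum.cong refl arg_cong2[where f = "(*)"] sum_words_two_coords[OF r(2) j]) auto
      also have "\<dots> \<le> (\<Sum>y\<in>Y. \<Sum>k\<in>?K. p x y * (rT * \<beta>))"
        using p(1) x rT0 \<beta> by (intro sum_mono mult_left_mono) auto
      also have "\<dots> = pX x * (rT * (real (J - 1) * \<beta>))"
        using j by (simp add: pX_def sum_distrib_right sum_distrib_left card_Diff_singleton ac_simps)
      \<comment> \<open>The bound on \<open>J\<close> is made for this: clashes cost at most half of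
        \<open>rT\<close>, which turns \<open>1 / (2 * \<alpha>)\<close> into
        \<open>1 / (4 * \<alpha>)\<close>.\<close>
      also have "\<dots> \<le> pX x * (rT * (\<tau> / 2))" using J(2) pX x rT0 by (intro mult_left_mono) auto
      finally have "(\<Sum>row\<in>?R. rr row * b row) / (\<tau> * pX x) \<le> rT / 2"
        using \<tau> x by (simp add: field_simps)
      then have "rT / 2 \<le> (\<Sum>row\<in>?R. rr row * of_bool (row ! j \<in> T x)) - (\<Sum>row\<in>?R. rr row * b row) / (\<tau> * pX x)"
        using s1 by simp
      also have "\<dots> = (\<Sum>row\<in>?R. rr row * (of_bool (row ! j \<in> T x) - b row / (\<tau> * pX x)))"
        by (simp add: right_diff_distrib sum_subtractf sum_divide_distrib)
      also have "\<dots> \<le> (\<Sum>row\<in>?R. rr row * of_bool (good x row j))"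
        using pt rr by (intro sum_mono mult_left_mono) auto
      finally show ?thesis using rT by simp
    qed
    have "real J / (4 * \<alpha>) = (\<Sum>j<J. 1 / (4 * \<alpha>))" by simp
    also have "\<dots> \<le> (\<Sum>j<J. \<Sum>row\<in>?R. rr row * of_bool (good x row j))"
      using one_j by (intro sum_mono) auto
    also have "\<dots> = (\<Sum>row\<in>?R. rr row * (\<Sum>j<J. of_bool (good x row j)))"
      by (subst sum.swap) (simp only: sum_distrib_left)
    also have "\<dots> \<le> (\<Sum>row\<in>?R. rr row * of_bool (\<exists>j. good x row j))"
    proof (intro sum_mono mult_left_mono)
      fix row
      show "(\<Sum>j<J. of_bool (good x row j)) \<le> (of_bool (\<exists>j. good x row j) :: real)"
      proof (cases "\<exists>j. good x row j")
        case True
        then obtain j where j: "good x row j" ..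
        then have "(\<Sum>k<J. of_bool (good x row k)) = (\<Sum>k<J. (if k = j then 1 else 0) :: real)"
          using good_unique[OF x] by (intro sum.cong) auto
        also have "\<dots> \<le> 1" by simp
        finally show ?thesis using True by simp
      qed simp
    qed (use rr in auto)
    finally show ?thesis .
  qed

  let ?CB = "words ?R L"
  define wt where "wt cs = (\<Prod>l<L. rr (cs ! l))" for cs
  define fail where "fail x cs \<longleftrightarrow> (\<forall>l<L. \<not> (\<exists>j. good x (cs ! l) j))" for x cs
  define Xg where "Xg = {x \<in> X. pX x > 0 \<and> miss x \<le> 1/2}"
  let ?ex = "exp (- (real L * real J / (4 * \<alpha>)))"
  have wt0: "wt cs \<ge> 0" if "cs \<in> ?CB" for cs
    unfolding wt_def by (rule prod_nonneg) (use rr words_nth[OF that] in auto)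
  have wt1: "(\<Sum>cs\<in>?CB. wt cs) = 1"
    using sum_prod_words[where g = "\<lambda>_. rr" and S = ?R and n = L] rr1 by (simp add: wt_def)
  \<comment> \<open>The rows are independent, so the failure probability of one row is raised to the
    power \<open>L\<close>; then \<open>1 - t \<le> exp (- t)\<close>.\<close>
  have fail_prob: "(\<Sum>cs\<in>?CB. wt cs * of_bool (fail x cs)) \<le> ?ex" if x: "x \<in> Xg" for x
  proof -
    let ?h = "\<lambda>row. rr row * of_bool (\<not> (\<exists>j. good x row j))"
    have prod_bool: "(\<Prod>l<L. of_bool (Q l) :: real) = of_bool (\<forall>l<L. Q l)" for Q
      by (cases "\<forall>l<L. Q l") auto
    have "(\<Sum>cs\<in>?CB. wt cs * of_bool (fail x cs)) = (\<Sum>cs\<in>?CB. \<Prod>l<L. ?h (cs ! l))"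
      by (simp only: wt_def fail_def prod.distrib prod_bool)
    also have "\<dots> = (\<Sum>row\<in>?R. ?h row) ^ L"
      using sum_prod_words[where g = "\<lambda>_. ?h" and S = ?R and n = L] by simp
    also have "\<dots> \<le> exp (- (real J / (4 * \<alpha>))) ^ L"
    proof (rule power_mono)
      have "(\<Sum>row\<in>?R. ?h row) + (\<Sum>row\<in>?R. rr row * of_bool (\<exists>j. good x row j)) = 1"
        unfolding sum.distrib [symmetric] rr1 [symmetric] by (rule sum.cong) auto
      then have "(\<Sum>row\<in>?R. ?h row) \<le> 1 + - (real J / (4 * \<alpha>))"
        using row_prob[of x] x by (simp add: Xg_def)
      also have "\<dots> \<le> exp (- (real J / (4 * \<alpha>)))" by (rule exp_ge_add_one_self)
      finally show "(\<Sum>row\<in>?R. ?h row) \<le> exp (- (real J / (4 * \<alpha>)))" .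
      show "0 \<le> (\<Sum>row\<in>?R. ?h row)" using rr by (intro sum_nonneg) auto
    qed
    also have "\<dots> = ?ex" by (simp add: exp_of_nat_mult [symmetric])
    finally show ?thesis .
  qed
  have "\<exists>cs\<in>?CB. (\<Sum>x\<in>Xg. pX x * of_bool (fail x cs)) \<le> ?ex"
  proof (rule weighted_average_le_ex[of ?CB wt])
    have "(\<Sum>cs\<in>?CB. wt cs * (\<Sum>x\<in>Xg. pX x * of_bool (fail x cs)))
      = (\<Sum>x\<in>Xg. pX x * (\<Sum>cs\<in>?CB. wt cs * of_bool (fail x cs)))"
      unfolding sum_distrib_left by (subst sum.swap) (simp add: mult.left_commute)
    also have "\<dots> \<le> (\<Sum>x\<in>Xg. pX x * ?ex)"
      using fail_prob pX by (intro sum_mono mult_left_mono) (auto simp: Xg_def)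
    also have "\<dots> \<le> (\<Sum>x\<in>X. pX x * ?ex)"
      using fin pX by (intro sum_mono2) (auto simp: Xg_def)
    also have "\<dots> = ?ex" by (simp add: pX1 flip: sum_distrib_right)
    finally show "(\<Sum>cs\<in>?CB. wt cs * (\<Sum>x\<in>Xg. pX x * of_bool (fail x cs))) \<le> ?ex" .
  qed (use wt0 wt1 fin in auto)
  then obtain cs where cs: "(\<Sum>x\<in>Xg. pX x * of_bool (fail x cs)) \<le> ?ex" by blast

  \<comment> \<open>Without a good entry in any row, row 0 is sent as a default.\<close>
  have "\<exists>lj. fst lj < L \<and> (\<not> fail x cs \<longrightarrow> good x (cs ! fst lj) (snd lj))" for x
    using L unfolding fail_def by (cases "\<exists>l<L. \<exists>j. good x (cs ! l) j") (auto intro: exI[of _ 0])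
  then obtain lj where lj: "\<And>x. fst (lj x) < L" "\<And>x. \<not> fail x cs \<Longrightarrow> good x (cs ! fst (lj x)) (snd (lj x))"
    by metis
  define e where "e x = fst (lj x)" for x
  define u where "u x = cs ! e x ! snd (lj x)" for x
  define D where "D l y = cs ! l ! (SOME j. j < J \<and> B (cs ! l ! j) y)" for l y
  \<comment> \<open>Three sources of error: a failed test or a clash at the chosen good entry
    (\<open>\<tau>\<close> each), a source value with \<open>miss x > 1/2\<close> (Markov again,
    whence the factor 2), and a codebook without a good entry.\<close>
  have err: "(\<Sum>y\<in>Y. p x y * of_bool (\<not> (D (e x) y = u x \<and> u x \<in> W \<and> q (u x) x > 0)))
     \<le> 2 * \<tau> * pX x + 2 * (pX x * miss x) + (if x \<in> Xg then pX x * of_bool (fail x cs) else 0)" (is "?er x \<le> _")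
    if x: "x \<in> X" for x
  proof -
    have m0: "0 \<le> miss x" unfolding miss_def using q(1) x by (intro sum_nonneg) auto
    have er1: "?er x \<le> pX x" unfolding pX_def using p(1) x by (intro sum_mono) auto
    have t0: "0 \<le> 2 * \<tau> * pX x" "0 \<le> 2 * (pX x * miss x)" using \<tau> pX[OF x] m0 by auto
    consider "pX x = 0" | "pX x > 0" "miss x > 1/2" | "x \<in> Xg" "fail x cs" | "x \<in> Xg" "\<not> fail x cs"
      using x pX[OF x] by (force simp: Xg_def)
    then show ?thesis
    proof cases
      case 1
      then show ?thesis using er1 by (simp add: Xg_def)
    next
      case 2
      then have "pX x * 1 \<le> pX x * (2 * miss x)" by (intro mult_left_mono) auto
      then have "pX x \<le> 2 * (pX x * miss x)" by simp
      moreover have "(if x \<in> Xg then pX x * of_bool (fail x cs) else 0) = 0" using 2 by (simp add: Xg_def)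
      ultimately show ?thesis using er1 t0 by linarith
    next
      case 3
      then have "(if x \<in> Xg then pX x * of_bool (fail x cs) else 0) = pX x" by simp
      then show ?thesis using er1 t0 by linarith
    next
      case 4
      let ?j = "snd (lj x)" and ?row = "cs ! e x"
      have g: "good x ?row ?j" using lj(2)[OF 4(2)] by (simp add: e_def)
      then have uT: "u x \<in> T x" and j: "?j < J" by (auto simp: good_def u_def)
      have "?er x \<le> (\<Sum>y\<in>Y. p x y * of_bool (\<not> B (u x) y) + p x y * of_bool (\<exists>k<J. k \<noteq> ?j \<and> B (?row ! k) y))"
      proof (rule sum_mono)
        fix y assume y: "y \<in> Y"
        have "D (e x) y = u x" if "B (u x) y" "\<not> (\<exists>k<J. k \<noteq> ?j \<and> B (?row ! k) y)"
        proof -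
          have "(SOME j. j < J \<and> B (?row ! j) y) = ?j"
            by (rule some_equality) (use that j in \<open>auto simp: u_def\<close>)
          then show ?thesis by (simp add: D_def u_def)
        qed
        then show "p x y * of_bool (\<not> (D (e x) y = u x \<and> u x \<in> W \<and> q (u x) x > 0))
          \<le> p x y * of_bool (\<not> B (u x) y) + p x y * of_bool (\<exists>k<J. k \<noteq> ?j \<and> B (?row ! k) y)"
          using p(1)[OF x y] uT by (auto simp: T_def)
      qed
      also have "\<dots> \<le> \<tau> * pX x + \<tau> * pX x"
        unfolding sum.distrib using uT g by (intro add_mono) (auto simp: T_def good_def clash_def)
      finally have "?er x \<le> 2 * \<tau> * pX x" by simp
      moreover have "(if x \<in> Xg then pX x * of_bool (fail x cs) else 0) = 0" using 4 by simp
      ultimately show ?thesis using t0 by linarith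
    qed
  qed
  have "(\<Sum>x\<in>X. ?er x) \<le> (\<Sum>x\<in>X. 2 * \<tau> * pX x + 2 * (pX x * miss x) + (if x \<in> Xg then pX x * of_bool (fail x cs) else 0))"
    using err by (rule sum_mono)
  also have "\<dots> = 2 * \<tau> + 2 * (\<Sum>x\<in>X. pX x * miss x) + (\<Sum>x\<in>Xg. pX x * of_bool (fail x cs))"
  proof -
    have "X \<inter> Xg = Xg" by (auto simp: Xg_def)
    then show ?thesis using fin pX1
      by (simp add: sum.distrib sum_distrib_left [symmetric] sum.If_cases)
  qed
  also have "\<dots> \<le> 2 * \<tau> + 2 * \<eta> / \<tau> + ?ex" using miss_total cs by simp
  finally have "(\<Sum>x\<in>X. ?er x) \<le> 2 * \<tau> + 2 * \<eta> / \<tau> + ?ex" .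
  moreover have "\<forall>x. e x < L" using lj(1) by (simp add: e_def)
  ultimately show ?thesis by blast
qed

subsection \<open>Achievability\<close>

lemma sum_words_triple:
  "(\<Sum>zs\<in>words (A \<times> B \<times> C) n. F (map fst zs) (map (fst \<circ> snd) zs) (map (snd \<circ> snd) zs))
     = (\<Sum>xs\<in>words A n. \<Sum>ys\<in>words B n. \<Sum>us\<in>words C n. F xs ys us)"
  using sum_words_prod_set[where A = A and B = "B \<times> C" and n = n
      and F = "\<lambda>xs zs. F xs (map fst zs) (map snd zs)"]
  by (simp add: sum_words_prod_set)

lemma prod_eq_powr_sum_log:
  fixes a :: "'i \<Rightarrow> real"
  assumes "\<And>i. i \<in> I \<Longrightarrow> a i > 0"
  shows "(\<Prod>i\<in>I. a i) = 2 powr (\<Sum>i\<in>I. log 2 (a i))"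
  using assms by (induction I rule: infinite_finite_induct) (auto simp: powr_add)

section \<open>A source with an admissible channel, and its block code\<close>

locale source_channel =
  fixes nx ny :: nat and P :: "nat \<Rightarrow> nat \<Rightarrow> real" and E :: "nat set set"
    and Q :: "nat set \<Rightarrow> nat \<Rightarrow> real"
  assumes joint: "is_joint_dist nx ny P" and finE: "finite E" and chan: "hyper_channel nx E Q"
begin

lemma P_nonneg: "x < nx \<Longrightarrow> y < ny \<Longrightarrow> P x y \<ge> 0"
  using joint by (auto simp: is_joint_dist_def)

lemma P_sum: "(\<Sum>x<nx. \<Sum>y<ny. P x y) = 1"
  using joint by (auto simp: is_joint_dist_def)

lemma Q_nonneg: "w \<in> E \<Longrightarrow> x < nx \<Longrightarrow> Q w x \<ge> 0"
  using chan by (auto simp: hyper_channel_def)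

lemma Q_sum: "x < nx \<Longrightarrow> (\<Sum>w\<in>E. Q w x) = 1"
  using chan by (auto simp: hyper_channel_def)

lemma Q_pos_mem: "w \<in> E \<Longrightarrow> x < nx \<Longrightarrow> Q w x > 0 \<Longrightarrow> x \<in> w"
  using chan by (force simp: hyper_channel_def)

definition py :: "nat \<Rightarrow> real" where "py y = (\<Sum>x<nx. P x y)"
definition pwy :: "nat set \<Rightarrow> nat \<Rightarrow> real" where "pwy w y = (\<Sum>x<nx. P x y * Q w x)"
definition pw :: "nat set \<Rightarrow> real" where "pw w = (\<Sum>x<nx. \<Sum>y<ny. P x y * Q w x)"
text \<open>The conditional law of W given Y. It is 0 at letters of probability zero, where the
  quotient is a division by zero; hence \<open>V_sum\<close> is only an inequality.\<close>

definition V :: "nat set \<Rightarrow> nat \<Rightarrow> real" where "V w y = pwy w y / py y"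
definition \<mu> :: "nat set \<Rightarrow> nat \<Rightarrow> nat \<Rightarrow> real" where "\<mu> w x y = P x y * Q w x"

text \<open>\<open>D1\<close> is I(W;X) and the next constant \<open>D2\<close> is I(W;Y), both as
  means of log-likelihood ratios to which the weak law applies. The weight \<open>\<mu>\<close>
  vanishes wherever a ratio is not positive.\<close>

definition D1 :: real where
  "D1 = (\<Sum>w\<in>E. \<Sum>x<nx. \<Sum>y<ny. \<mu> w x y * log 2 (Q w x / pw w))"
definition D2 :: real where
  "D2 = (\<Sum>w\<in>E. \<Sum>x<nx. \<Sum>y<ny. \<mu> w x y * log 2 (V w y / pw w))"

lemma \<mu>_nonneg: "w \<in> E \<Longrightarrow> x < nx \<Longrightarrow> y < ny \<Longrightarrow> \<mu> w x y \<ge> 0"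
  unfolding \<mu>_def by (intro mult_nonneg_nonneg P_nonneg Q_nonneg)

lemma \<mu>_sum: "(\<Sum>w\<in>E. \<Sum>x<nx. \<Sum>y<ny. \<mu> w x y) = 1"
proof -
  have "(\<Sum>w\<in>E. \<Sum>x<nx. \<Sum>y<ny. \<mu> w x y) = (\<Sum>x<nx. \<Sum>y<ny. \<Sum>w\<in>E. P x y * Q w x)"
    unfolding \<mu>_def by (subst sum.swap, intro sum.cong refl, rule sum.swap)
  also have "\<dots> = 1" using Q_sum P_sum by (simp flip: sum_distrib_left)
  finally show ?thesis .
qed

lemma \<mu>_posD:
  assumes "w \<in> E" "x < nx" "y < ny" "\<mu> w x y > 0"
  shows "P x y > 0" "Q w x > 0" "py y > 0" "pwy w y > 0" "pw w > 0" "V w y > 0"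
proof -
  show P: "P x y > 0" and Q: "Q w x > 0"
    using assms P_nonneg[of x y] Q_nonneg[of w x] unfolding \<mu>_def
    by (auto simp: zero_less_mult_iff)
  show py: "py y > 0" unfolding py_def
    using assms P P_nonneg by (intro sum_pos2[of _ x]) auto
  show pwy: "pwy w y > 0" unfolding pwy_def
    using assms P_nonneg Q_nonneg by (intro sum_pos2[of _ x]) (auto simp: \<mu>_def)
  have "0 < (\<Sum>y<ny. P x y * Q w x)"
    using assms P_nonneg Q_nonneg by (intro sum_pos2[of _ y]) (auto simp: \<mu>_def)
  then show "pw w > 0" unfolding pw_def
    by (rule sum_pos2[of _ x, rotated 2]) (use assms P_nonneg Q_nonneg in \<open>auto intro!: sum_nonneg\<close>)
  show "V w y > 0" unfolding V_def using py pwy by simp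
qed

lemma V_nonneg: "w \<in> E \<Longrightarrow> y < ny \<Longrightarrow> V w y \<ge> 0"
  unfolding V_def pwy_def py_def using P_nonneg Q_nonneg
  by (intro divide_nonneg_nonneg sum_nonneg) auto

lemma V_sum: "y < ny \<Longrightarrow> (\<Sum>w\<in>E. V w y) \<le> 1"
proof -
  assume y: "y < ny"
  have "(\<Sum>w\<in>E. pwy w y) = (\<Sum>x<nx. \<Sum>w\<in>E. P x y * Q w x)"
    unfolding pwy_def by (rule sum.swap)
  also have "\<dots> = py y" using Q_sum by (simp add: py_def flip: sum_distrib_left)
  finally have "(\<Sum>w\<in>E. V w y) = py y / py y" by (simp add: V_def flip: sum_divide_distrib)
  then show ?thesis by simp
qed

lemma pw_nonneg: "w \<in> E \<Longrightarrow> pw w \<ge> 0"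
  unfolding pw_def using P_nonneg Q_nonneg by (intro sum_nonneg) auto

lemma pw_sum: "(\<Sum>w\<in>E. pw w) = 1"
  using \<mu>_sum by (simp add: pw_def \<mu>_def)

lemma cond_mi_eq: "cond_mi nx ny P E Q = (\<Sum>w\<in>E. \<Sum>x<nx. \<Sum>y<ny. \<mu> w x y * log 2 (Q w x / V w y))"
  unfolding cond_mi_def Let_def
proof (intro sum.cong refl)
  fix w x y assume a: "w \<in> E" "x \<in> {..<nx}" "y \<in> {..<ny}"
  show "(if P x y * Q w x > 0 then P x y * Q w x * log 2 (P x y * Q w x * (\<Sum>x'<nx. P x' y) /
            ((\<Sum>x'<nx. P x' y * Q w x') * P x y)) else 0) = \<mu> w x y * log 2 (Q w x / V w y)"
  proof (cases "\<mu> w x y > 0")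
    case True
    note pos = \<mu>_posD[OF a(1) _ _ True]
    have "P x y * Q w x * py y / (pwy w y * P x y) = Q w x / V w y"
      using pos a by (simp add: V_def field_simps)
    then show ?thesis using True by (simp add: \<mu>_def py_def pwy_def)
  next
    case False
    then have "\<mu> w x y = 0" using \<mu>_nonneg[of w x y] a by simp
    then show ?thesis by (simp add: \<mu>_def)
  qed
qed

text \<open>The chain rule for the Markov chain W - X - Y: given x, the law of W does not change
  with y, so the density \<open>Q w x / V w y\<close> is the quotient of the densities behind
  \<open>D1\<close> and \<open>D2\<close>.\<close>

lemma cond_mi_eq_diff: "cond_mi nx ny P E Q = D1 - D2"
  unfolding cond_mi_eq D1_def D2_def sum_subtractf [symmetric]
proof (intro sum.cong refl)
  fix w x y assume a: "w \<in> E" "x \<in> {..<nx}" "y \<in> {..<ny}"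
  show "\<mu> w x y * log 2 (Q w x / V w y)
     = \<mu> w x y * log 2 (Q w x / pw w) - \<mu> w x y * log 2 (V w y / pw w)"
  proof (cases "\<mu> w x y > 0")
    case True
    note pos = \<mu>_posD[OF a(1) _ _ True]
    show ?thesis using pos a by (simp add: log_divide right_diff_distrib)
  next
    case False
    then have "\<mu> w x y = 0" using \<mu>_nonneg[of w x y] a by simp
    then show ?thesis by simp
  qed
qed

text \<open>Gibbs' inequality from \<open>ln t \<le> t - 1\<close>: \<open>\<mu>\<close> has mass 1
  and is compared with \<open>P x y * V w y\<close>, of mass at most 1.\<close>

lemma cond_mi_nonneg: "cond_mi nx ny P E Q \<ge> 0"
proof -
  have summand: "(\<mu> w x y - P x y * V w y) / ln 2 \<le> \<mu> w x y * log 2 (Q w x / V w y)"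
    if a: "w \<in> E" "x < nx" "y < ny" for w x y
  proof (cases "\<mu> w x y > 0")
    case True
    note pos = \<mu>_posD[OF a True]
    have "1 - V w y / Q w x \<le> - ln (V w y / Q w x)"
      using ln_le_minus_one[of "V w y / Q w x"] pos by simp
    also have "\<dots> = ln (Q w x / V w y)" using pos by (simp add: ln_div)
    finally have "\<mu> w x y * (1 - V w y / Q w x) \<le> \<mu> w x y * ln (Q w x / V w y)"
      using True by (intro mult_left_mono) auto
    moreover have "\<mu> w x y * (1 - V w y / Q w x) = \<mu> w x y - P x y * V w y"
      using pos by (simp add: \<mu>_def field_simps)
    ultimately have "\<mu> w x y - P x y * V w y \<le> \<mu> w x y * ln (Q w x / V w y)" by simp
    then show ?thesis by (simp add: log_def divide_right_mono)
  next
    case False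
    then have "\<mu> w x y = 0" using \<mu>_nonneg[of w x y] a by simp
    then show ?thesis using P_nonneg[of x y] V_nonneg[of w y] a by simp
  qed
  have "(\<Sum>w\<in>E. \<Sum>x<nx. \<Sum>y<ny. P x y * V w y) = (\<Sum>x<nx. \<Sum>y<ny. \<Sum>w\<in>E. P x y * V w y)"
    by (subst sum.swap, intro sum.cong refl, rule sum.swap)
  also have "\<dots> = (\<Sum>x<nx. \<Sum>y<ny. P x y * (\<Sum>w\<in>E. V w y))" by (simp only: sum_distrib_left)
  also have "\<dots> \<le> (\<Sum>x<nx. \<Sum>y<ny. P x y * 1)"
    using V_sum P_nonneg by (intro sum_mono mult_left_mono) auto
  finally have "0 \<le> (\<Sum>w\<in>E. \<Sum>x<nx. \<Sum>y<ny. \<mu> w x y - P x y * V w y) / ln 2"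
    using P_sum \<mu>_sum by (simp add: sum_subtractf)
  also have "\<dots> \<le> cond_mi nx ny P E Q"
    unfolding cond_mi_eq sum_divide_distrib by (intro sum_mono summand) auto
  finally show ?thesis .
qed

text \<open>\<open>K\<close> is a variance divided by \<open>\<delta>\<^sup>2\<close>, so one
  constant serves all block lengths.\<close>

lemma weak_law_triples:
  fixes g :: "nat set \<Rightarrow> nat \<Rightarrow> nat \<Rightarrow> real"
  assumes "\<delta> > 0"
  shows "\<exists>K. \<forall>n>0. (\<Sum>ws\<in>words E n. \<Sum>xs\<in>words {..<nx} n. \<Sum>ys\<in>words {..<ny} n.
      (\<Prod>i<n. \<mu> (ws ! i) (xs ! i) (ys ! i)) *
      of_bool (\<bar>(\<Sum>i<n. g (ws ! i) (xs ! i) (ys ! i))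
         - real n * (\<Sum>w\<in>E. \<Sum>x<nx. \<Sum>y<ny. \<mu> w x y * g w x y)\<bar> \<ge> real n * \<delta>)) \<le> K / real n"
proof -
  let ?S = "E \<times> {..<nx} \<times> {..<ny}"
  define m h where "m = (\<lambda>(w, x, y). \<mu> w x y)" and "h = (\<lambda>(w, x, y). g w x y)"
  define e where "e = (\<Sum>w\<in>E. \<Sum>x<nx. \<Sum>y<ny. \<mu> w x y * g w x y)"
  have fin: "finite ?S" using finE by simp
  have one: "(\<Sum>a\<in>?S. m a) = 1" using \<mu>_sum by (simp add: m_def sum.cartesian_product)
  have nn: "m a \<ge> 0" if "a \<in> ?S" for a using that \<mu>_nonneg by (auto simp: m_def)
  have e: "(\<Sum>a\<in>?S. m a * h a) = e" unfolding e_def m_def h_def sum.cartesian_product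
    by (intro sum.cong) auto
  let ?v = "(\<Sum>a\<in>?S. m a * (h a - e)\<^sup>2) / \<delta>\<^sup>2"
  have "(\<Sum>ws\<in>words E n. \<Sum>xs\<in>words {..<nx} n. \<Sum>ys\<in>words {..<ny} n.
      (\<Prod>i<n. \<mu> (ws ! i) (xs ! i) (ys ! i)) *
      of_bool (\<bar>(\<Sum>i<n. g (ws ! i) (xs ! i) (ys ! i)) - real n * e\<bar> \<ge> real n * \<delta>)) \<le> ?v / real n" if n: "n > 0" for n
  proof -
    have "(\<Sum>zs\<in>words ?S n. if \<bar>(\<Sum>i<n. h (zs ! i)) - real n * e\<bar> \<ge> real n * \<delta>
            then (\<Prod>i<n. m (zs ! i)) else 0) \<le> (\<Sum>a\<in>?S. m a * (h a - e)\<^sup>2) / (real n * \<delta>\<^sup>2)"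
      using weak_law_words[OF fin nn one n assms, of h] e by simp
    moreover have "(\<Sum>zs\<in>words ?S n. if \<bar>(\<Sum>i<n. h (zs ! i)) - real n * e\<bar> \<ge> real n * \<delta>
            then (\<Prod>i<n. m (zs ! i)) else 0)
       = (\<Sum>ws\<in>words E n. \<Sum>xs\<in>words {..<nx} n. \<Sum>ys\<in>words {..<ny} n.
      (\<Prod>i<n. \<mu> (ws ! i) (xs ! i) (ys ! i)) *
      of_bool (\<bar>(\<Sum>i<n. g (ws ! i) (xs ! i) (ys ! i)) - real n * e\<bar> \<ge> real n * \<delta>))"
      unfolding sum_words_triple [symmetric]
    proof (intro sum.cong refl)
      fix zs assume "zs \<in> words ?S n"
      then have l: "length zs = n" by (rule words_length)
      have "(\<Sum>i<n. h (zs ! i)) = (\<Sum>i<n. g (map fst zs ! i) (map (fst \<circ> snd) zs ! i) (map (snd \<circ> snd) zs ! i))"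
        "(\<Prod>i<n. m (zs ! i)) = (\<Prod>i<n. \<mu> (map fst zs ! i) (map (fst \<circ> snd) zs ! i) (map (snd \<circ> snd) zs ! i))"
        using l by (auto simp: h_def m_def case_prod_unfold intro!: sum.cong prod.cong)
      then show "(if \<bar>(\<Sum>i<n. h (zs ! i)) - real n * e\<bar> \<ge> real n * \<delta> then (\<Prod>i<n. m (zs ! i)) else 0)
        = (\<Prod>i<n. \<mu> (map fst zs ! i) (map (fst \<circ> snd) zs ! i) (map (snd \<circ> snd) zs ! i)) *
          of_bool (\<bar>(\<Sum>i<n. g (map fst zs ! i) (map (fst \<circ> snd) zs ! i) (map (snd \<circ> snd) zs ! i)) - real n * e\<bar> \<ge> real n * \<delta>)"
        by simp
    qed
    ultimately show ?thesis by (simp add: mult.commute)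
  qed
  then show ?thesis unfolding e_def by blast
qed

text \<open>The one-shot code for product laws. The encoder's test compares \<open>q\<close> with
  \<open>r\<close>, the decoder's test \<open>r\<close> with \<open>v\<close>; violating either is a
  deviation of an empirical mean from \<open>D1\<close> or \<open>D2\<close> by at least
  \<open>\<delta>\<close>. \<open>K\<close> precedes the block parameters, so that these may be
  chosen as functions of \<open>n\<close>.\<close>

lemma block_code:
  assumes d: "\<delta> > 0"
  obtains K where "\<And>n \<tau> J L. n > 0 \<Longrightarrow> 0 < \<tau> \<Longrightarrow> \<tau> < 1/2 \<Longrightarrow> J \<ge> 1 \<Longrightarrow> L \<ge> 1 \<Longrightarrow>
      real (J - 1) * 2 powr (- (real n * (D2 - \<delta>))) \<le> \<tau> / 2 \<Longrightarrow>
      \<exists>(e :: nat list \<Rightarrow> nat) u D. (\<forall>xs. e xs < L) \<and>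
       (\<Sum>xs\<in>words {..<nx} n. \<Sum>ys\<in>words {..<ny} n. (\<Prod>i<n. P (xs ! i) (ys ! i)) *
          of_bool (\<not> (D (e xs) ys = u xs \<and> u xs \<in> words E n \<and> (\<forall>i<n. xs ! i \<in> u xs ! i))))
       \<le> 2 * \<tau> + 2 * (K / real n) / \<tau> + exp (- (real L * real J / (4 * 2 powr (real n * (D1 + \<delta>)))))"
proof -
  define dev where "dev n g e ws xs ys \<longleftrightarrow> \<bar>(\<Sum>i<n. g (ws ! i) (xs ! i) (ys ! i)) - real n * e\<bar> \<ge> real n * \<delta>"
    for n :: nat and g :: "nat set \<Rightarrow> nat \<Rightarrow> nat \<Rightarrow> real" and e :: real and ws xs ys
  define g1 g2 where "g1 w x y = log 2 (Q w x / pw w)" and "g2 w x y = log 2 (V w y / pw w)"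
    for w and x y :: nat
  let ?M = "\<lambda>n ws xs ys. \<Prod>i<n. \<mu> (ws ! i) (xs ! i) (ys ! i)"
  obtain K1 where K1: "\<And>n. n > 0 \<Longrightarrow> (\<Sum>ws\<in>words E n. \<Sum>xs\<in>words {..<nx} n. \<Sum>ys\<in>words {..<ny} n.
      ?M n ws xs ys * of_bool (dev n g1 D1 ws xs ys)) \<le> K1 / real n"
    using weak_law_triples[OF d, of g1] unfolding dev_def g1_def D1_def by blast
  obtain K2 where K2: "\<And>n. n > 0 \<Longrightarrow> (\<Sum>ws\<in>words E n. \<Sum>xs\<in>words {..<nx} n. \<Sum>ys\<in>words {..<ny} n.
      ?M n ws xs ys * of_bool (dev n g2 D2 ws xs ys)) \<le> K2 / real n"
    using weak_law_triples[OF d, of g2] unfolding dev_def g2_def D2_def by blast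
  show thesis
  proof (rule that[of "K1 + K2"])
    fix n :: nat and \<tau> :: real and J L :: nat
    assume n: "n > 0" and \<tau>: "0 < \<tau>" "\<tau> < 1/2" and J: "J \<ge> 1" and L: "L \<ge> 1"
      and Jb: "real (J - 1) * 2 powr (- (real n * (D2 - \<delta>))) \<le> \<tau> / 2"
    define \<alpha> \<beta> where "\<alpha> = 2 powr (real n * (D1 + \<delta>))" and "\<beta> = 2 powr (- (real n * (D2 - \<delta>)))"
    define q where "q ws xs = (\<Prod>i<n. Q (ws ! i) (xs ! i))" for ws and xs :: "nat list"
    define r where "r ws = (\<Prod>i<n. pw (ws ! i))" for ws
    define p where "p xs ys = (\<Prod>i<n. P (xs ! i) (ys ! i))" for xs ys
    define v where "v ws ys = (\<Prod>i<n. V (ws ! i) (ys ! i))" for ws and ys :: "nat list"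
    let ?X = "words {..<nx} n" and ?Y = "words {..<ny} n" and ?W = "words E n"
    have nthX: "xs ! i < nx" if "xs \<in> ?X" "i < n" for xs i using words_nth[OF that] by simp
    have nthY: "ys ! i < ny" if "ys \<in> ?Y" "i < n" for ys i using words_nth[OF that] by simp
    have pq: "p xs ys * q ws xs = ?M n ws xs ys" for ws xs ys
      by (simp add: p_def q_def \<mu>_def prod.distrib)
    have q0: "q ws xs \<ge> 0" if "ws \<in> ?W" "xs \<in> ?X" for ws xs
      unfolding q_def using that by (intro prod_nonneg) (auto intro: Q_nonneg words_nth nthX)
    have p0: "p xs ys \<ge> 0" if "xs \<in> ?X" "ys \<in> ?Y" for xs ys
      unfolding p_def using that by (intro prod_nonneg) (auto intro: P_nonneg nthX nthY)
    have r0: "r ws \<ge> 0" if "ws \<in> ?W" for ws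
      unfolding r_def using that by (intro prod_nonneg) (auto intro: pw_nonneg words_nth)
    have v0: "v ws ys \<ge> 0" if "ws \<in> ?W" "ys \<in> ?Y" for ws ys
      unfolding v_def using that by (intro prod_nonneg) (auto intro: V_nonneg words_nth nthY)
    have p1: "(\<Sum>xs\<in>?X. \<Sum>ys\<in>?Y. p xs ys) = 1"
    proof -
      have "(\<Sum>xs\<in>?X. \<Sum>ys\<in>?Y. p xs ys) = (\<Sum>xs\<in>?X. \<Prod>i<n. \<Sum>y<ny. P (xs ! i) y)"
        unfolding p_def
        by (intro sum.cong refl) (rule sum_prod_words[where g = "\<lambda>i. P (xs ! i)" for xs])
      also have "\<dots> = (\<Prod>i<n. \<Sum>x<nx. \<Sum>y<ny. P x y)"
        by (rule sum_prod_words[where g = "\<lambda>_ x. \<Sum>y<ny. P x y"])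
      finally show ?thesis using P_sum by simp
    qed
    have q1: "(\<Sum>ws\<in>?W. q ws xs) = 1" if "xs \<in> ?X" for xs
      unfolding q_def using sum_prod_words[where g = "\<lambda>i w. Q w (xs ! i)" and S = E and n = n] Q_sum nthX[OF that]
      by simp
    have r1: "(\<Sum>ws\<in>?W. r ws) = 1"
      unfolding r_def using sum_prod_words[where g = "\<lambda>_. pw" and S = E and n = n] pw_sum by simp
    have v1: "(\<Sum>ws\<in>?W. v ws ys) \<le> 1" if "ys \<in> ?Y" for ys
    proof -
      have "(\<Sum>ws\<in>?W. v ws ys) = (\<Prod>i<n. \<Sum>w\<in>E. V w (ys ! i))"
        unfolding v_def by (rule sum_prod_words[where g = "\<lambda>i w. V w (ys ! i)"])
      also have "\<dots> \<le> 1"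
        using V_sum nthY[OF that] V_nonneg by (intro prod_le_1) (auto intro!: sum_nonneg)
      finally show ?thesis .
    qed
    have atyp: "?M n ws xs ys * of_bool (\<not> (q ws xs \<le> \<alpha> * r ws \<and> r ws \<le> \<beta> * v ws ys))
       \<le> ?M n ws xs ys * of_bool (dev n g1 D1 ws xs ys) + ?M n ws xs ys * of_bool (dev n g2 D2 ws xs ys)"
      if a: "ws \<in> ?W" "xs \<in> ?X" "ys \<in> ?Y" for ws xs ys
    proof -
      have m: "\<mu> (ws ! i) (xs ! i) (ys ! i) \<ge> 0" if "i < n" for i
        using a that by (intro \<mu>_nonneg) (auto intro: words_nth nthX nthY)
      have M0: "?M n ws xs ys \<ge> 0" using m by (intro prod_nonneg) auto
      show ?thesis
      proof (cases "?M n ws xs ys = 0")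
        case False
        then have "\<mu> (ws ! i) (xs ! i) (ys ! i) > 0" if "i < n" for i
          using m[OF that] that by (simp add: less_le)
        then have pos: "Q (ws ! i) (xs ! i) > 0 \<and> pw (ws ! i) > 0 \<and> V (ws ! i) (ys ! i) > 0" if "i < n" for i
          using that a \<mu>_posD[OF _ _ _ \<open>\<And>i. i < n \<Longrightarrow> \<mu> (ws ! i) (xs ! i) (ys ! i) > 0\<close>[OF that]]
          by (auto intro: words_nth nthX nthY)
        have rpos: "r ws > 0" unfolding r_def using pos by (intro prod_pos) auto
        have "q ws xs / r ws = (\<Prod>i<n. Q (ws ! i) (xs ! i) / pw (ws ! i))"
          by (simp add: q_def r_def prod_dividef)
        also have "\<dots> = 2 powr (\<Sum>i<n. g1 (ws ! i) (xs ! i) (ys ! i))"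
          unfolding g1_def using pos by (intro prod_eq_powr_sum_log) auto
        finally have qr: "q ws xs / r ws = 2 powr (\<Sum>i<n. g1 (ws ! i) (xs ! i) (ys ! i))" .
        have "v ws ys / r ws = (\<Prod>i<n. V (ws ! i) (ys ! i) / pw (ws ! i))"
          by (simp add: v_def r_def prod_dividef)
        also have "\<dots> = 2 powr (\<Sum>i<n. g2 (ws ! i) (xs ! i) (ys ! i))"
          unfolding g2_def using pos by (intro prod_eq_powr_sum_log) auto
        finally have vr: "v ws ys / r ws = 2 powr (\<Sum>i<n. g2 (ws ! i) (xs ! i) (ys ! i))" .
        have "dev n g1 D1 ws xs ys" if "\<not> q ws xs \<le> \<alpha> * r ws"
        proof -
          have "\<alpha> < q ws xs / r ws" using that rpos by (simp add: pos_less_divide_eq)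
          then have "real n * (D1 + \<delta>) < (\<Sum>i<n. g1 (ws ! i) (xs ! i) (ys ! i))"
            unfolding qr \<alpha>_def by simp
          then show ?thesis unfolding dev_def by (simp add: algebra_simps)
        qed
        moreover have "dev n g2 D2 ws xs ys" if "\<not> r ws \<le> \<beta> * v ws ys"
        proof -
          have "2 powr (- (real n * (D2 - \<delta>))) * (v ws ys / r ws) < 1"
            using that rpos by (simp add: \<beta>_def pos_divide_less_eq)
          then have "2 powr (- (real n * (D2 - \<delta>)) + (\<Sum>i<n. g2 (ws ! i) (xs ! i) (ys ! i))) < 2 powr 0"
            unfolding vr powr_add by simp
          then have "(\<Sum>i<n. g2 (ws ! i) (xs ! i) (ys ! i)) < real n * (D2 - \<delta>)"
            by (subst (asm) powr_less_cancel_iff) auto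
          then show ?thesis unfolding dev_def by (simp add: algebra_simps)
        qed
        ultimately show ?thesis using M0 by auto
      next
        case True
        show ?thesis unfolding True by simp
      qed
    qed
    have \<eta>: "(\<Sum>xs\<in>?X. \<Sum>ws\<in>?W. \<Sum>ys\<in>?Y. p xs ys * q ws xs *
        of_bool (\<not> (q ws xs \<le> \<alpha> * r ws \<and> r ws \<le> \<beta> * v ws ys))) \<le> (K1 + K2) / real n"
    proof -
      have "(\<Sum>xs\<in>?X. \<Sum>ws\<in>?W. \<Sum>ys\<in>?Y. p xs ys * q ws xs *
        of_bool (\<not> (q ws xs \<le> \<alpha> * r ws \<and> r ws \<le> \<beta> * v ws ys)))
        \<le> (\<Sum>xs\<in>?X. \<Sum>ws\<in>?W. \<Sum>ys\<in>?Y. ?M n ws xs ys * of_bool (dev n g1 D1 ws xs ys) + ?M n ws xs ys * of_bool (dev n g2 D2 ws xs ys))"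
        unfolding pq by (intro sum_mono atyp)
      also have "\<dots> = (\<Sum>ws\<in>?W. \<Sum>xs\<in>?X. \<Sum>ys\<in>?Y. ?M n ws xs ys * of_bool (dev n g1 D1 ws xs ys))
        + (\<Sum>ws\<in>?W. \<Sum>xs\<in>?X. \<Sum>ys\<in>?Y. ?M n ws xs ys * of_bool (dev n g2 D2 ws xs ys))"
        by (subst sum.swap) (simp add: sum.distrib)
      also have "\<dots> \<le> (K1 + K2) / real n" using K1[OF n] K2[OF n] by (simp add: add_divide_distrib)
      finally show ?thesis .
    qed
    \<comment> \<open>Change of measure: on accepted words \<open>r\<close> is at most
      \<open>\<beta> * v\<close>, and \<open>v\<close> has mass at most 1. So an independent
      codeword is rarely accepted.\<close>
    have \<beta>: "(\<Sum>ws\<in>?W. r ws * of_bool (r ws \<le> \<beta> * v ws ys)) \<le> \<beta>" if "ys \<in> ?Y" for ys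
    proof -
      have b: "\<beta> > 0" by (simp add: \<beta>_def)
      have "(\<Sum>ws\<in>?W. r ws * of_bool (r ws \<le> \<beta> * v ws ys)) \<le> (\<Sum>ws\<in>?W. \<beta> * v ws ys)"
        using v0 that b by (intro sum_mono) auto
      also have "\<dots> \<le> \<beta>" using v1[OF that] b by (simp add: mult_left_le flip: sum_distrib_left)
      finally show ?thesis .
    qed
    have "\<exists>(e :: nat list \<Rightarrow> nat) u D. (\<forall>x. e x < L) \<and>
      (\<Sum>x\<in>?X. \<Sum>y\<in>?Y. p x y * of_bool (\<not> (D (e x) y = u x \<and> u x \<in> ?W \<and> q (u x) x > 0)))
        \<le> 2 * \<tau> + 2 * ((K1 + K2) / real n) / \<tau> + exp (- (real L * real J / (4 * \<alpha>)))"
      by (rule one_shot_code[where A = "\<lambda>xs ws. q ws xs \<le> \<alpha> * r ws" and B = "\<lambda>ws ys. r ws \<le> \<beta> * v ws ys"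
            and r = r and \<beta> = \<beta>])
        (use finE p0 p1 q0 q1 r0 r1 \<beta> \<eta> \<tau> J L Jb in \<open>simp_all add: \<alpha>_def \<beta>_def [symmetric]\<close>)
    then obtain e :: "nat list \<Rightarrow> nat" and u D where e: "\<forall>x. e x < L"
      and er: "(\<Sum>x\<in>?X. \<Sum>y\<in>?Y. p x y * of_bool (\<not> (D (e x) y = u x \<and> u x \<in> ?W \<and> q (u x) x > 0)))
        \<le> 2 * \<tau> + 2 * ((K1 + K2) / real n) / \<tau> + exp (- (real L * real J / (4 * \<alpha>)))" by blast
    \<comment> \<open>A positive product has no zero factor, and the channel gives no mass to
      hyperedges that miss the letter.\<close>
    have mem: "\<forall>i<n. xs ! i \<in> u xs ! i" if "xs \<in> ?X" "u xs \<in> ?W" "q (u xs) xs > 0" for xs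
    proof (intro allI impI)
      fix i assume i: "i < n"
      have "Q (u xs ! i) (xs ! i) \<noteq> 0" 
        using that(3) i unfolding q_def by (metis finite_lessThan lessThan_iff less_irrefl prod_zero_iff)
      then show "xs ! i \<in> u xs ! i"
        using Q_pos_mem[of "u xs ! i" "xs ! i"] Q_nonneg[of "u xs ! i" "xs ! i"] words_nth[OF that(2) i] nthX[OF that(1) i]
        by force
    qed
    have "(\<Sum>xs\<in>?X. \<Sum>ys\<in>?Y. p xs ys * of_bool (\<not> (D (e xs) ys = u xs \<and> u xs \<in> ?W \<and> (\<forall>i<n. xs ! i \<in> u xs ! i))))
       \<le> (\<Sum>x\<in>?X. \<Sum>y\<in>?Y. p x y * of_bool (\<not> (D (e x) y = u x \<and> u x \<in> ?W \<and> q (u x) x > 0)))"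
      using mem p0 by (intro sum_mono mult_left_mono) auto
    also note er
    finally show "\<exists>(e :: nat list \<Rightarrow> nat) u D. (\<forall>xs. e xs < L) \<and>
       (\<Sum>xs\<in>?X. \<Sum>ys\<in>?Y. (\<Prod>i<n. P (xs ! i) (ys ! i)) *
          of_bool (\<not> (D (e xs) ys = u xs \<and> u xs \<in> ?W \<and> (\<forall>i<n. xs ! i \<in> u xs ! i))))
       \<le> 2 * \<tau> + 2 * ((K1 + K2) / real n) / \<tau> + exp (- (real L * real J / (4 * 2 powr (real n * (D1 + \<delta>)))))"
      unfolding \<alpha>_def p_def using e by blast
  qed
qed

end

section \<open>Sending the joint counts along with the hyperedges\<close>

lemma prod_dist_eq: "xs \<in> words S n \<Longrightarrow> prod_dist P xs ys = (\<Prod>i<n. P (xs ! i) (ys ! i))"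
  by (simp add: prod_dist_def words_length)

lemma prod_dist_nonneg:
  assumes "is_joint_dist nx ny P" "xs \<in> words {..<nx} n" "ys \<in> words {..<ny} n"
  shows "prod_dist P xs ys \<ge> 0"
  unfolding prod_dist_eq[OF assms(2)] using assms words_nth[OF assms(2)] words_nth[OF assms(3)]
  by (intro prod_nonneg) (auto simp: is_joint_dist_def)

lemma err_prob_nonneg:
  assumes "is_joint_dist nx ny P"
  shows "err_prob nx ny P n g enc dec \<ge> 0"
  unfolding err_prob_def seqs_eq_words using prod_dist_nonneg[OF assms] by (intro sum_nonneg) auto

lemma support_if_prod_dist_nonzero:
  assumes "is_joint_dist nx ny P" "xs \<in> words {..<nx} n" "ys \<in> words {..<ny} n"
    "prod_dist P xs ys \<noteq> 0" "i < n"
  shows "(xs ! i, ys ! i) \<in> support nx ny P"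
proof -
  have "P (xs ! i) (ys ! i) \<noteq> 0" using assms(4,5) unfolding prod_dist_eq[OF assms(2)] by auto
  then show ?thesis
    using assms(1) words_nth[OF assms(2,5)] words_nth[OF assms(3,5)]
    by (auto simp: support_def is_joint_dist_def less_le)
qed

text \<open>The message adds to the row index the number of positions of each pair (w, x); each
  count lies between 0 and \<open>n\<close>. The decoder does not recover \<open>xs\<close>: by
  \<open>type_fun_determined\<close>, any word with these counts that is possible with the
  hyperedges and \<open>ys\<close> has the right type.\<close>

lemma type_code:
  assumes joint: "is_joint_dist nx ny P" and finE: "finite E"
    and E: "\<And>w. w \<in> E \<Longrightarrow> solvable (support nx ny P) f w {0..<ny} \<and> w \<subseteq> {0..<nx}"
    and e: "\<And>xs. e xs < (L :: nat)"
  shows "\<exists>enc dec. (\<forall>xs\<in>seqs nx n. enc xs < L * (n + 1) ^ (card E * nx)) \<and>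
    err_prob nx ny P n (type_fun f) enc dec \<le>
      (\<Sum>xs\<in>words {..<nx} n. \<Sum>ys\<in>words {..<ny} n. (\<Prod>i<n. P (xs ! i) (ys ! i)) *
          of_bool (\<not> (D (e xs) ys = u xs \<and> u xs \<in> words E n \<and> (\<forall>i<n. xs ! i \<in> u xs ! i))))"
proof -
  \<comment> \<open>Restriction places the counts in a \<open>PiE\<close> set, whose cardinality is
    known.\<close>
  define cnt where "cnt ws xs = restrict (\<lambda>(w, x). card {i. i < n \<and> ws ! i = w \<and> xs ! i = x}) (E \<times> {..<nx})"
    for ws :: "nat set list" and xs :: "nat list"
  define MM where "MM = {..<L} \<times> PiE (E \<times> {..<nx}) (\<lambda>_. {..n})"
  have finM: "finite MM" unfolding MM_def using finE by (intro finite_cartesian_product finite_PiE) auto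
  have cardM: "card MM = L * (n + 1) ^ (card E * nx)"
    unfolding MM_def using finE by (simp add: card_cartesian_product card_PiE)
  obtain h where h: "bij_betw h MM {0..<card MM}" using ex_bij_betw_finite_nat[OF finM] by blast
  have card_le: "card {i. i < n \<and> R i} \<le> n" for R
    using card_mono[of "{..<n}" "{i. i < n \<and> R i}"] by auto
  have inM: "(e xs, cnt (u xs) xs) \<in> MM" for xs
    unfolding MM_def cnt_def using e card_le by auto
  define enc where "enc xs = h (e xs, cnt (u xs) xs)" for xs
  define cand where "cand ws c ys xs \<longleftrightarrow> length xs = n \<and> (\<forall>i<n. xs ! i \<in> ws ! i \<and> (xs ! i, ys ! i) \<in> support nx ny P)
     \<and> cnt ws xs = c" for ws c and ys xs :: "nat list"
  define dec where "dec k ys = type_fun f (SOME xs. cand (D (fst (inv_into MM h k)) ys) (snd (inv_into MM h k)) ys xs) ys"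
    for k ys
  have inv: "inv_into MM h (enc xs) = (e xs, cnt (u xs) xs)" for xs
    unfolding enc_def using h inM by (intro inv_into_f_f) (auto simp: bij_betw_def)
  have ok: "dec (enc xs) ys = type_fun f xs ys"
    if xs: "xs \<in> words {..<nx} n" and ys: "ys \<in> words {..<ny} n" and nz: "prod_dist P xs ys \<noteq> 0"
      and D: "D (e xs) ys = u xs" and ws: "u xs \<in> words E n" and mem: "\<forall>i<n. xs ! i \<in> u xs ! i" for xs ys
  proof -
    define c where "c = cnt (u xs) xs"
    define xs' where "xs' = (SOME xs'. cand (u xs) c ys xs')"
    have cxs: "cand (u xs) c ys xs"
      unfolding cand_def c_def using words_length[OF xs] mem support_if_prod_dist_nonzero[OF joint xs ys nz] by simp
    then have c': "cand (u xs) c ys xs'" unfolding xs'_def by (rule someI)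
    have cnts: "card {i. i < n \<and> u xs ! i = w \<and> xs ! i = x} = card {i. i < n \<and> u xs ! i = w \<and> xs' ! i = x}"
      if "w \<in> E" "x < nx" for w x
    proof -
      have "cnt (u xs) xs (w, x) = cnt (u xs) xs' (w, x)" using cxs c' by (simp add: cand_def)
      then show ?thesis using that by (simp add: cnt_def)
    qed
    have "type_fun f xs ys = type_fun f xs' ys"
      by (rule type_fun_determined[OF finE ws _ _ ys E _ _ cnts]) (use cxs c' in \<open>auto simp: cand_def\<close>)
    then show ?thesis unfolding dec_def inv by (simp add: D xs'_def c_def)
  qed
  have "err_prob nx ny P n (type_fun f) enc dec \<le>
      (\<Sum>xs\<in>words {..<nx} n. \<Sum>ys\<in>words {..<ny} n. (\<Prod>i<n. P (xs ! i) (ys ! i)) *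
          of_bool (\<not> (D (e xs) ys = u xs \<and> u xs \<in> words E n \<and> (\<forall>i<n. xs ! i \<in> u xs ! i))))"
    unfolding err_prob_def seqs_eq_words
  proof (intro sum_mono)
    fix xs ys assume xs: "xs \<in> words {..<nx} n" and ys: "ys \<in> words {..<ny} n"
    note p0 = prod_dist_nonneg[OF joint xs ys]
    show "(if dec (enc xs) ys \<noteq> type_fun f xs ys then prod_dist P xs ys else 0)
      \<le> (\<Prod>i<n. P (xs ! i) (ys ! i)) *
        of_bool (\<not> (D (e xs) ys = u xs \<and> u xs \<in> words E n \<and> (\<forall>i<n. xs ! i \<in> u xs ! i)))"
      unfolding prod_dist_eq[OF xs, symmetric] using p0 ok[OF xs ys]
      by (cases "prod_dist P xs ys = 0") auto
  qed
  moreover have "\<forall>xs\<in>seqs nx n. enc xs < L * (n + 1) ^ (card E * nx)"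
    using h inM unfolding enc_def bij_betw_def cardM by fastforce
  ultimately show ?thesis by blast
qed

lemma (in source_channel) achievable_cond_mi:
  assumes E: "\<And>w. w \<in> E \<Longrightarrow> solvable (support nx ny P) f w {0..<ny} \<and> w \<subseteq> {0..<nx}"
    and "\<delta> > 0"
  shows "achievable nx ny P (\<lambda>n. type_fun f) (cond_mi nx ny P E Q + \<delta>)"
proof -
  define d where "d = \<delta> / 5"
  have d: "d > 0" using assms by (simp add: d_def)
  define H where "H = cond_mi nx ny P E Q"
  have H: "H = D1 - D2" "H \<ge> 0" using cond_mi_eq_diff cond_mi_nonneg by (auto simp: H_def)
  obtain K where K: "\<And>n \<tau> J L. n > 0 \<Longrightarrow> 0 < \<tau> \<Longrightarrow> \<tau> < 1/2 \<Longrightarrow> J \<ge> 1 \<Longrightarrow> L \<ge> 1 \<Longrightarrow>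
      real (J - 1) * 2 powr (- (real n * (D2 - d))) \<le> \<tau> / 2 \<Longrightarrow>
      \<exists>(e :: nat list \<Rightarrow> nat) u D. (\<forall>xs. e xs < L) \<and>
       (\<Sum>xs\<in>words {..<nx} n. \<Sum>ys\<in>words {..<ny} n. (\<Prod>i<n. P (xs ! i) (ys ! i)) *
          of_bool (\<not> (D (e xs) ys = u xs \<and> u xs \<in> words E n \<and> (\<forall>i<n. xs ! i \<in> u xs ! i))))
       \<le> 2 * \<tau> + 2 * (K / real n) / \<tau> + exp (- (real L * real J / (4 * 2 powr (real n * (D1 + d)))))"
    using block_code[OF d] by blast
  \<comment> \<open>Both \<open>\<tau>\<close> and \<open>K / (n * \<tau>)\<close> must
    vanish.\<close>
  define \<tau> where "\<tau> n = 1 / sqrt (real n)" for n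
  \<comment> \<open>Since \<open>D1 = H + D2\<close>, the product \<open>L * J\<close> is about
    \<open>2 powr (n * (D1 + 2 * d))\<close> and beats the covering threshold by
    \<open>2 powr (n * d)\<close>, while \<open>J\<close> stays below the packing threshold
    \<open>2 powr (n * (D2 - d))\<close> by the same factor. \<open>L\<close> spends
    \<open>4 * d\<close>; the fifth part of \<open>\<delta>\<close> pays for rounding and for the
    polynomial factor.\<close>
  define J where "J n = nat \<lceil>2 powr (real n * (D2 - 2 * d))\<rceil>" for n
  define L where "L n = nat \<lceil>2 powr (real n * (H + 4 * d))\<rceil>" for n
  define c where "c = card E * nx"
  define M where "M n = L n * (n + 1) ^ c" for n
  define bnd where "bnd n = 2 * \<tau> n + 2 * (K / real n) / \<tau> n + exp (- (2 powr (real n * d) / 4))" for n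
  define good where "good n \<longleftrightarrow> n > 0 \<and> \<tau> n < 1/2 \<and> 2 powr (- (real n * d)) \<le> \<tau> n / 2" for n
  \<comment> \<open>The upper bound concerns \<open>J n - 1\<close>, because rounding up gives
    \<open>J n = 1\<close> even when the exponent is negative.\<close>
  have J: "J n \<ge> 1" "2 powr (real n * (D2 - 2 * d)) \<le> real (J n)" "real (J n - 1) \<le> 2 powr (real n * (D2 - 2 * d))" for n
  proof -
    have pos: "0 < 2 powr (real n * (D2 - 2 * d))" by simp
    then have c1: "1 \<le> \<lceil>2 powr (real n * (D2 - 2 * d))\<rceil>" by linarith
    then show 1: "J n \<ge> 1" unfolding J_def by linarith
    show "2 powr (real n * (D2 - 2 * d)) \<le> real (J n)" unfolding J_def by linarith
    show "real (J n - 1) \<le> 2 powr (real n * (D2 - 2 * d))"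
      using 1 c1 unfolding J_def by (simp add: of_nat_diff)
  qed
  have L: "L n \<ge> 1" "2 powr (real n * (H + 4 * d)) \<le> real (L n)" "real (L n) \<le> 2 * 2 powr (real n * (H + 4 * d))" for n
  proof -
    have "real n * (H + 4 * d) \<ge> 0" using H d by simp
    then have ge: "1 \<le> 2 powr (real n * (H + 4 * d))" by (simp add: ge_one_powr_ge_zero)
    then have c1: "1 \<le> \<lceil>2 powr (real n * (H + 4 * d))\<rceil>" by linarith
    then show "L n \<ge> 1" unfolding L_def by linarith
    show "2 powr (real n * (H + 4 * d)) \<le> real (L n)" unfolding L_def by linarith
    show "real (L n) \<le> 2 * 2 powr (real n * (H + 4 * d))"
      using ge c1 unfolding L_def by simp linarith
  qed
  have code: "\<exists>enc dec. (\<forall>xs\<in>seqs nx n. enc xs < M n) \<and>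
      (good n \<longrightarrow> err_prob nx ny P n (type_fun f) enc dec \<le> bnd n)" for n
  proof (cases "good n")
    case False
    \<comment> \<open>At the finitely many other block lengths a constant code fills the
      gap.\<close>
    have "\<forall>xs\<in>seqs nx n. 0 < M n" using L(1)[of n] by (simp add: M_def)
    then show ?thesis using False by (intro exI[of _ "\<lambda>_. 0"]) auto
  next
    case True
    then have n: "n > 0" and t: "0 < \<tau> n" "\<tau> n < 1/2" and dd: "2 powr (- (real n * d)) \<le> \<tau> n / 2"
      by (auto simp: good_def \<tau>_def)
    have "real (J n - 1) * 2 powr (- (real n * (D2 - d)))
        \<le> 2 powr (real n * (D2 - 2 * d)) * 2 powr (- (real n * (D2 - d)))"
      using J(3) by (intro mult_right_mono) auto
    also have "\<dots> = 2 powr (- (real n * d))" by (simp add: algebra_simps flip: powr_add)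
    finally have Jb: "real (J n - 1) * 2 powr (- (real n * (D2 - d))) \<le> \<tau> n / 2" using dd by simp
    obtain e :: "nat list \<Rightarrow> nat" and u D where e: "\<forall>xs. e xs < L n"
      and er: "(\<Sum>xs\<in>words {..<nx} n. \<Sum>ys\<in>words {..<ny} n. (\<Prod>i<n. P (xs ! i) (ys ! i)) *
          of_bool (\<not> (D (e xs) ys = u xs \<and> u xs \<in> words E n \<and> (\<forall>i<n. xs ! i \<in> u xs ! i))))
       \<le> 2 * \<tau> n + 2 * (K / real n) / \<tau> n + exp (- (real (L n) * real (J n) / (4 * 2 powr (real n * (D1 + d)))))"
      using K[OF n t J(1) L(1) Jb] by blast
    obtain enc dec where ed: "\<forall>xs\<in>seqs nx n. enc xs < L n * (n + 1) ^ (card E * nx)"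
      "err_prob nx ny P n (type_fun f) enc dec \<le>
      (\<Sum>xs\<in>words {..<nx} n. \<Sum>ys\<in>words {..<ny} n. (\<Prod>i<n. P (xs ! i) (ys ! i)) *
          of_bool (\<not> (D (e xs) ys = u xs \<and> u xs \<in> words E n \<and> (\<forall>i<n. xs ! i \<in> u xs ! i))))"
      using type_code[OF joint finE E, of e "L n" n D u] e by blast
    have "2 powr (real n * d) * 2 powr (real n * (D1 + d))
       = 2 powr (real n * (H + 4 * d)) * 2 powr (real n * (D2 - 2 * d))"
      unfolding H(1) by (simp add: algebra_simps flip: powr_add)
    also have "\<dots> \<le> real (L n) * real (J n)" using L(2) J(2) by (intro mult_mono) auto
    finally have "2 powr (real n * d) / 4 \<le> real (L n) * real (J n) / (4 * 2 powr (real n * (D1 + d)))"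
      by (simp add: field_simps)
    then have "exp (- (real (L n) * real (J n) / (4 * 2 powr (real n * (D1 + d))))) \<le> exp (- (2 powr (real n * d) / 4))"
      by simp
    then have "err_prob nx ny P n (type_fun f) enc dec \<le> bnd n" using ed(2) er unfolding bnd_def by linarith
    then show ?thesis using ed(1) unfolding M_def c_def by blast
  qed
  then obtain enc dec where
    enc: "\<And>n. \<forall>xs\<in>seqs nx n. enc n xs < M n" and
    err: "\<And>n. good n \<Longrightarrow> err_prob nx ny P n (type_fun f) (enc n) (dec n) \<le> bnd n"
    by metis
  have good_ev: "eventually good sequentially"
  proof -
    have "eventually (\<lambda>n. \<tau> n < 1/2) sequentially" unfolding \<tau>_def by real_asymp
    moreover have "eventually (\<lambda>n. 2 powr (- (real n * d)) \<le> \<tau> n / 2) sequentially"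
      unfolding \<tau>_def using d by real_asymp
    ultimately show ?thesis unfolding good_def using eventually_gt_at_top[of 0]
      by eventually_elim simp
  qed
  have bnd0: "bnd \<longlonglongrightarrow> 0"
  proof -
    have "(\<lambda>n. 2 * (1 / sqrt (real n))) \<longlonglongrightarrow> 0" by real_asymp
    moreover have "(\<lambda>n. 2 * (K / real n) / (1 / sqrt (real n))) \<longlonglongrightarrow> 0" by real_asymp
    moreover have "(\<lambda>n. exp (- (2 powr (real n * d) / 4))) \<longlonglongrightarrow> 0" using d by real_asymp
    ultimately show ?thesis unfolding bnd_def \<tau>_def
      using tendsto_add[OF tendsto_add] by fastforce
  qed
  have "(\<lambda>n. err_prob nx ny P n (type_fun f) (enc n) (dec n)) \<longlonglongrightarrow> 0"
  proof (rule tendsto_sandwich[OF _ _ tendsto_const bnd0])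
    show "eventually (\<lambda>n. 0 \<le> err_prob nx ny P n (type_fun f) (enc n) (dec n)) sequentially"
      by (intro always_eventually allI err_prob_nonneg[OF joint])
    show "eventually (\<lambda>n. err_prob nx ny P n (type_fun f) (enc n) (dec n) \<le> bnd n) sequentially"
      using good_ev by (rule eventually_mono) (rule err)
  qed
  moreover have "limsup (\<lambda>n. ereal (log 2 (real (M n)) / real n)) \<le> ereal (H + \<delta>)"
  proof (rule Limsup_bounded)
    have "(\<lambda>n. (1 + real c * log 2 (real n + 1)) / real n) \<longlonglongrightarrow> 0" by real_asymp
    then have "eventually (\<lambda>n. (1 + real c * log 2 (real n + 1)) / real n < d) sequentially"
      using d by (rule order_tendstoD)
    then show "eventually (\<lambda>n. ereal (log 2 (real (M n)) / real n) \<le> ereal (H + \<delta>)) sequentially"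
      using eventually_gt_at_top[of 0]
    proof eventually_elim
      case (elim n)
      have "log 2 (real (M n)) = log 2 (real (L n)) + log 2 ((real n + 1) ^ c)"
        unfolding M_def using L(1)[of n] by (simp add: log_mult add.commute)
      also have "\<dots> = log 2 (real (L n)) + real c * log 2 (real n + 1)"
        by (simp add: log_nat_power)
      also have "log 2 (real (L n)) \<le> log 2 (2 * 2 powr (real n * (H + 4 * d)))"
        using L(1,3)[of n] by (subst log_le_cancel_iff) auto
      also have "\<dots> = 1 + real n * (H + 4 * d)" by (simp add: log_mult)
      finally have "log 2 (real (M n)) / real n \<le> (1 + real n * (H + 4 * d) + real c * log 2 (real n + 1)) / real n"
        using elim by (simp add: divide_right_mono)
      also have "\<dots> = H + 4 * d + (1 + real c * log 2 (real n + 1)) / real n"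
        using elim by (simp add: field_simps)
      also have "\<dots> \<le> H + \<delta>" using elim(1) d_def by linarith
      finally show ?case by simp
    qed
  qed
  ultimately show ?thesis unfolding achievable_def H_def using enc by blast
qed

subsection \<open>Converse\<close>

text \<open>A loop meets each of its rows in two possible columns, so the two indicators there
  differ by a difference of potentials. \<open>G\<close> is common to all letters of the set, so the
  cyclic shift of the columns cancels the total.\<close>

lemma solvable_hyperedge_if_potential:
  fixes G :: "nat \<Rightarrow> nat \<Rightarrow> real"
  shows "solvable_hyperedge nx ny S f {x. x < nx \<and> (\<forall>b b'. (x, b) \<in> S \<longrightarrow> (x, b') \<in> S \<longrightarrow>
    (\<forall>v. of_bool (f x b = v) - of_bool (f x b' = v) = G b v - G b' v))}" (is "solvable_hyperedge _ _ _ _ ?A")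
proof -
  have "card {i. i < length as \<and> f (as ! i) (bs ! i) = v}
      = card {i. i < length as \<and> f (as ! i) (bs ! ((i + 1) mod length as)) = v}"
    if loop: "simple_loop S ?A B as bs" for B as bs v
  proof -
    define k where "k = length as"
    have k: "k \<ge> 1" using loop by (simp add: simple_loop_def k_def)
    have "(\<Sum>i<k. of_bool (f (as ! i) (bs ! i) = v) - of_bool (f (as ! i) (bs ! ((i + 1) mod k)) = v))
      = (\<Sum>i<k. G (bs ! i) v - G (bs ! ((i + 1) mod k)) v)"
    proof (rule sum.cong[OF refl])
      fix i assume i: "i \<in> {..<k}"
      have "set as \<subseteq> ?A" using loop unfolding simple_loop_def by (elim conjE)
      then have "as ! i \<in> ?A" by (rule subsetD) (use i in \<open>simp add: k_def\<close>)
      moreover have "(as ! i, bs ! i) \<in> S" "(as ! i, bs ! ((i + 1) mod k)) \<in> S"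
        using conjunct2[OF loop[unfolded simple_loop_def]] i unfolding k_def by blast+
      ultimately show "of_bool (f (as ! i) (bs ! i) = v) - of_bool (f (as ! i) (bs ! ((i + 1) mod k)) = v)
        = G (bs ! i) v - G (bs ! ((i + 1) mod k)) v" by blast
    qed
    also have "\<dots> = 0"
      using sum.reindex_bij_betw[OF bij_betw_cyclic_shift[OF k], of "\<lambda>i. G (bs ! i) v"]
      by (simp add: sum_subtractf)
    finally have "(\<Sum>i<k. of_bool (f (as ! i) (bs ! i) = v) :: real)
       = (\<Sum>i<k. of_bool (f (as ! i) (bs ! ((i + 1) mod k)) = v))"
      by (simp add: sum_subtractf del: sum_of_bool_eq)
    moreover have "(\<Sum>i<k. of_bool (R i) :: real) = real (card {i. i < k \<and> R i})" for R
    proof -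
      have "{..<k} \<inter> {i. R i} = {i. i < k \<and> R i}" by auto
      then show ?thesis by (simp add: sum_of_bool_eq)
    qed
    ultimately show ?thesis by (simp only: k_def of_nat_eq_iff)
  qed
  then show ?thesis unfolding solvable_hyperedge_def solvable_def by auto
qed

lemma finite_max_solvable_hyperedges: "finite (max_solvable_hyperedges nx ny S f)"
  by (rule finite_subset[of _ "Pow {0..<nx}"])
    (auto simp: max_solvable_hyperedges_def solvable_hyperedge_def)

lemma ex_max_solvable_hyperedge_superset:
  assumes "solvable_hyperedge nx ny S f e"
  shows "\<exists>e'\<in>max_solvable_hyperedges nx ny S f. e \<subseteq> e'"
proof -
  let ?F = "{e'. solvable_hyperedge nx ny S f e' \<and> e \<subseteq> e'}"
  have "finite ?F" by (rule finite_subset[of _ "Pow {0..<nx}"]) (auto simp: solvable_hyperedge_def)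
  moreover have "?F \<noteq> {}" using assms by auto
  ultimately obtain m where m: "m \<in> ?F" "\<And>b. b \<in> ?F \<Longrightarrow> m \<subseteq> b \<Longrightarrow> m = b"
    using finite_has_maximal[of ?F] by auto
  then have "m \<in> max_solvable_hyperedges nx ny S f" unfolding max_solvable_hyperedges_def by blast
  then show ?thesis using m by blast
qed

text \<open>With a single letter a simple loop has length 1, and modulo 1 its two columns coincide.
  Hence every letter lies in a maximal hyperedge, so admissible channels exist.\<close>

lemma solvable_hyperedge_singleton: "x < nx \<Longrightarrow> solvable_hyperedge nx ny S f {x}"
proof -
  assume x: "x < nx"
  have "length as = 1" if "simple_loop S {x} B as bs" for B as bs
  proof -
    have "card (set as) \<le> card {x}" using that by (intro card_mono) (auto simp: simple_loop_def)
    then show ?thesis using that by (simp add: simple_loop_def distinct_card)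
  qed
  then show ?thesis using x unfolding solvable_hyperedge_def solvable_def
    by (auto intro!: arg_cong[where f = card])
qed

text \<open>Overwriting the \<open>i\<close>-th letter is a bijection between the two fibres. In the
  converse this is the Markov property: an edge that ignores the \<open>i\<close>-th side letter has
  a law independent of it.\<close>

lemma sum_words_shift_coord:
  fixes G :: "'a list \<Rightarrow> real"
  assumes "i < n" "a \<in> S" "b \<in> S" and G: "\<And>xs c. xs \<in> words S n \<Longrightarrow> G (xs[i := c]) = G xs"
    and fin: "finite S"
  shows "(\<Sum>xs\<in>words S n. G xs * of_bool (xs ! i = a)) = (\<Sum>xs\<in>words S n. G xs * of_bool (xs ! i = b))"
proof -
  have restr: "(\<Sum>xs\<in>words S n. G xs * of_bool (xs ! i = c)) = (\<Sum>xs\<in>{xs\<in>words S n. xs ! i = c}. G xs)" for c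
    using fin by (simp add: sum.inter_filter [symmetric] of_bool_def if_distrib cong: if_cong)
  show ?thesis unfolding restr
    by (rule sum.reindex_bij_witness[where i = "\<lambda>xs. xs[i := a]" and j = "\<lambda>xs. xs[i := b]"])
      (use assms in \<open>auto simp: words_update words_length\<close>)
qed

text \<open>Overwriting forgets only the old letter, so at most \<open>card S\<close> words share an
  image.\<close>

lemma sum_words_update_le:
  fixes H :: "'a list \<Rightarrow> real"
  assumes "finite S" "i < n" "b \<in> S" and H: "\<And>xs. xs \<in> words S n \<Longrightarrow> H xs \<ge> 0"
  shows "(\<Sum>xs\<in>words S n. H (xs[i := b])) \<le> real (card S) * (\<Sum>xs\<in>words S n. H xs)"
proof -
  let ?h = "\<lambda>xs. (xs ! i, xs[i := b])"
  have inj: "inj_on ?h (words S n)"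
    by (rule inj_onI) (metis Pair_inject list_update_id list_update_overwrite)
  have "(\<Sum>xs\<in>words S n. H (xs[i := b])) = (\<Sum>z\<in>?h ` words S n. H (snd z))"
    by (simp add: sum.reindex[OF inj])
  also have "\<dots> \<le> (\<Sum>z\<in>S \<times> words S n. H (snd z))"
    using assms by (intro sum_mono2) (auto intro: words_nth words_update)
  also have "\<dots> = real (card S) * (\<Sum>xs\<in>words S n. H xs)"
    unfolding sum.cartesian_product' by simp
  finally show ?thesis .
qed

lemma prod_split_coord:
  fixes g :: "nat \<Rightarrow> real"
  assumes "i < n"
  shows "(\<Prod>j<n. g j) = g i * (\<Prod>j\<in>{..<n} - {i}. g j)"
  using assms by (intro prod.remove) auto

text \<open>The sum of the mutual informations is the expectation of the logarithm of a product of density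
  ratios. Weighted with the source law, this product is, for a fixed message, a product of
  conditional laws of the source letters given the side information and the edges, so its total
  mass is at most the number of messages.\<close>

lemma single_letterization:
  fixes P :: "nat \<Rightarrow> nat \<Rightarrow> real" and edge :: "nat \<Rightarrow> nat \<Rightarrow> nat list \<Rightarrow> nat set"
  assumes joint: "is_joint_dist nx ny P" and ny: "ny > 0" and finE: "finite E"
    and edge: "\<And>i m ys. edge i m ys \<in> E" and upd: "\<And>i m ys b. edge i m (ys[i := b]) = edge i m ys"
    and enc: "\<And>xs. xs \<in> words {..<nx} n \<Longrightarrow> enc xs < M"
  obtains Q where
    "\<And>i w x. w \<in> E \<Longrightarrow> x < nx \<Longrightarrow> Q i w x \<ge> 0"
    "\<And>i w x y. i < n \<Longrightarrow> x < nx \<Longrightarrow> y < ny \<Longrightarrow> P x y * Q i w x =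
       (\<Sum>xs\<in>words {..<nx} n. \<Sum>ys\<in>words {..<ny} n. (\<Prod>j<n. P (xs ! j) (ys ! j)) *
          of_bool (xs ! i = x \<and> ys ! i = y \<and> edge i (enc xs) ys = w))"
    "(\<Sum>i<n. cond_mi nx ny P E (Q i)) \<le> log 2 (real M)"
proof -
  let ?X = "words {..<nx} n" and ?Y = "words {..<ny} n"
  have P0: "P x y \<ge> 0" if "x < nx" "y < ny" for x y using joint that by (auto simp: is_joint_dist_def)
  have nthX: "xs ! i < nx" if "xs \<in> ?X" "i < n" for xs i using words_nth[OF that] by simp
  have nthY: "ys ! i < ny" if "ys \<in> ?Y" "i < n" for ys i using words_nth[OF that] by simp
  define p where "p xs ys = (\<Prod>j<n. P (xs ! j) (ys ! j))" for xs ys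
  define pr where "pr i xs ys = (\<Prod>j\<in>{..<n} - {i}. P (xs ! j) (ys ! j))" for i xs ys
  have p_split: "p xs ys = P (xs ! i) (ys ! i) * pr i xs ys" if "i < n" for i xs ys
    unfolding p_def pr_def using that by (rule prod_split_coord)
  have p0: "p xs ys \<ge> 0" if "xs \<in> ?X" "ys \<in> ?Y" for xs ys
    unfolding p_def using that by (intro prod_nonneg) (auto intro: P0 nthX nthY)
  have pr0: "pr i xs ys \<ge> 0" if "xs \<in> ?X" "ys \<in> ?Y" for i xs ys
    unfolding pr_def using that by (intro prod_nonneg) (auto intro: P0 nthX nthY)
  have p1: "(\<Sum>xs\<in>?X. \<Sum>ys\<in>?Y. p xs ys) = 1"
  proof -
    have "(\<Sum>xs\<in>?X. \<Sum>ys\<in>?Y. p xs ys) = (\<Sum>xs\<in>?X. \<Prod>i<n. \<Sum>y<ny. P (xs ! i) y)"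
      unfolding p_def
      by (intro sum.cong refl) (rule sum_prod_words[where g = "\<lambda>i. P (xs ! i)" for xs])
    also have "\<dots> = (\<Prod>i<n. \<Sum>x<nx. \<Sum>y<ny. P x y)"
      by (rule sum_prod_words[where g = "\<lambda>_ x. \<Sum>y<ny. P x y"])
    finally show ?thesis using joint by (simp add: is_joint_dist_def)
  qed
  \<comment> \<open>The conditional law of the edge given the \<open>i\<close>-th source letter.
    Omitting the \<open>i\<close>-th factor of the source law avoids a division by
    \<open>P x y\<close>; the side letter is fixed to the reference letter 0, which exists by
    \<open>ny\<close>, and every other letter gives the same value.\<close>
  define Q where "Q i w x = (\<Sum>xs\<in>?X. \<Sum>ys\<in>?Y. pr i xs ys * of_bool (xs ! i = x \<and> edge i (enc xs) ys = w) * of_bool (ys ! i = 0))"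
    for i w x
  have Q0: "Q i w x \<ge> 0" for i w x unfolding Q_def using pr0 by (intro sum_nonneg) auto
  have PQ: "P x y * Q i w x =
       (\<Sum>xs\<in>?X. \<Sum>ys\<in>?Y. p xs ys * of_bool (xs ! i = x \<and> ys ! i = y \<and> edge i (enc xs) ys = w))"
    if i: "i < n" and xy: "x < nx" "y < ny" for i w x y
  proof -
    have "(\<Sum>xs\<in>?X. \<Sum>ys\<in>?Y. p xs ys * of_bool (xs ! i = x \<and> ys ! i = y \<and> edge i (enc xs) ys = w))
       = (\<Sum>xs\<in>?X. \<Sum>ys\<in>?Y. P x y * (pr i xs ys * of_bool (xs ! i = x \<and> edge i (enc xs) ys = w) * of_bool (ys ! i = y)))"
      by (intro sum.cong refl) (auto simp: p_split[OF i])
    also have "\<dots> = P x y * (\<Sum>xs\<in>?X. \<Sum>ys\<in>?Y. pr i xs ys * of_bool (xs ! i = x \<and> edge i (enc xs) ys = w) * of_bool (ys ! i = y))"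
      by (simp only: sum_distrib_left)
    also have "(\<Sum>xs\<in>?X. \<Sum>ys\<in>?Y. pr i xs ys * of_bool (xs ! i = x \<and> edge i (enc xs) ys = w) * of_bool (ys ! i = y)) = Q i w x"
      unfolding Q_def
      by (intro sum.cong refl sum_words_shift_coord) (use i xy ny in \<open>auto simp: upd pr_def intro!: prod.cong\<close>)
    finally show ?thesis by simp
  qed
  define py where "py y = (\<Sum>x<nx. P x y)" for y
  define pwy where "pwy i w y = (\<Sum>x<nx. P x y * Q i w x)" for i w y
  \<comment> \<open>\<open>c\<close> is the law of the source letter given edge and side letter,
    \<open>r\<close> the ratio inside \<open>cond_mi\<close>. Where all is positive,
    \<open>P * r = py * c\<close>, which turns the source law times all ratios into a product of
    laws.\<close>
  define c where "c i w x y = P x y * Q i w x / pwy i w y" for i w x y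
  define r where "r i w x y = P x y * Q i w x * py y / (pwy i w y * P x y)" for i w x y
  have py0: "py y \<ge> 0" if "y < ny" for y unfolding py_def using that P0 by (intro sum_nonneg) auto
  have pwy0: "pwy i w y \<ge> 0" if "y < ny" for i w y
    unfolding pwy_def using that P0 Q0 by (intro sum_nonneg) auto
  have c0: "c i w x y \<ge> 0" if "x < nx" "y < ny" for i w x y
    unfolding c_def using that P0 Q0 pwy0 by (intro divide_nonneg_nonneg mult_nonneg_nonneg) auto
  have c1: "(\<Sum>x<nx. c i w x y) \<le> 1" for i w y
    unfolding c_def sum_divide_distrib [symmetric] pwy_def by simp

  have cmi: "cond_mi nx ny P E (Q i) = (\<Sum>xs\<in>?X. \<Sum>ys\<in>?Y. p xs ys * log 2 (r i (edge i (enc xs) ys) (xs ! i) (ys ! i)))"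
    if i: "i < n" for i
  proof -
    have "cond_mi nx ny P E (Q i) = (\<Sum>w\<in>E. \<Sum>x<nx. \<Sum>y<ny. P x y * Q i w x * log 2 (r i w x y))"
      unfolding cond_mi_def Let_def
    proof (intro sum.cong refl)
      fix w x y assume "x \<in> {..<nx}" "y \<in> {..<ny}"
      then have "0 \<le> P x y * Q i w x" using P0 Q0 by auto
      then show "(if P x y * Q i w x > 0 then P x y * Q i w x * log 2 (P x y * Q i w x * (\<Sum>x'<nx. P x' y) /
            ((\<Sum>x'<nx. P x' y * Q i w x') * P x y)) else 0) = P x y * Q i w x * log 2 (r i w x y)"
        unfolding r_def py_def pwy_def by (cases "P x y * Q i w x = 0") auto
    qed
    also have "\<dots> = (\<Sum>w\<in>E. \<Sum>x<nx. \<Sum>y<ny. \<Sum>xs\<in>?X. \<Sum>ys\<in>?Y.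
        p xs ys * of_bool (xs ! i = x \<and> ys ! i = y \<and> edge i (enc xs) ys = w) * log 2 (r i w x y))"
      by (intro sum.cong refl) (simp only: PQ[OF i] sum_distrib_right lessThan_iff)
    also have "\<dots> = (\<Sum>(w, x, y)\<in>E \<times> {..<nx} \<times> {..<ny}. \<Sum>(xs, ys)\<in>?X \<times> ?Y.
        p xs ys * of_bool (xs ! i = x \<and> ys ! i = y \<and> edge i (enc xs) ys = w) * log 2 (r i w x y))"
      by (simp only: sum.cartesian_product' prod.case)
    also have "\<dots> = (\<Sum>(xs, ys)\<in>?X \<times> ?Y. \<Sum>(w, x, y)\<in>E \<times> {..<nx} \<times> {..<ny}.
        p xs ys * of_bool (xs ! i = x \<and> ys ! i = y \<and> edge i (enc xs) ys = w) * log 2 (r i w x y))"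
      unfolding case_prod_unfold by (rule sum.swap)
    also have "\<dots> = (\<Sum>(xs, ys)\<in>?X \<times> ?Y. p xs ys * log 2 (r i (edge i (enc xs) ys) (xs ! i) (ys ! i)))"
    proof (intro sum.cong refl, clarify)
      fix xs ys assume xy: "xs \<in> ?X" "ys \<in> ?Y"
      let ?t = "(edge i (enc xs) ys, xs ! i, ys ! i)"
      have "(\<Sum>(w, x, y)\<in>E \<times> {..<nx} \<times> {..<ny}.
          p xs ys * of_bool (xs ! i = x \<and> ys ! i = y \<and> edge i (enc xs) ys = w) * log 2 (r i w x y))
        = (\<Sum>t\<in>E \<times> {..<nx} \<times> {..<ny}. if t = ?t then p xs ys * log 2 (r i (edge i (enc xs) ys) (xs ! i) (ys ! i)) else 0)"
        by (intro sum.cong refl) auto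
      also have "\<dots> = p xs ys * log 2 (r i (edge i (enc xs) ys) (xs ! i) (ys ! i))"
        using xy i finE edge nthX nthY by simp
      finally show "(\<Sum>(w, x, y)\<in>E \<times> {..<nx} \<times> {..<ny}.
          p xs ys * of_bool (xs ! i = x \<and> ys ! i = y \<and> edge i (enc xs) ys = w) * log 2 (r i w x y))
        = p xs ys * log 2 (r i (edge i (enc xs) ys) (xs ! i) (ys ! i))" .
    qed
    finally show ?thesis by (simp add: sum.cartesian_product)
  qed

  have "?X \<noteq> {}" using p1 by auto
  then have M: "M > 0" using enc by force
  define T where "T m xs ys = (\<Prod>i<n. py (ys ! i) * c i (edge i m ys) (xs ! i) (ys ! i))" for m xs ys
  have T0: "T m xs ys \<ge> 0" if "xs \<in> ?X" "ys \<in> ?Y" for m xs ys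
    unfolding T_def using that by (intro prod_nonneg) (auto intro!: mult_nonneg_nonneg py0 c0 nthX nthY)
  \<comment> \<open>For a fixed message the edges depend on \<open>ys\<close> alone, so the sum over
    \<open>xs\<close> factorizes. The true message varies with \<open>xs\<close>;
    \<open>Tenc\<close> pays for this by summing over all \<open>M\<close> messages.\<close>
  have Tsum: "(\<Sum>xs\<in>?X. \<Sum>ys\<in>?Y. T m xs ys) \<le> 1" for m
  proof -
    have "(\<Sum>xs\<in>?X. \<Sum>ys\<in>?Y. T m xs ys) = (\<Sum>ys\<in>?Y. \<Prod>i<n. \<Sum>x<nx. py (ys ! i) * c i (edge i m ys) x (ys ! i))"
      unfolding T_def
      by (subst sum.swap, intro sum.cong refl,
          rule sum_prod_words[where g = "\<lambda>i x. py (ys ! i) * c i (edge i m ys) x (ys ! i)" for ys])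
    also have "\<dots> \<le> (\<Sum>ys\<in>?Y. \<Prod>i<n. py (ys ! i))"
    proof (intro sum_mono prod_mono conjI)
      fix ys i assume a: "ys \<in> ?Y" "i \<in> {..<n}"
      then show "0 \<le> (\<Sum>x<nx. py (ys ! i) * c i (edge i m ys) x (ys ! i))"
        by (intro sum_nonneg mult_nonneg_nonneg) (auto intro: py0 c0 nthY)
      show "(\<Sum>x<nx. py (ys ! i) * c i (edge i m ys) x (ys ! i)) \<le> py (ys ! i)"
        unfolding sum_distrib_left [symmetric] using c1 py0 nthY a by (intro mult_left_le) auto
    qed
    also have "\<dots> = (\<Prod>i<n. \<Sum>y<ny. py y)"
      by (rule sum_prod_words[where g = "\<lambda>_. py"])
    also have "(\<Sum>y<ny. py y) = 1"
      unfolding py_def by (subst sum.swap) (use joint in \<open>simp add: is_joint_dist_def\<close>)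
    finally show ?thesis by simp
  qed
  have Tenc: "(\<Sum>xs\<in>?X. \<Sum>ys\<in>?Y. T (enc xs) xs ys) \<le> real M"
  proof -
    have "(\<Sum>xs\<in>?X. \<Sum>ys\<in>?Y. T (enc xs) xs ys) \<le> (\<Sum>xs\<in>?X. \<Sum>m<M. \<Sum>ys\<in>?Y. T m xs ys)"
    proof (rule sum_mono)
      fix xs assume xs: "xs \<in> ?X"
      show "(\<Sum>ys\<in>?Y. T (enc xs) xs ys) \<le> (\<Sum>m<M. \<Sum>ys\<in>?Y. T m xs ys)"
        using enc[OF xs] T0[OF xs] by (intro member_le_sum[of "enc xs" "{..<M}" "\<lambda>m. \<Sum>ys\<in>?Y. T m xs ys"]) (auto intro!: sum_nonneg)
    qed
    also have "\<dots> = (\<Sum>m<M. \<Sum>xs\<in>?X. \<Sum>ys\<in>?Y. T m xs ys)" by (rule sum.swap)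
    also have "\<dots> \<le> (\<Sum>m<M. 1)" using Tsum by (rule sum_mono)
    finally show ?thesis by simp
  qed
  \<comment> \<open>Jensen's inequality in pointwise form: \<open>ln t \<le> t - 1\<close> with
    \<open>t\<close> the product of the ratios divided by \<open>M\<close>. Summed up, the
    correction is nonpositive by \<open>Tenc\<close>.\<close>
  have pt: "p xs ys * (\<Sum>i<n. log 2 (r i (edge i (enc xs) ys) (xs ! i) (ys ! i)))
     \<le> p xs ys * log 2 (real M) + (T (enc xs) xs ys / real M - p xs ys) / ln 2"
    if xy: "xs \<in> ?X" "ys \<in> ?Y" for xs ys
  proof (cases "p xs ys = 0")
    case True
    then show ?thesis using T0[OF xy, of "enc xs"] M by simp
  next
    case False
    then have pp: "p xs ys > 0" using p0[OF xy] by simp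
    let ?r = "\<lambda>i. r i (edge i (enc xs) ys) (xs ! i) (ys ! i)"
    have pos: "?r i > 0 \<and> P (xs ! i) (ys ! i) * ?r i = py (ys ! i) * c i (edge i (enc xs) ys) (xs ! i) (ys ! i)"
      if i: "i < n" for i
    proof -
      let ?w = "edge i (enc xs) ys" and ?x = "xs ! i" and ?y = "ys ! i"
      note lt = nthX[OF xy(1) i] nthY[OF xy(2) i]
      have Pp: "P ?x ?y > 0" using pp P0[OF lt] by (auto simp: p_split[OF i] zero_less_mult_iff)
      let ?g = "\<lambda>xs' ys'. p xs' ys' * of_bool (xs' ! i = ?x \<and> ys' ! i = ?y \<and> edge i (enc xs') ys' = ?w)"
      have "0 < (\<Sum>ys'\<in>?Y. ?g xs ys')"
        using xy pp p0 by (intro sum_pos2[of _ ys]) auto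
      also have "\<dots> \<le> (\<Sum>xs'\<in>?X. \<Sum>ys'\<in>?Y. ?g xs' ys')"
        by (rule member_le_sum[of xs ?X "\<lambda>xs'. \<Sum>ys'\<in>?Y. ?g xs' ys'"]) (use xy p0 in \<open>auto intro!: sum_nonneg\<close>)
      finally have PQp: "P ?x ?y * Q i ?w ?x > 0" by (simp add: PQ[OF i lt])
      have wyp: "pwy i ?w ?y > 0"
        unfolding pwy_def using PQp lt P0 Q0 by (intro sum_pos2[of _ ?x]) auto
      have pyp: "py ?y > 0"
        unfolding py_def using Pp lt P0 by (intro sum_pos2[of _ ?x]) auto
      have "Q i ?w ?x > 0" using Pp PQp by (simp add: zero_less_mult_iff)
      then show ?thesis using Pp wyp pyp unfolding r_def c_def by simp
    qed
    have "p xs ys * (\<Prod>i<n. ?r i) = (\<Prod>i<n. P (xs ! i) (ys ! i) * ?r i)"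
      by (simp add: p_def prod.distrib)
    also have "\<dots> = T (enc xs) xs ys" unfolding T_def using pos by (intro prod.cong) auto
    finally have pT: "p xs ys * (\<Prod>i<n. ?r i) = T (enc xs) xs ys" .
    have prp: "(\<Prod>i<n. ?r i) > 0" using pos by (intro prod_pos) auto
    have "(\<Sum>i<n. log 2 (?r i)) = log 2 (\<Prod>i<n. ?r i)"
      using pos prod_eq_powr_sum_log[of "{..<n}" ?r] by simp
    also have "\<dots> = log 2 (real M) + ln ((\<Prod>i<n. ?r i) / real M) / ln 2"
    proof -
      have "log 2 z = log 2 (real M) + ln (z / real M) / ln 2" if "z > 0" for z
        using that M by (simp add: log_def ln_div diff_divide_distrib)
      from this[OF prp] show ?thesis .
    qed
    also have "\<dots> \<le> log 2 (real M) + ((\<Prod>i<n. ?r i) / real M - 1) / ln 2"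
      using prp M by (intro add_left_mono divide_right_mono ln_le_minus_one divide_pos_pos) auto
    finally have "p xs ys * (\<Sum>i<n. log 2 (?r i)) \<le> p xs ys * (log 2 (real M) + ((\<Prod>i<n. ?r i) / real M - 1) / ln 2)"
      using pp by (intro mult_left_mono) auto
    also have "\<dots> = p xs ys * log 2 (real M) + (p xs ys * (\<Prod>i<n. ?r i) / real M - p xs ys) / ln 2"
      by (simp add: algebra_simps diff_divide_distrib)
    finally show ?thesis unfolding pT .
  qed
  have "(\<Sum>i<n. cond_mi nx ny P E (Q i))
     = (\<Sum>i<n. \<Sum>xs\<in>?X. \<Sum>ys\<in>?Y. p xs ys * log 2 (r i (edge i (enc xs) ys) (xs ! i) (ys ! i)))"
    using cmi by (intro sum.cong) auto
  also have "\<dots> = (\<Sum>xs\<in>?X. \<Sum>ys\<in>?Y. p xs ys * (\<Sum>i<n. log 2 (r i (edge i (enc xs) ys) (xs ! i) (ys ! i))))"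
    unfolding sum_distrib_left by (subst sum.swap, intro sum.cong refl, rule sum.swap)
  also have "\<dots> \<le> (\<Sum>xs\<in>?X. \<Sum>ys\<in>?Y. p xs ys * log 2 (real M) + (T (enc xs) xs ys / real M - p xs ys) / ln 2)"
    by (intro sum_mono pt)
  also have "\<dots> = log 2 (real M) + ((\<Sum>xs\<in>?X. \<Sum>ys\<in>?Y. T (enc xs) xs ys) / real M - 1) / ln 2"
    by (simp add: sum.distrib sum_subtractf p1 flip: sum_distrib_right sum_divide_distrib)
  also have "\<dots> \<le> log 2 (real M)" using Tenc M by (simp add: divide_nonpos_pos)
  finally have "(\<Sum>i<n. cond_mi nx ny P E (Q i)) \<le> log 2 (real M)" .
  with Q0 PQ show thesis unfolding p_def using that by blast
qed

section \<open>Replacing one letter of the side information\<close>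

lemma ex_min_support_prob:
  obtains c where "c > 0" "\<And>x y. (x, y) \<in> support nx ny P \<Longrightarrow> c \<le> P x y"
proof -
  \<comment> \<open>The element 1 keeps the set nonempty when the support is empty.\<close>
  let ?A = "insert 1 ((\<lambda>(x, y). P x y) ` support nx ny P)"
  have "support nx ny P \<subseteq> {..<nx} \<times> {..<ny}" by (auto simp: support_def)
  then have fin: "finite ?A" using finite_subset by blast
  have "Min ?A > 0" using fin by (subst Min_gr_iff) (auto simp: support_def)
  moreover have "Min ?A \<le> P x y" if "(x, y) \<in> support nx ny P" for x y
    using fin that by (intro Min_le) force+
  ultimately show thesis using that by blast
qed

lemma joint_dist_le_1:
  assumes "is_joint_dist nx ny P" "x < nx" "y < ny"
  shows "P x y \<le> 1"
proof -
  have nn: "\<And>x y. x < nx \<Longrightarrow> y < ny \<Longrightarrow> P x y \<ge> 0" using assms(1) by (auto simp: is_joint_dist_def)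
  have "P x y \<le> (\<Sum>y<ny. P x y)" using nn assms by (intro member_le_sum) auto
  also have "\<dots> \<le> (\<Sum>x<nx. \<Sum>y<ny. P x y)"
    by (rule member_le_sum[of x _ "\<lambda>x. \<Sum>y<ny. P x y"]) (use nn assms in \<open>auto intro!: sum_nonneg\<close>)
  finally show ?thesis using assms(1) by (simp add: is_joint_dist_def)
qed

text \<open>The sum over the other positions is free of \<open>b\<close>: it is the unknown additive
  constant, which cancels when two answers are subtracted.\<close>

lemma type_fun_update:
  assumes "length xs = n" "length ys = n" "i < n"
  shows "real n * type_fun f xs (ys[i := b]) v
    = of_bool (f (xs ! i) b = v) + (\<Sum>j\<in>{..<n} - {i}. of_bool (f (xs ! j) (ys ! j) = v))"
proof -
  have "real n * type_fun f xs (ys[i := b]) v = real (card {j. j < n \<and> map2 f xs (ys[i := b]) ! j = v})"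
    using assms by (simp add: type_fun_def seq_type_def)
  also have "{j. j < n \<and> map2 f xs (ys[i := b]) ! j = v} = {..<n} \<inter> {j. f (xs ! j) (ys[i := b] ! j) = v}"
    using assms by auto
  also have "real (card \<dots>) = (\<Sum>j<n. of_bool (f (xs ! j) (ys[i := b] ! j) = v))"
    by (simp add: sum_of_bool_eq)
  also have "\<dots> = of_bool (f (xs ! i) b = v) + (\<Sum>j\<in>{..<n} - {i}. of_bool (f (xs ! j) (ys[i := b] ! j) = v))"
    using assms by (subst sum.remove[of _ i]) auto
  also have "(\<Sum>j\<in>{..<n} - {i}. of_bool (f (xs ! j) (ys[i := b] ! j) = v) :: real)
     = (\<Sum>j\<in>{..<n} - {i}. of_bool (f (xs ! j) (ys ! j) = v))"
    by (intro sum.cong) auto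
  finally show ?thesis .
qed

text \<open>\<open>t\<close> is the decoder at a fixed message. Only differences of answers enter,
  and \<open>ys\<close> only through updates at \<open>i\<close>, so the set ignores the
  \<open>i\<close>-th letter of \<open>ys\<close>.\<close>

definition compatible ::
  "nat \<Rightarrow> (nat \<times> nat) set \<Rightarrow> (nat \<Rightarrow> nat \<Rightarrow> nat) \<Rightarrow> nat \<Rightarrow> (nat list \<Rightarrow> nat \<Rightarrow> real) \<Rightarrow> nat \<Rightarrow> nat list \<Rightarrow> nat set" where
  "compatible nx S f n t i ys = {x. x < nx \<and> (\<forall>b b'. (x, b) \<in> S \<longrightarrow> (x, b') \<in> S \<longrightarrow>
    (\<forall>v. of_bool (f x b = v) - of_bool (f x b' = v)
       = real n * t (ys[i := b]) v - real n * t (ys[i := b']) v))}"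

text \<open>If the true letter is missed, the decoder errs on \<open>ys[i := b]\<close> for some
  possible \<open>b\<close>, and that pair of words is at least \<open>c\<close> times as likely.
  One factor \<open>ny\<close> is the union over \<open>b\<close>, the other counts the words with a
  common update.\<close>

lemma compatible_miss_prob:
  assumes joint: "is_joint_dist nx ny P" and i: "i < n"
    and c: "c > 0" "\<And>x y. (x, y) \<in> support nx ny P \<Longrightarrow> c \<le> P x y"
  shows "(\<Sum>xs\<in>words {..<nx} n. \<Sum>ys\<in>words {..<ny} n. (\<Prod>j<n. P (xs ! j) (ys ! j)) *
      of_bool (xs ! i \<notin> compatible nx (support nx ny P) f n (dec (enc xs)) i ys))
    \<le> real ny * real ny / c * err_prob nx ny P n (type_fun f) enc dec"
proof -
  let ?X = "words {..<nx} n" and ?Y = "words {..<ny} n" and ?S = "support nx ny P"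
  define p where "p xs ys = (\<Prod>j<n. P (xs ! j) (ys ! j))" for xs ys
  define H where "H xs ys = (if dec (enc xs) ys \<noteq> type_fun f xs ys then p xs ys else 0)" for xs ys
  have P0: "P x y \<ge> 0" if "x < nx" "y < ny" for x y using joint that by (auto simp: is_joint_dist_def)
  have nthX: "xs ! i < nx" if "xs \<in> ?X" "i < n" for xs i using words_nth[OF that] by simp
  have nthY: "ys ! i < ny" if "ys \<in> ?Y" "i < n" for ys i using words_nth[OF that] by simp
  have p0: "p xs ys \<ge> 0" if "xs \<in> ?X" "ys \<in> ?Y" for xs ys
    unfolding p_def using that by (intro prod_nonneg) (auto intro: P0 nthX nthY)
  have err: "err_prob nx ny P n (type_fun f) enc dec = (\<Sum>xs\<in>?X. \<Sum>ys\<in>?Y. H xs ys)"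
    unfolding err_prob_def seqs_eq_words H_def p_def
    by (intro sum.cong refl) (simp add: prod_dist_eq)
  have H0: "H xs ys \<ge> 0" if "xs \<in> ?X" "ys \<in> ?Y" for xs ys
    unfolding H_def using p0[OF that] by simp
  have pt: "p xs ys * of_bool (xs ! i \<notin> compatible nx ?S f n (dec (enc xs)) i ys) \<le> (\<Sum>b<ny. H xs (ys[i := b])) / c"
    if xs: "xs \<in> ?X" and ys: "ys \<in> ?Y" for xs ys
  proof (cases "xs ! i \<in> compatible nx ?S f n (dec (enc xs)) i ys")
    case True
    then show ?thesis using H0[OF xs] words_update[OF ys] c by (auto intro!: divide_nonneg_pos sum_nonneg)
  next
    case False
    have "\<exists>b. (xs ! i, b) \<in> ?S \<and> dec (enc xs) (ys[i := b]) \<noteq> type_fun f xs (ys[i := b])"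
    proof (rule ccontr)
      assume "\<not> ?thesis"
      then have "dec (enc xs) (ys[i := b]) = type_fun f xs (ys[i := b])" if "(xs ! i, b) \<in> ?S" for b
        using that by blast
      then have "xs ! i \<in> compatible nx ?S f n (dec (enc xs)) i ys"
        unfolding compatible_def
        using nthX[OF xs i] type_fun_update[OF words_length[OF xs] words_length[OF ys] i, of f] by simp
      with False show False by blast
    qed
    then obtain b where b: "(xs ! i, b) \<in> ?S" "dec (enc xs) (ys[i := b]) \<noteq> type_fun f xs (ys[i := b])" by blast
    then have bn: "b < ny" by (simp add: support_def)
    \<comment> \<open>The old and the updated word differ in one factor of the law: at most 1 for
      the old letter, at least \<open>c\<close> for the new one.\<close>
    let ?R = "\<Prod>j\<in>{..<n} - {i}. P (xs ! j) (ys ! j)"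
    have R0: "?R \<ge> 0" using xs ys by (intro prod_nonneg) (auto intro: P0 nthX nthY)
    have "p xs (ys[i := b]) = P (xs ! i) b * ?R"
      unfolding p_def prod_split_coord[OF i] using i words_length[OF ys]
      by (intro arg_cong2[where f = "(*)"] prod.cong) auto
    moreover have "p xs ys = P (xs ! i) (ys ! i) * ?R" unfolding p_def by (rule prod_split_coord[OF i])
    moreover have "P (xs ! i) (ys ! i) * ?R \<le> 1 * ?R"
      using R0 joint_dist_le_1[OF joint nthX[OF xs i] nthY[OF ys i]] by (intro mult_right_mono)
    moreover have "c * ?R \<le> P (xs ! i) b * ?R" using R0 c(2)[OF b(1)] by (intro mult_right_mono)
    ultimately have le: "p xs ys \<le> ?R" "?R \<le> p xs (ys[i := b]) / c"
      using c(1) by (simp_all add: pos_le_divide_eq mult.commute)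
    note le(1)
    also note le(2)
    also have "\<dots> = H xs (ys[i := b]) / c" using b by (simp add: H_def)
    also have "\<dots> \<le> (\<Sum>b<ny. H xs (ys[i := b])) / c"
      using c(1) bn H0[OF xs] words_update[OF ys]
      by (intro divide_right_mono member_le_sum[of b _ "\<lambda>b. H xs (ys[i := b])"]) auto
    finally show ?thesis using False by simp
  qed
  have "(\<Sum>xs\<in>?X. \<Sum>ys\<in>?Y. p xs ys * of_bool (xs ! i \<notin> compatible nx ?S f n (dec (enc xs)) i ys))
    \<le> (\<Sum>xs\<in>?X. \<Sum>ys\<in>?Y. (\<Sum>b<ny. H xs (ys[i := b])) / c)"
    by (intro sum_mono pt)
  also have "\<dots> = (\<Sum>xs\<in>?X. \<Sum>b<ny. \<Sum>ys\<in>?Y. H xs (ys[i := b])) / c"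
    by (simp only: sum_divide_distrib [symmetric] sum.swap[of _ "{..<ny}" ?Y])
  also have "\<dots> \<le> (\<Sum>xs\<in>?X. \<Sum>b<ny. real ny * (\<Sum>ys\<in>?Y. H xs ys)) / c"
  proof (intro divide_right_mono sum_mono)
    fix xs b assume "xs \<in> ?X" "b \<in> {..<ny}"
    then show "(\<Sum>ys\<in>?Y. H xs (ys[i := b])) \<le> real ny * (\<Sum>ys\<in>?Y. H xs ys)"
      using sum_words_update_le[OF _ i, of "{..<ny}" b "H xs"] H0 by simp
  qed (use c in simp)
  also have "\<dots> = real ny * real ny / c * err_prob nx ny P n (type_fun f) enc dec"
    unfolding err by (simp add: mult.assoc flip: sum_distrib_left)
  finally show ?thesis unfolding p_def .
qed

text \<open>Some coordinate has at most the average information; choosing it, instead of averaging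
  the channels, avoids a convexity argument. The mass on hyperedges missing the letter is bounded by
  a multiple of the error probability.\<close>

lemma block_converse:
  assumes joint: "is_joint_dist nx ny P" and n: "n > 0"
    and marg: "\<forall>x<nx. (\<Sum>y<ny. P x y) > 0"
    and c: "c > 0" "\<And>x y. (x, y) \<in> support nx ny P \<Longrightarrow> c \<le> P x y"
    and enc: "\<And>xs. xs \<in> seqs nx n \<Longrightarrow> enc xs < M"
    and E: "E = max_solvable_hyperedges nx ny (support nx ny P) f"
  shows "\<exists>Q. (\<forall>w\<in>E. \<forall>x<nx. 0 \<le> Q w x) \<and> (\<forall>x<nx. (\<Sum>w\<in>E. Q w x) = 1) \<and>
    (\<forall>w\<in>E. \<forall>x<nx. x \<notin> w \<longrightarrow> (\<Sum>y<ny. P x y) * Q w x \<le> real ny * real ny / c * err_prob nx ny P n (type_fun f) enc dec) \<and>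
    cond_mi nx ny P E Q \<le> log 2 (real M) / real n"
proof -
  let ?X = "words {..<nx} n" and ?Y = "words {..<ny} n" and ?S = "support nx ny P"
  let ?p = "\<lambda>xs ys. \<Prod>j<n. P (xs ! j) (ys ! j)"
  have finE: "finite E" unfolding E by (rule finite_max_solvable_hyperedges)
  have P0: "P x y \<ge> 0" if "x < nx" "y < ny" for x y using joint that by (auto simp: is_joint_dist_def)
  have nthX: "xs ! i < nx" if "xs \<in> ?X" "i < n" for xs i using words_nth[OF that] by simp
  have nthY: "ys ! i < ny" if "ys \<in> ?Y" "i < n" for ys i using words_nth[OF that] by simp
  have p0: "?p xs ys \<ge> 0" if "xs \<in> ?X" "ys \<in> ?Y" for xs ys
    using that by (intro prod_nonneg) (auto intro: P0 nthX nthY)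
  have ny: "ny > 0" using joint by (cases "ny = 0") (auto simp: is_joint_dist_def)
  \<comment> \<open>The choice sees \<open>ys\<close> only through the compatible set, so
    \<open>edge\<close> also ignores the \<open>i\<close>-th letter of \<open>ys\<close>.\<close>
  define edge where "edge i m ys = (SOME e. e \<in> E \<and> compatible nx ?S f n (dec m) i ys \<subseteq> e)" for i m ys
  have edge: "edge i m ys \<in> E \<and> compatible nx ?S f n (dec m) i ys \<subseteq> edge i m ys" for i m ys
  proof -
    have "solvable_hyperedge nx ny ?S f (compatible nx ?S f n (dec m) i ys)"
      unfolding compatible_def
      by (rule solvable_hyperedge_if_potential[where G = "\<lambda>b v. real n * dec m (ys[i := b]) v"])
    then have "\<exists>e. e \<in> E \<and> compatible nx ?S f n (dec m) i ys \<subseteq> e"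
      using ex_max_solvable_hyperedge_superset E by blast
    then show ?thesis unfolding edge_def by (rule someI_ex)
  qed
  have upd: "edge i m (ys[i := b]) = edge i m ys" for i m ys b
    unfolding edge_def compatible_def by simp
  obtain Q where Q0: "\<And>i w x. w \<in> E \<Longrightarrow> x < nx \<Longrightarrow> Q i w x \<ge> 0"
    and PQ: "\<And>i w x y. i < n \<Longrightarrow> x < nx \<Longrightarrow> y < ny \<Longrightarrow> P x y * Q i w x =
       (\<Sum>xs\<in>?X. \<Sum>ys\<in>?Y. ?p xs ys * of_bool (xs ! i = x \<and> ys ! i = y \<and> edge i (enc xs) ys = w))"
    and mi: "(\<Sum>i<n. cond_mi nx ny P E (Q i)) \<le> log 2 (real M)"
    using single_letterization[OF joint ny finE, of edge n enc M] edge upd enc unfolding seqs_eq_words by blast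
  have "\<exists>i\<in>{..<n}. cond_mi nx ny P E (Q i) \<le> log 2 (real M) / real n"
    by (rule weighted_average_le_ex[where w = "\<lambda>_. 1 / real n"])
      (use n mi in \<open>simp_all add: divide_right_mono flip: sum_divide_distrib\<close>)
  then obtain i where i: "i < n" and le: "cond_mi nx ny P E (Q i) \<le> log 2 (real M) / real n" by auto
  have pX: "(\<Sum>y<ny. P x y) * Q i w x = (\<Sum>xs\<in>?X. \<Sum>ys\<in>?Y. ?p xs ys * of_bool (xs ! i = x \<and> edge i (enc xs) ys = w))"
    if x: "x < nx" for w x
  proof -
    have "(\<Sum>y<ny. P x y) * Q i w x
      = (\<Sum>y<ny. \<Sum>xs\<in>?X. \<Sum>ys\<in>?Y. ?p xs ys * of_bool (xs ! i = x \<and> ys ! i = y \<and> edge i (enc xs) ys = w))"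
      unfolding sum_distrib_right using PQ[OF i x] by (intro sum.cong) auto
    also have "\<dots> = (\<Sum>xs\<in>?X. \<Sum>ys\<in>?Y. \<Sum>y<ny. ?p xs ys * of_bool (xs ! i = x \<and> ys ! i = y \<and> edge i (enc xs) ys = w))"
      by (subst sum.swap, intro sum.cong refl, rule sum.swap)
    also have "\<dots> = (\<Sum>xs\<in>?X. \<Sum>ys\<in>?Y. ?p xs ys * of_bool (xs ! i = x \<and> edge i (enc xs) ys = w))"
    proof (intro sum.cong refl)
      fix xs ys assume "ys \<in> ?Y"
      then have "ys ! i < ny" using nthY i by blast
      moreover have "(\<Sum>y<ny. ?p xs ys * of_bool (xs ! i = x \<and> ys ! i = y \<and> edge i (enc xs) ys = w))
        = (\<Sum>y<ny. if y = ys ! i then ?p xs ys * of_bool (xs ! i = x \<and> edge i (enc xs) ys = w) else 0)"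
        by (intro sum.cong refl) auto
      ultimately show "(\<Sum>y<ny. ?p xs ys * of_bool (xs ! i = x \<and> ys ! i = y \<and> edge i (enc xs) ys = w))
        = ?p xs ys * of_bool (xs ! i = x \<and> edge i (enc xs) ys = w)" by simp
    qed
    finally show ?thesis .
  qed
  have Q1: "(\<Sum>w\<in>E. Q i w x) = 1" if x: "x < nx" for x
  proof -
    have "(\<Sum>y<ny. P x y) * (\<Sum>w\<in>E. Q i w x)
      = (\<Sum>w\<in>E. \<Sum>xs\<in>?X. \<Sum>ys\<in>?Y. ?p xs ys * of_bool (xs ! i = x \<and> edge i (enc xs) ys = w))"
      unfolding sum_distrib_left using pX[OF x] by (intro sum.cong) auto
    also have "\<dots> = (\<Sum>xs\<in>?X. \<Sum>ys\<in>?Y. \<Sum>w\<in>E. ?p xs ys * of_bool (xs ! i = x \<and> edge i (enc xs) ys = w))"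
      by (subst sum.swap, intro sum.cong refl, rule sum.swap)
    also have "\<dots> = (\<Sum>xs\<in>?X. \<Sum>ys\<in>?Y. ?p xs ys * of_bool (xs ! i = x))"
    proof (intro sum.cong refl)
      fix xs ys
      have "(\<Sum>w\<in>E. ?p xs ys * of_bool (xs ! i = x \<and> edge i (enc xs) ys = w))
        = (\<Sum>w\<in>E. if w = edge i (enc xs) ys then ?p xs ys * of_bool (xs ! i = x) else 0)"
        by (intro sum.cong refl) auto
      then show "(\<Sum>w\<in>E. ?p xs ys * of_bool (xs ! i = x \<and> edge i (enc xs) ys = w)) = ?p xs ys * of_bool (xs ! i = x)"
        using finE edge by simp
    qed
    also have "\<dots> = (\<Sum>xs\<in>?X. (\<Prod>j<n. \<Sum>y<ny. P (xs ! j) y) * of_bool (xs ! i = x))"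
      unfolding sum_distrib_right [symmetric]
      by (intro sum.cong refl arg_cong2[where f = "(*)"], rule sum_prod_words[where g = "\<lambda>j. P (xs ! j)" for xs])
    also have "\<dots> = (\<Sum>x'<nx. (\<Sum>y<ny. P x' y) * of_bool (x' = x))"
      by (rule sum_words_one_coord[where r = "\<lambda>x. \<Sum>y<ny. P x y" and g = "\<lambda>x'. of_bool (x' = x)"])
        (use joint i in \<open>auto simp: is_joint_dist_def\<close>)
    also have "\<dots> = (\<Sum>x'<nx. if x' = x then (\<Sum>y<ny. P x' y) else 0)" by (intro sum.cong) auto
    also have "\<dots> = (\<Sum>y<ny. P x y)" using x by simp
    finally have "(\<Sum>y<ny. P x y) * (\<Sum>w\<in>E. Q i w x) = (\<Sum>y<ny. P x y)" .
    moreover have "(\<Sum>y<ny. P x y) \<noteq> 0" using marg x by force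
    ultimately show ?thesis by simp
  qed
  have miss: "(\<Sum>y<ny. P x y) * Q i w x \<le> real ny * real ny / c * err_prob nx ny P n (type_fun f) enc dec"
    if x: "x < nx" "x \<notin> w" for w x
  proof -
    have "(\<Sum>y<ny. P x y) * Q i w x
      \<le> (\<Sum>xs\<in>?X. \<Sum>ys\<in>?Y. ?p xs ys * of_bool (xs ! i \<notin> compatible nx ?S f n (dec (enc xs)) i ys))"
      unfolding pX[OF x(1)]
    proof (intro sum_mono mult_left_mono p0)
      fix xs ys
      show "of_bool (xs ! i = x \<and> edge i (enc xs) ys = w)
        \<le> (of_bool (xs ! i \<notin> compatible nx ?S f n (dec (enc xs)) i ys) :: real)"
        using edge[of i "enc xs" ys] x by auto
    qed auto
    also note compatible_miss_prob[OF joint i c]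
    finally show ?thesis .
  qed
  show ?thesis using Q0 Q1 miss le by (intro exI[of _ "Q i"]) auto
qed

section \<open>Compactness of channels and continuity of the conditional information\<close>

lemma ex_convergent_subseq_finite:
  fixes a :: "nat \<Rightarrow> 'i \<Rightarrow> real"
  assumes "finite I" "\<And>n i. i \<in> I \<Longrightarrow> \<bar>a n i\<bar> \<le> B"
  shows "\<exists>r. strict_mono (r :: nat \<Rightarrow> nat) \<and> (\<forall>i\<in>I. convergent (\<lambda>n. a (r n) i))"
  using assms
proof (induction I rule: finite_induct)
  case empty
  then show ?case by (intro exI[of _ id]) (auto simp: strict_mono_def)
next
  case (insert j I)
  then obtain r where r: "strict_mono r" "\<And>i. i \<in> I \<Longrightarrow> convergent (\<lambda>n. a (r n) i)" by auto
  \<comment> \<open>Bolzano-Weierstrass one coordinate at a time: the new coordinate has a monotone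
    subsequence, and the earlier ones stay convergent along it.\<close>
  obtain s where s: "strict_mono s" "monoseq (\<lambda>n. a (r (s n)) j)"
    using seq_monosub[of "\<lambda>n. a (r n) j"] by (auto simp: o_def)
  have "Bseq (\<lambda>n. a (r (s n)) j)" using insert.prems by (intro BseqI'[of _ B]) auto
  then have "convergent (\<lambda>n. a (r (s n)) j)" using s(2) by (rule Bseq_monoseq_convergent)
  moreover have "convergent (\<lambda>n. a (r (s n)) i)" if "i \<in> I" for i
    using convergent_subseq_convergent[OF r(2)[OF that] s(1)] by (simp add: o_def)
  moreover have "strict_mono (r \<circ> s)" using r(1) s(1) by (rule strict_mono_o)
  ultimately show ?case by (intro exI[of _ "r \<circ> s"]) (auto simp: o_def)
qed

text \<open>The delicate limit is 0, where the function is continuous from the right with value 0.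
  It does occur: limit channels vanish on hyperedges that miss the letter.\<close>

lemma tendsto_times_log:
  fixes a :: "nat \<Rightarrow> real"
  assumes "a \<longlonglongrightarrow> l" "\<And>n. a n \<ge> 0"
  shows "(\<lambda>n. a n * log 2 (a n)) \<longlonglongrightarrow> l * log 2 l"
proof -
  have l: "l \<ge> 0" using assms by (intro LIMSEQ_le_const[of a]) auto
  have "continuous_on {0..} (\<lambda>t::real. t * log 2 t)"
    unfolding continuous_on_def
  proof
    fix t :: real assume "t \<in> {0..}"
    show "((\<lambda>t. t * log 2 t) \<longlongrightarrow> t * log 2 t) (at t within {0..})"
    proof (cases "t = 0")
      case True
      have "((\<lambda>t::real. t * log 2 t) \<longlongrightarrow> 0) (at_right 0)" by real_asymp
      then show ?thesis using True by (simp add: at_within_Ici_at_right)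
    next
      case False
      then show ?thesis using \<open>t \<in> {0..}\<close> by (auto intro!: tendsto_intros)
    qed
  qed
  then show ?thesis
    by (rule continuous_on_tendsto_compose) (use assms l in auto)
qed

text \<open>Written through \<open>t * log 2 t\<close>, the information has neither case distinction
  nor quotient and is continuous up to channels with zero entries; the logarithm of the y-marginal
  is constant in \<open>Q\<close>.\<close>

lemma cond_mi_eq_times_log:
  assumes joint: "is_joint_dist nx ny P" and Q: "\<And>w x. w \<in> E \<Longrightarrow> x < nx \<Longrightarrow> Q w x \<ge> 0"
  shows "cond_mi nx ny P E Q = (\<Sum>w\<in>E. \<Sum>y<ny. (\<Sum>x<nx. P x y * (Q w x * log 2 (Q w x)))
    + (\<Sum>x<nx. P x y * Q w x) * log 2 (\<Sum>x<nx. P x y)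
    - (\<Sum>x<nx. P x y * Q w x) * log 2 (\<Sum>x<nx. P x y * Q w x))"
proof -
  have P0: "P x y \<ge> 0" if "x < nx" "y < ny" for x y using joint that by (auto simp: is_joint_dist_def)
  have "cond_mi nx ny P E Q = (\<Sum>w\<in>E. \<Sum>x<nx. \<Sum>y<ny. P x y * (Q w x * log 2 (Q w x))
      + P x y * Q w x * log 2 (\<Sum>x<nx. P x y) - P x y * Q w x * log 2 (\<Sum>x<nx. P x y * Q w x))"
    unfolding cond_mi_def Let_def
  proof (intro sum.cong refl)
    fix w x y assume w: "w \<in> E" and "x \<in> {..<nx}" and "y \<in> {..<ny}"
    then have x: "x < nx" and y: "y < ny" by auto
    let ?py = "\<Sum>x<nx. P x y" and ?pwy = "\<Sum>x<nx. P x y * Q w x"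
    show "(if 0 < P x y * Q w x then P x y * Q w x * log 2 (P x y * Q w x * ?py / (?pwy * P x y)) else 0)
      = P x y * (Q w x * log 2 (Q w x)) + P x y * Q w x * log 2 ?py - P x y * Q w x * log 2 ?pwy"
    proof (cases "0 < P x y * Q w x")
      case True
      then have Pp: "P x y > 0" and Qp: "Q w x > 0"
        using P0[OF x y] Q[OF w x] by (auto simp: zero_less_mult_iff)
      have pyp: "?py > 0" using Pp P0 x y by (intro sum_pos2[of _ x]) auto
      have pwyp: "?pwy > 0" using True P0 Q w x y by (intro sum_pos2[of _ x]) auto
      have "P x y * Q w x * ?py / (?pwy * P x y) = Q w x * ?py / ?pwy" using Pp by simp
      also have "log 2 \<dots> = log 2 (Q w x) + log 2 ?py - log 2 ?pwy"
        using Qp pyp pwyp by (simp add: log_divide log_mult)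
      finally have eq: "log 2 (P x y * Q w x * ?py / (?pwy * P x y)) = log 2 (Q w x) + log 2 ?py - log 2 ?pwy" .
      show ?thesis using True unfolding eq by (simp add: algebra_simps)
    next
      case False
      moreover have "0 \<le> P x y * Q w x" using P0[OF x y] Q[OF w x] by simp
      ultimately have "P x y * Q w x = 0" by simp
      then show ?thesis by auto
    qed
  qed
  also have "\<dots> = (\<Sum>w\<in>E. \<Sum>y<ny. \<Sum>x<nx. P x y * (Q w x * log 2 (Q w x))
      + P x y * Q w x * log 2 (\<Sum>x<nx. P x y) - P x y * Q w x * log 2 (\<Sum>x<nx. P x y * Q w x))"
    by (rule sum.cong[OF refl], rule sum.swap)
  finally show ?thesis by (simp only: sum.distrib sum_subtractf sum_distrib_right)
qed

lemma tendsto_cond_mi: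
  assumes joint: "is_joint_dist nx ny P"
    and Q: "\<And>n w x. w \<in> E \<Longrightarrow> x < nx \<Longrightarrow> Qs n w x \<ge> 0"
    and lim: "\<And>w x. w \<in> E \<Longrightarrow> x < nx \<Longrightarrow> (\<lambda>n. Qs n w x) \<longlonglongrightarrow> Q w x"
  shows "(\<lambda>n. cond_mi nx ny P E (Qs n)) \<longlonglongrightarrow> cond_mi nx ny P E Q"
proof -
  have P0: "P x y \<ge> 0" if "x < nx" "y < ny" for x y using joint that by (auto simp: is_joint_dist_def)
  have Q0: "Q w x \<ge> 0" if "w \<in> E" "x < nx" for w x
    using lim[OF that] Q[OF that] by (intro LIMSEQ_le_const[of "\<lambda>n. Qs n w x"]) auto
  define F where "F Q = (\<Sum>w\<in>E. \<Sum>y<ny. (\<Sum>x<nx. P x y * (Q w x * log 2 (Q w x)))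
    + (\<Sum>x<nx. P x y * Q w x) * log 2 (\<Sum>x<nx. P x y)
    - (\<Sum>x<nx. P x y * Q w x) * log 2 (\<Sum>x<nx. P x y * Q w x))" for Q
  have "cond_mi nx ny P E Q = F Q" "\<And>n. cond_mi nx ny P E (Qs n) = F (Qs n)"
    unfolding F_def by (rule cond_mi_eq_times_log[OF joint], use Q0 Q in simp)+
  moreover have "(\<lambda>n. F (Qs n)) \<longlonglongrightarrow> F Q"
    unfolding F_def
    by (intro tendsto_sum tendsto_add tendsto_diff tendsto_mult tendsto_const tendsto_times_log lim)
      (auto intro!: sum_nonneg mult_nonneg_nonneg P0 Q)
  ultimately show ?thesis by simp
qed

lemma achievable_imp_channel:
  assumes joint: "is_joint_dist nx ny P" and marg: "\<forall>x<nx. (\<Sum>y<ny. P x y) > 0"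
    and ach: "achievable nx ny P (\<lambda>n. type_fun f) R"
    and E: "E = max_solvable_hyperedges nx ny (support nx ny P) f"
  shows "\<exists>Q. hyper_channel nx E Q \<and> cond_mi nx ny P E Q \<le> R"
proof -
  have finE: "finite E" unfolding E by (rule finite_max_solvable_hyperedges)
  obtain c where c: "c > 0" "\<And>x y. (x, y) \<in> support nx ny P \<Longrightarrow> c \<le> P x y"
    using ex_min_support_prob by blast
  obtain M enc dec where enc: "\<And>n xs. xs \<in> seqs nx n \<Longrightarrow> enc n xs < M n"
    and err: "(\<lambda>n. err_prob nx ny P n (type_fun f) (enc n) (dec n)) \<longlonglongrightarrow> 0"
    and rate: "limsup (\<lambda>n. ereal (log 2 (real (M n)) / real n)) \<le> ereal R"
    using ach unfolding achievable_def by blast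
  define \<epsilon> where "\<epsilon> n = real ny * real ny / c * err_prob nx ny P n (type_fun f) (enc n) (dec n)" for n
  have eps: "\<epsilon> \<longlonglongrightarrow> 0" unfolding \<epsilon>_def [abs_def] by (rule tendsto_mult_right_zero[OF err])
  \<comment> \<open>Shifted to \<open>Suc n\<close>, since \<open>block_converse\<close> asks for a
    positive block length.\<close>
  have "\<exists>Q. (\<forall>w\<in>E. \<forall>x<nx. 0 \<le> Q w x) \<and> (\<forall>x<nx. (\<Sum>w\<in>E. Q w x) = 1) \<and>
    (\<forall>w\<in>E. \<forall>x<nx. x \<notin> w \<longrightarrow> (\<Sum>y<ny. P x y) * Q w x \<le> \<epsilon> (Suc n)) \<and>
    cond_mi nx ny P E Q \<le> log 2 (real (M (Suc n))) / real (Suc n)" for n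
    unfolding \<epsilon>_def by (rule block_converse[OF joint _ marg c enc E]) auto
  then obtain Qs where Q0: "\<And>n w x. w \<in> E \<Longrightarrow> x < nx \<Longrightarrow> 0 \<le> Qs n w x"
    and Q1: "\<And>n x. x < nx \<Longrightarrow> (\<Sum>w\<in>E. Qs n w x) = 1"
    and miss: "\<And>n w x. w \<in> E \<Longrightarrow> x < nx \<Longrightarrow> x \<notin> w \<Longrightarrow> (\<Sum>y<ny. P x y) * Qs n w x \<le> \<epsilon> (Suc n)"
    and mi: "\<And>n. cond_mi nx ny P E (Qs n) \<le> log 2 (real (M (Suc n))) / real (Suc n)"
    by metis
  have Qle: "Qs n w x \<le> 1" if "w \<in> E" "x < nx" for n w x
    using member_le_sum[of w E "\<lambda>w. Qs n w x"] Q0 Q1 that finE by simp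
  have "\<exists>r. strict_mono (r :: nat \<Rightarrow> nat) \<and> (\<forall>i\<in>E \<times> {..<nx}. convergent (\<lambda>n. Qs (r n) (fst i) (snd i)))"
    using ex_convergent_subseq_finite[of "E \<times> {..<nx}" "\<lambda>n i. Qs n (fst i) (snd i)" 1] finE Q0 Qle by fastforce
  then obtain r where r: "strict_mono (r :: nat \<Rightarrow> nat)"
    and conv: "\<And>w x. w \<in> E \<Longrightarrow> x < nx \<Longrightarrow> convergent (\<lambda>n. Qs (r n) w x)" by fastforce
  define Q where "Q w x = lim (\<lambda>n. Qs (r n) w x)" for w x
  have lim: "(\<lambda>n. Qs (r n) w x) \<longlonglongrightarrow> Q w x" if "w \<in> E" "x < nx" for w x
    unfolding Q_def using conv[OF that] by (simp add: convergent_LIMSEQ_iff)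
  have sub: "strict_mono (\<lambda>n. Suc (r n))" using r by (simp add: strict_mono_def)
  have nonneg: "Q w x \<ge> 0" if "w \<in> E" "x < nx" for w x
    using lim[OF that] Q0[OF that] by (intro LIMSEQ_le_const[of "\<lambda>n. Qs (r n) w x"]) auto
  have zero: "Q w x = 0" if wx: "w \<in> E" "x < nx" "x \<notin> w" for w x
  proof -
    have "(\<Sum>y<ny. P x y) * Q w x \<le> 0"
    proof (rule LIMSEQ_le)
      show "(\<lambda>n. (\<Sum>y<ny. P x y) * Qs (r n) w x) \<longlonglongrightarrow> (\<Sum>y<ny. P x y) * Q w x"
        by (intro tendsto_mult tendsto_const lim wx)
      show "(\<lambda>n. \<epsilon> (Suc (r n))) \<longlonglongrightarrow> 0" using LIMSEQ_subseq_LIMSEQ[OF eps sub] by (simp add: o_def)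
      show "\<exists>N. \<forall>n\<ge>N. (\<Sum>y<ny. P x y) * Qs (r n) w x \<le> \<epsilon> (Suc (r n))" using miss[OF wx] by blast
    qed
    then show ?thesis using marg wx nonneg[OF wx(1,2)] by (force simp: mult_le_0_iff)
  qed
  have sum1: "(\<Sum>w\<in>E. Q w x) = 1" if "x < nx" for x
  proof (rule LIMSEQ_unique)
    show "(\<lambda>n. \<Sum>w\<in>E. Qs (r n) w x) \<longlonglongrightarrow> (\<Sum>w\<in>E. Q w x)" using that by (intro tendsto_sum lim)
    show "(\<lambda>n. \<Sum>w\<in>E. Qs (r n) w x) \<longlonglongrightarrow> 1" using Q1[OF that] by simp
  qed
  have "hyper_channel nx E Q" unfolding hyper_channel_def using nonneg zero sum1 by blast
  \<comment> \<open>The limit superior bounds the rates by \<open>R + d\<close> only eventually,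
    hence the slack \<open>d\<close>.\<close>
  moreover have "cond_mi nx ny P E Q \<le> R"
  proof (rule field_le_epsilon)
    fix d :: real assume d: "d > 0"
    have "limsup (\<lambda>n. ereal (log 2 (real (M n)) / real n)) < ereal (R + d)"
      using rate by (rule order_le_less_trans) (use d in simp)
    then have ev: "eventually (\<lambda>n. ereal (log 2 (real (M n)) / real n) < ereal (R + d)) sequentially"
      by (rule Limsup_lessD)
    have "eventually (\<lambda>n. cond_mi nx ny P E (Qs (r n)) \<le> R + d) sequentially"
      using eventually_subseq[OF sub ev]
    proof (rule eventually_mono)
      fix n assume "ereal (log 2 (real (M (Suc (r n)))) / real (Suc (r n))) < ereal (R + d)"
      then show "cond_mi nx ny P E (Qs (r n)) \<le> R + d" using mi[of "r n"] by simp
    qed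
    moreover have "(\<lambda>n. cond_mi nx ny P E (Qs (r n))) \<longlonglongrightarrow> cond_mi nx ny P E Q"
      using Q0 lim by (intro tendsto_cond_mi[OF joint]) auto
    ultimately show "cond_mi nx ny P E Q \<le> R + d"
      by (intro tendsto_upperbound) auto
  qed
  ultimately show ?thesis by blast
qed

section \<open>Comparison of the two infima\<close>

theorem theorem2:
  fixes nx ny m :: nat and P :: "nat \<Rightarrow> nat \<Rightarrow> real" and f :: "nat \<Rightarrow> nat \<Rightarrow> nat"
  assumes "is_joint_dist nx ny P"
    and "\<forall>x<nx. (\<Sum>y<ny. P x y) > 0"
    and "\<forall>x<nx. \<forall>y<ny. f x y < m"
  shows "opt_rate nx ny P (\<lambda>n. type_fun f)
         = cond_hypergraph_entropy nx ny P
             (max_solvable_hyperedges nx ny (support nx ny P) f)"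
proof -
  define E where "E = max_solvable_hyperedges nx ny (support nx ny P) f"
  define A where "A = {R. achievable nx ny P (\<lambda>n. type_fun f) R}"
  define H where "H = {cond_mi nx ny P E Q | Q. hyper_channel nx E Q}"
  have finE: "finite E" unfolding E_def by (rule finite_max_solvable_hyperedges)
  have solv: "solvable (support nx ny P) f w {0..<ny} \<and> w \<subseteq> {0..<nx}" if "w \<in> E" for w
    using that by (auto simp: E_def max_solvable_hyperedges_def solvable_hyperedge_def)
  have ch: "source_channel nx ny P E Q" if "hyper_channel nx E Q" for Q
    using assms(1) finE that by unfold_locales
  have H0: "h \<ge> 0" if "h \<in> H" for h using that source_channel.cond_mi_nonneg[OF ch] by (auto simp: H_def)
  \<comment> \<open>Together with \<open>AH\<close> this suffices for equal infima: each set has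
    elements below any element of the other, up to an arbitrary slack.\<close>
  have HA: "h + \<delta> \<in> A" if "h \<in> H" "\<delta> > 0" for h \<delta>
    using that source_channel.achievable_cond_mi[OF ch solv] by (auto simp: H_def A_def)
  have AH: "\<exists>h\<in>H. h \<le> R" if "R \<in> A" for R
    using that achievable_imp_channel[OF assms(1,2) _ E_def, of R] by (auto simp: A_def H_def)
  \<comment> \<open>Witnessed by the deterministic channel that sends each letter to one maximal
    hyperedge containing it.\<close>
  have "H \<noteq> {}"
  proof -
    have "\<exists>e\<in>E. x \<in> e" if "x < nx" for x
      using ex_max_solvable_hyperedge_superset[OF solvable_hyperedge_singleton[OF that]] by (auto simp: E_def)
    then obtain e where e: "\<And>x. x < nx \<Longrightarrow> e x \<in> E \<and> x \<in> e x" by metis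
    have "hyper_channel nx E (\<lambda>w x. of_bool (w = e x))"
      unfolding hyper_channel_def using e finE by (auto simp: of_bool_def)
    then show ?thesis by (auto simp: H_def)
  qed
  then have neA: "A \<noteq> {}" using HA[of _ 1] by force
  have A0: "R \<ge> 0" if "R \<in> A" for R using AH[OF that] H0 by force
  have "Inf A \<le> Inf H"
  proof (rule cInf_greatest[OF \<open>H \<noteq> {}\<close>])
    fix h assume "h \<in> H"
    show "Inf A \<le> h"
    proof (rule field_le_epsilon)
      fix d :: real assume "d > 0"
      then show "Inf A \<le> h + d" using HA[OF \<open>h \<in> H\<close>] A0 by (intro cInf_lower bdd_belowI[of A 0]) auto
    qed
  qed
  moreover have "Inf H \<le> Inf A"
  proof (rule cInf_greatest[OF neA])
    fix R assume "R \<in> A"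
    then obtain h where "h \<in> H" "h \<le> R" using AH by blast
    moreover have "Inf H \<le> h" using \<open>h \<in> H\<close> H0 by (intro cInf_lower bdd_belowI[of H 0]) auto
    ultimately show "Inf H \<le> R" by simp
  qed
  ultimately show ?thesis
    unfolding opt_rate_def cond_hypergraph_entropy_def A_def H_def E_def by simp
qed

end
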